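(* If $\mathcal{K}=(D,X,H,f)$ is an uncolorable degree-feasible configuration for which $D$ is connected, then $\mathcal{K}$ is constructible.
   Context: All digraphs are finite, without loops and parallel arcs (digons allowed); $d_D(v)=(d^+_D(v),d^-_D(v))$; pairs in $\mathbb{N}_0^2$ are compared and added coordinatewise. Connected, block (maximal connected subdigraph with no vertex whose removal disconnects it) refer to the underlying graph. $D^\pm(G)$: replace each edge of undirected $G$ by a digon. Antidirected cycle: underlying graph a cycle, each vertex a source or a sink. Cover of $D$: pair $(X,H)$, $H$ disjoint from $D$, $X_v\subseteq V(H)$ pairwise disjoint with union $V(H)$, each independent in $H$, arcs of $H$ from $X_u$ to $X_v$ ($u\ne v$) a matching if $uv\in A(D)$, none otherwise. Transversal: $|T\cap X_v|=1$ for all $v$. For $U\subseteq V(H)$, $(X,H)/U$ is the cover $(X',H[U])$ of $D[\{v:X_v\cap U\ne\varnothing\}]$ with $X'_v=X_v\cap U$. A cover is saturated if for every arc $uv$ the arcs from $X_u$ to $X_v$ form a perfect matching of $H[X_u\cup X_v]$. For $f:V(H)\to\mathbb{N}_0^2$, $f=(f^+,f^-)$, $f(Y)=\sum_{y\in Y}f(y)$; $H$ is strictly $f$-degenerate if every nonempty subdigraph $H'$ of $H$ has a vertex $x$ with $d^+_{H'}(x)<f^+(x)$ or $d^-_{H'}(x)<f^-(x)$. A configuration is $(D,X,H,f)$ with $(X,H)$ a cover of $D$ and $f:V(H)\to\mathbb{N}_0^2$; degree-feasible if $f(X_v)\ge d_D(v)$ for all $v$; colorable if some transversal $T$ has $H[T]$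 strictly $f$-degenerate; uncolorable otherwise. $(D,X,H,f)$ is constructible if one of: (I) $D$ is a block and there is a transversal $T$ with $(X,H)/T$ saturated, $f(x)=d_D(v)$ for $x\in T\cap X_v$, $f=(0,0)$ off $T$; (II) $D=D^\pm(K_n)$, $n\ge1$, $n_1+\dots+n_p=n-1$ with $n_i\in\mathbb{N}$, $p\ge1$, pairwise disjoint transversals $T_1,\dots,T_p$ with $(X,H)/T_i$ saturated, $f=(n_i,n_i)$ on $T_i$, $(0,0)$ elsewhere; (III) $D=D^\pm(C_n)$, $n\ge5$ odd, disjoint transversals $T_1,T_2$ with $(X,H)/T_i$ saturated, $f=(1,1)$ on $T_1\cup T_2$, $(0,0)$ elsewhere; (IV) $D=D^\pm(C_n)$, $n\ge4$ even, disjoint transversals $T_1,T_2$ with $H[T_1\cup T_2]=D^\pm(C_{2n})$, $f=(1,1)$ on $T_1\cup T_2$, $(0,0)$ elsewhere; (V) $D$ an antidirected cycle on $n\ge4$ vertices, $n$ even, disjoint transversals $T_1,T_2$ with $H[T_1\cup T_2]$ an antidirected cycle on $2n$ vertices, and for $x\in X_v\cap(T_1\cup T_2)$, $f(x)=(1,0)$ if $v$ is a source of $D$ and $(0,1)$ if $v$ is a sink, $f=(0,0)$ elsewhere; (VI) $(D,X,H,f)$ is obtained from disjoint constructible configurations $(D^i,X^i,H^i,f^i)$, $i=1,2$, with $|D^i|<|D|$, by identifying $v^1\in V(D^1)$ and $v^2\in V(D^2)$ into one vertex, choosing a bijection $\pi:X^1_{v^1}\to X^2_{v^2}$ and identifying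 each $x$ with $\pi(x)$ in $H$, with $f=f^i$ on $V(H^i)\setminus X^i_{v^i}$ and $f=f^1(x)+f^2(\pi(x))$ at the identified vertices.
   Formalization: H is assumed to have at least one vertex; this excludes only the case where D is a single vertex v with X_v empty, which is uncolorable and degree-feasible but not constructible. *)

theory Defs
  imports "Graph_Theory.Graph_Theory" "HOL-Library.Product_Order"
begin

text \<open>
  Digraphs are modelled by \<^typ>\<open>'a pair_pre_digraph\<close> subject to \<^locale>\<open>pair_digraph\<close>: finite,
  loopless, and without parallel arcs because arcs are ordered pairs; digons are allowed. A digraph
  and its cover have separate vertex types, which makes them disjoint. The instances from
  \<^theory>\<open>HOL-Library.Product_Order\<close> give the coordinatewise order and addition on
  \<^typ>\<open>nat \<times> nat\<close>.
\<close>

definition deg :: "'a pair_pre_digraph \<Rightarrow> 'a \<Rightarrow> nat \<times> nat" where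
  "deg D v = (out_degree D v, in_degree D v)"

definition induce :: "'a pair_pre_digraph \<Rightarrow> 'a set \<Rightarrow> 'a pair_pre_digraph" where
  "induce D U = \<lparr> pverts = pverts D \<inter> U, parcs = parcs D \<inter> U \<times> U \<rparr>"

lemma with_proj_induce:
  assumes "U \<subseteq> pverts D"
  shows "with_proj (induce D U) = with_proj D \<restriction> U"
  using assms by (auto simp: induce_def induce_subgraph_def with_proj_def)

definition separating_vertex :: "('a, 'b) pre_digraph \<Rightarrow> 'a \<Rightarrow> bool" where
  "separating_vertex G v \<longleftrightarrow> v \<in> verts G \<and> verts G - {v} \<noteq> {} \<and>
     \<not> Digraph_Component.connected (G \<restriction> (verts G - {v}))"

definition block_of :: "'a pair_pre_digraph \<Rightarrow> 'a pair_pre_digraph \<Rightarrow> bool" where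
  "block_of B D \<longleftrightarrow> pre_digraph.max_subgraph (with_proj D)
     (\<lambda>G. Digraph_Component.connected G \<and> (\<forall>v. \<not> separating_vertex G v)) (with_proj B)"

text \<open>A digraph is called a block when it is a block of itself.\<close>

abbreviation is_block :: "'a pair_pre_digraph \<Rightarrow> bool" where
  "is_block D \<equiv> block_of D D"


text \<open>Undirected simple graphs, given by a vertex set and a set of two-element edges.\<close>

type_synonym 'a ugraph = "'a set \<times> 'a set set"

definition complete_ugraph :: "nat \<Rightarrow> 'a ugraph \<Rightarrow> bool" where
  "complete_ugraph n G \<longleftrightarrow> finite (fst G) \<and> card (fst G) = n \<and>
     snd G = {{u, v} |u v. u \<in> fst G \<and> v \<in> fst G \<and> u \<noteq> v}"

definition cycle_ugraph :: "nat \<Rightarrow> 'a ugraph \<Rightarrow> bool" where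
  "cycle_ugraph n G \<longleftrightarrow> n \<ge> 3 \<and> (\<exists>c. bij_betw c {..<n} (fst G) \<and>
     snd G = {{c i, c (Suc i mod n)} |i. i < n})"

definition bidirect :: "'a ugraph \<Rightarrow> 'a pair_pre_digraph" where
  "bidirect G = \<lparr> pverts = fst G, parcs = {(u, v). u \<noteq> v \<and> {u, v} \<in> snd G} \<rparr>"

definition bidirected_complete :: "nat \<Rightarrow> 'a pair_pre_digraph \<Rightarrow> bool" where
  "bidirected_complete n D \<longleftrightarrow> (\<exists>G. complete_ugraph n G \<and> D = bidirect G)"

definition bidirected_cycle :: "nat \<Rightarrow> 'a pair_pre_digraph \<Rightarrow> bool" where
  "bidirected_cycle n D \<longleftrightarrow> (\<exists>G. cycle_ugraph n G \<and> D = bidirect G)"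

definition underlying :: "'a pair_pre_digraph \<Rightarrow> 'a ugraph" where
  "underlying D = (pverts D, {{u, v} |u v. (u, v) \<in> parcs D})"

definition source :: "'a pair_pre_digraph \<Rightarrow> 'a \<Rightarrow> bool" where
  "source D v \<longleftrightarrow> in_arcs D v = {}"

definition sink :: "'a pair_pre_digraph \<Rightarrow> 'a \<Rightarrow> bool" where
  "sink D v \<longleftrightarrow> out_arcs D v = {}"

text \<open>
  The edge set of the underlying graph forgets arc multiplicities, but the vertices of a digon are
  neither sources nor sinks, so no digon can occur below.
\<close>

definition antidirected_cycle :: "nat \<Rightarrow> 'a pair_pre_digraph \<Rightarrow> bool" where
  "antidirected_cycle n D \<longleftrightarrow> cycle_ugraph n (underlying D) \<and>
     (\<forall>v\<in>pverts D. source D v \<or> sink D v)"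


definition arcs_between :: "'a pair_pre_digraph \<Rightarrow> 'a set \<Rightarrow> 'a set \<Rightarrow> ('a \<times> 'a) set" where
  "arcs_between H A B = parcs H \<inter> A \<times> B"

definition matching :: "('a \<times> 'a) set \<Rightarrow> bool" where
  "matching M \<longleftrightarrow> (\<forall>e\<in>M. \<forall>e'\<in>M. e \<noteq> e' \<longrightarrow> {fst e, snd e} \<inter> {fst e', snd e'} = {})"

definition perfect_matching :: "'a pair_pre_digraph \<Rightarrow> ('a \<times> 'a) set \<Rightarrow> bool" where
  "perfect_matching H M \<longleftrightarrow> M \<subseteq> parcs H \<and> matching M \<and> (\<Union>e\<in>M. {fst e, snd e}) = pverts H"

text \<open>
  The sets \<open>X v\<close> may be empty. Then there is no transversal, and nothing is colorable or
  constructible. For connected \<open>D\<close> and a degree-feasible \<open>f\<close> this happens only when \<open>D\<close> is a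
  single vertex and \<open>H\<close> has no vertices, which is the case that \<open>pverts H \<noteq> {}\<close> excludes.
\<close>

definition cover :: "'a pair_pre_digraph \<Rightarrow> ('a \<Rightarrow> 'b set) \<Rightarrow> 'b pair_pre_digraph \<Rightarrow> bool" where
  "cover D X H \<longleftrightarrow> pair_digraph H \<and>
     (\<Union>v\<in>pverts D. X v) = pverts H \<and>
     (\<forall>u\<in>pverts D. \<forall>v\<in>pverts D. u \<noteq> v \<longrightarrow> X u \<inter> X v = {}) \<and>
     (\<forall>v\<in>pverts D. arcs_between H (X v) (X v) = {}) \<and>
     (\<forall>u\<in>pverts D. \<forall>v\<in>pverts D. u \<noteq> v \<longrightarrow>
        (if (u, v) \<in> parcs D then matching (arcs_between H (X u) (X v))
         else arcs_between H (X u) (X v) = {}))"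

definition transversal :: "'a pair_pre_digraph \<Rightarrow> ('a \<Rightarrow> 'b set) \<Rightarrow> 'b pair_pre_digraph \<Rightarrow> 'b set \<Rightarrow> bool"
where
  "transversal D X H T \<longleftrightarrow> T \<subseteq> pverts H \<and> (\<forall>v\<in>pverts D. card (T \<inter> X v) = 1)"

definition saturated :: "'a pair_pre_digraph \<Rightarrow> ('a \<Rightarrow> 'b set) \<Rightarrow> 'b pair_pre_digraph \<Rightarrow> bool" where
  "saturated D X H \<longleftrightarrow> (\<forall>(u, v)\<in>parcs D.
     perfect_matching (induce H (X u \<union> X v)) (arcs_between H (X u) (X v)))"

text \<open>\<open>saturated_restr D X H U\<close> says that the cover \<open>(X, H)/U\<close> is saturated.\<close>

definition saturated_restr ::
  "'a pair_pre_digraph \<Rightarrow> ('a \<Rightarrow> 'b set) \<Rightarrow> 'b pair_pre_digraph \<Rightarrow> 'b set \<Rightarrow> bool" where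
  "saturated_restr D X H U \<longleftrightarrow>
     saturated (induce D {v \<in> pverts D. X v \<inter> U \<noteq> {}}) (\<lambda>v. X v \<inter> U) (induce H U)"

definition strictly_degenerate :: "'b pair_pre_digraph \<Rightarrow> ('b \<Rightarrow> nat \<times> nat) \<Rightarrow> bool" where
  "strictly_degenerate H f \<longleftrightarrow>
     (\<forall>H'. subgraph (with_proj H') (with_proj H) \<and> pverts H' \<noteq> {} \<longrightarrow>
        (\<exists>x\<in>pverts H'. out_degree H' x < fst (f x) \<or> in_degree H' x < snd (f x)))"


text \<open>
  In a configuration \<open>(D, X, H, f)\<close> only the values of \<open>X\<close> on \<open>V(D)\<close> and of \<open>f\<close> on \<open>V(H)\<close> matter.
  The weight function \<open>f\<close> is unconstrained beyond its type, so it is not an argument here.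
\<close>

definition configuration :: "'a pair_pre_digraph \<Rightarrow> ('a \<Rightarrow> 'b set) \<Rightarrow> 'b pair_pre_digraph \<Rightarrow> bool" where
  "configuration D X H \<longleftrightarrow> pair_digraph D \<and> cover D X H"

definition degree_feasible ::
  "'a pair_pre_digraph \<Rightarrow> ('a \<Rightarrow> 'b set) \<Rightarrow> ('b \<Rightarrow> nat \<times> nat) \<Rightarrow> bool" where
  "degree_feasible D X f \<longleftrightarrow> (\<forall>v\<in>pverts D. deg D v \<le> (\<Sum>x\<in>X v. f x))"

definition colorable ::
  "'a pair_pre_digraph \<Rightarrow> ('a \<Rightarrow> 'b set) \<Rightarrow> 'b pair_pre_digraph \<Rightarrow> ('b \<Rightarrow> nat \<times> nat) \<Rightarrow> bool" where
  "colorable D X H f \<longleftrightarrow> (\<exists>T. transversal D X H T \<and> strictly_degenerate (induce H T) f)"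

abbreviation uncolorable ::
  "'a pair_pre_digraph \<Rightarrow> ('a \<Rightarrow> 'b set) \<Rightarrow> 'b pair_pre_digraph \<Rightarrow> ('b \<Rightarrow> nat \<times> nat) \<Rightarrow> bool" where
  "uncolorable D X H f \<equiv> \<not> colorable D X H f"


text \<open>
  The union of two disjoint digraphs is represented as a tagged union of arbitrary ones, so that
  disjoint copies are available over every vertex type. \<open>identifies q A S\<close> says that \<open>q\<close> is the
  quotient map on \<open>A\<close> that merges \<open>a\<close> with \<open>b\<close> for \<open>(a, b) \<in> S\<close> and nothing else; this suffices
  when, as below, \<open>S\<close> is a bijection between two disjoint sets.
\<close>

definition disjoint_union ::
  "'a pair_pre_digraph \<Rightarrow> 'b pair_pre_digraph \<Rightarrow> ('a + 'b) pair_pre_digraph" where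
  "disjoint_union D1 D2 = \<lparr> pverts = pverts D1 <+> pverts D2,
     parcs = map_prod Inl Inl ` parcs D1 \<union> map_prod Inr Inr ` parcs D2 \<rparr>"

definition image_digraph :: "('a \<Rightarrow> 'b) \<Rightarrow> 'a pair_pre_digraph \<Rightarrow> 'b pair_pre_digraph" where
  "image_digraph q D = \<lparr> pverts = q ` pverts D, parcs = map_prod q q ` parcs D \<rparr>"

definition identifies :: "('a \<Rightarrow> 'b) \<Rightarrow> 'a set \<Rightarrow> ('a \<times> 'a) set \<Rightarrow> bool" where
  "identifies q A S \<longleftrightarrow>
     (\<forall>a\<in>A. \<forall>b\<in>A. q a = q b \<longleftrightarrow> a = b \<or> (a, b) \<in> S \<or> (b, a) \<in> S)"

definition merged ::
  "'a pair_pre_digraph \<Rightarrow> ('a \<Rightarrow> 'b set) \<Rightarrow> 'b pair_pre_digraph \<Rightarrow> ('b \<Rightarrow> nat \<times> nat) \<Rightarrow>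
   'a pair_pre_digraph \<Rightarrow> ('a \<Rightarrow> 'b set) \<Rightarrow> 'b pair_pre_digraph \<Rightarrow> ('b \<Rightarrow> nat \<times> nat) \<Rightarrow>
   'a pair_pre_digraph \<Rightarrow> ('a \<Rightarrow> 'b set) \<Rightarrow> 'b pair_pre_digraph \<Rightarrow> ('b \<Rightarrow> nat \<times> nat) \<Rightarrow> bool" where
  "merged D1 X1 H1 f1 D2 X2 H2 f2 D X H f \<longleftrightarrow>
     (\<exists>v1\<in>pverts D1. \<exists>v2\<in>pverts D2. \<exists>\<pi> q r.
        bij_betw \<pi> (X1 v1) (X2 v2) \<and>
        identifies q (pverts (disjoint_union D1 D2)) {(Inl v1, Inr v2)} \<and>
        identifies r (pverts (disjoint_union H1 H2)) {(Inl x, Inr (\<pi> x)) |x. x \<in> X1 v1} \<and>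
        D = image_digraph q (disjoint_union D1 D2) \<and>
        H = image_digraph r (disjoint_union H1 H2) \<and>
        (\<forall>v\<in>pverts D1. X (q (Inl v)) = r ` Inl ` X1 v) \<and>
        (\<forall>v\<in>pverts D2. X (q (Inr v)) = r ` Inr ` X2 v) \<and>
        (\<forall>x\<in>pverts H1 - X1 v1. f (r (Inl x)) = f1 x) \<and>
        (\<forall>x\<in>pverts H2 - X2 v2. f (r (Inr x)) = f2 x) \<and>
        (\<forall>x\<in>X1 v1. f (r (Inl x)) = f1 x + f2 (\<pi> x)))"

inductive constructible ::
  "'a pair_pre_digraph \<Rightarrow> ('a \<Rightarrow> 'b set) \<Rightarrow> 'b pair_pre_digraph \<Rightarrow> ('b \<Rightarrow> nat \<times> nat) \<Rightarrow> bool" where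
  block:
    "\<lbrakk>configuration D X H; is_block D;
      transversal D X H T; saturated_restr D X H T;
      \<forall>v\<in>pverts D. \<forall>x\<in>T \<inter> X v. f x = deg D v;
      \<forall>x\<in>pverts H - T. f x = (0, 0)\<rbrakk>
     \<Longrightarrow> constructible D X H f"
| complete:
    "\<lbrakk>configuration D X H; n \<ge> 1; bidirected_complete n D;
      (p :: nat) \<ge> 1; \<forall>i\<in>{1..p}. k i \<ge> 1; (\<Sum>i = 1..p. k i) = n - 1;
      \<forall>i\<in>{1..p}. transversal D X H (T i) \<and> saturated_restr D X H (T i);
      \<forall>i\<in>{1..p}. \<forall>j\<in>{1..p}. i \<noteq> j \<longrightarrow> T i \<inter> T j = {};
      \<forall>i\<in>{1..p}. \<forall>x\<in>T i. f x = (k i, k i);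
      \<forall>x\<in>pverts H - (\<Union>i\<in>{1..p}. T i). f x = (0, 0)\<rbrakk>
     \<Longrightarrow> constructible D X H f"
| odd_cycle:
    "\<lbrakk>configuration D X H; n \<ge> 5; odd n; bidirected_cycle n D;
      transversal D X H T1; transversal D X H T2; T1 \<inter> T2 = {};
      saturated_restr D X H T1; saturated_restr D X H T2;
      \<forall>x\<in>T1 \<union> T2. f x = (1, 1);
      \<forall>x\<in>pverts H - (T1 \<union> T2). f x = (0, 0)\<rbrakk>
     \<Longrightarrow> constructible D X H f"
| even_cycle:
    "\<lbrakk>configuration D X H; n \<ge> 4; even n; bidirected_cycle n D;
      transversal D X H T1; transversal D X H T2; T1 \<inter> T2 = {};
      bidirected_cycle (2 * n) (induce H (T1 \<union> T2));
      \<forall>x\<in>T1 \<union> T2. f x = (1, 1);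
      \<forall>x\<in>pverts H - (T1 \<union> T2). f x = (0, 0)\<rbrakk>
     \<Longrightarrow> constructible D X H f"
| antidirected:
    "\<lbrakk>configuration D X H; n \<ge> 4; even n; antidirected_cycle n D;
      transversal D X H T1; transversal D X H T2; T1 \<inter> T2 = {};
      antidirected_cycle (2 * n) (induce H (T1 \<union> T2));
      \<forall>v\<in>pverts D. \<forall>x\<in>X v \<inter> (T1 \<union> T2).
        (source D v \<longrightarrow> f x = (1, 0)) \<and> (sink D v \<longrightarrow> f x = (0, 1));
      \<forall>x\<in>pverts H - (T1 \<union> T2). f x = (0, 0)\<rbrakk>
     \<Longrightarrow> constructible D X H f"
| merge:
    "\<lbrakk>configuration D X H;
      constructible D1 X1 H1 f1; constructible D2 X2 H2 f2;
      card (pverts D1) < card (pverts D); card (pverts D2) < card (pverts D);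
      merged D1 X1 H1 f1 D2 X2 H2 f2 D X H f\<rbrakk>
     \<Longrightarrow> constructible D X H f"

end

theory Submission
  imports Defs
begin

text \<open>
  Choosing a colour for a vertex and lowering the weights of its neighbours in \<open>H\<close> preserves
  uncolorability and degree-feasibility. Hence a vertex whose weights exceed its degree would allow a
  greedy colouring, so all degree inequalities are equalities, and along every arc between two
  non-separating vertices the colours of non-zero weight are perfectly matched. At a cut vertex the
  weights split into two parts, each uncolorable on its own side, so it remains to treat blocks.

  If a block has just one colour of non-zero weight per vertex, it is of the first type. Otherwise
  delete a vertex \<open>a\<close> and look at an end block of the rest. By induction its weights agree along
  matched colours; since changing the colour of \<open>a\<close> changes only the weights at neighbours of \<open>a\<close>,
  all inner vertices of the end block are adjacent to \<open>a\<close>. This forces the underlying graph to be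
  complete or a cycle, and the remaining structure is read off in these two cases.
\<close>

section \<open>Covers, reductions and tightness\<close>

text \<open>The induction over blocks carries only \<open>balanced\<close>, not the full structure:
  to compare what an end block inherits from different colours of \<open>a\<close> it is enough that
  weights agree along matched pairs. \<open>balanced\<close> has two alternatives because the two
  weights of a colour coincide in bidirected blocks but not in antidirected cycles; in both cases
  the weight of a colour along an arc equals the weight of its partner in the opposite direction.

  The obstacle is that colouring \<open>a\<close> may leave only one colour of non-zero weight at a
  vertex, where the induction says nothing. An inner vertex not adjacent to \<open>a\<close> keeps
  all its colours, and with it the whole end block, so adjacency to \<open>a\<close> can be derived.
  In a complete graph every vertex is adjacent to \<open>a\<close>, and this degenerate case needs
  its own argument.

  The triangle is both complete and a cycle. It is treated as a cycle, which leaves at least four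
  vertices to the complete case, and is recognised as complete only when its type of constructible
  configuration is chosen.\<close>

definition cyclic_enum :: "'c set \<Rightarrow> ('c \<Rightarrow> 'c \<Rightarrow> bool) \<Rightarrow> nat \<Rightarrow> (nat \<Rightarrow> 'c) \<Rightarrow> bool" where
  "cyclic_enum S A n c \<longleftrightarrow> bij_betw c {..<n} S \<and>
     (\<forall>u\<in>S. \<forall>v\<in>S. A u v \<longleftrightarrow> (\<exists>i<n. {u, v} = {c i, c (Suc i mod n)}))"

text \<open>
  The flag \<open>s\<close> is a direction: \<open>E s u v\<close> means that there is an arc from \<open>u\<close> to \<open>v\<close> if \<open>s\<close> holds, and
  from \<open>v\<close> to \<open>u\<close> otherwise, and likewise for \<open>F\<close> and the weights \<open>f s\<close>. This treats out-degrees and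
  in-degrees alike.
\<close>

locale digraph_cover =
  fixes V0 :: "'a set" and E :: "bool \<Rightarrow> 'a \<Rightarrow> 'a \<Rightarrow> bool"
    and X :: "'a \<Rightarrow> 'b set" and F :: "bool \<Rightarrow> 'b \<Rightarrow> 'b \<Rightarrow> bool"
  assumes finite_V0: "finite V0"
    and E_irrefl: "\<not> E s v v"
    and E_rev: "E (\<not> s) v u \<longleftrightarrow> E s u v"
    and finite_X: "v \<in> V0 \<Longrightarrow> finite (X v)"
    and X_disj: "\<lbrakk>u \<in> V0; v \<in> V0; x \<in> X u; x \<in> X v\<rbrakk> \<Longrightarrow> u = v"
    and F_rev: "F (\<not> s) y x \<longleftrightarrow> F s x y"
    and F_E: "\<lbrakk>u \<in> V0; v \<in> V0; x \<in> X u; y \<in> X v; F s x y\<rbrakk> \<Longrightarrow> E s u v"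
    and F_match: "\<lbrakk>u \<in> V0; v \<in> V0; x \<in> X u; y \<in> X v; y' \<in> X v; F s x y; F s x y'\<rbrakk> \<Longrightarrow> y = y'"
begin

definition dg :: "'a set \<Rightarrow> bool \<Rightarrow> 'a \<Rightarrow> nat" where
  "dg V s v = card {u \<in> V. E s v u}"

definition fd :: "bool \<Rightarrow> 'b \<Rightarrow> 'b set \<Rightarrow> nat" where
  "fd s x T = card {y \<in> T. F s x y}"

text \<open>Only vertex sets are tested, that is, induced subdigraphs: dropping arcs lowers degrees
  and can only help, so this is strict degeneracy of the subdigraph induced by
  \<open>T\<close>.\<close>

definition sdeg :: "(bool \<Rightarrow> 'b \<Rightarrow> nat) \<Rightarrow> 'b set \<Rightarrow> bool" where
  "sdeg f T \<longleftrightarrow> (\<forall>S\<subseteq>T. S \<noteq> {} \<longrightarrow> (\<exists>x\<in>S. \<exists>s. fd s x S < f s x))"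

definition transv :: "'a set \<Rightarrow> 'b set \<Rightarrow> bool" where
  "transv V T \<longleftrightarrow> T \<subseteq> \<Union>(X ` V) \<and> (\<forall>v\<in>V. \<exists>x. T \<inter> X v = {x})"

definition col :: "'a set \<Rightarrow> (bool \<Rightarrow> 'b \<Rightarrow> nat) \<Rightarrow> bool" where
  "col V f \<longleftrightarrow> (\<exists>T. transv V T \<and> sdeg f T)"

definition feas :: "'a set \<Rightarrow> (bool \<Rightarrow> 'b \<Rightarrow> nat) \<Rightarrow> bool" where
  "feas V f \<longleftrightarrow> (\<forall>v\<in>V. \<forall>s. dg V s v \<le> sum (f s) (X v))"

definition ucf :: "'a set \<Rightarrow> (bool \<Rightarrow> 'b \<Rightarrow> nat) \<Rightarrow> bool" where
  "ucf V f \<longleftrightarrow> feas V f \<and> \<not> col V f"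

definition adj :: "'a \<Rightarrow> 'a \<Rightarrow> bool" where
  "adj u v \<longleftrightarrow> (\<exists>s. E s u v)"

text \<open>Connectivity by cuts instead of walks suits the many arguments about sets that are
  closed off; \<open>connected_subD\<close> reconciles it with reachability.\<close>

definition conn :: "'a set \<Rightarrow> bool" where
  "conn V \<longleftrightarrow> V \<noteq> {} \<and> (\<forall>A\<subseteq>V. A \<noteq> {} \<and> A \<noteq> V \<longrightarrow> (\<exists>u\<in>A. \<exists>v\<in>V - A. adj u v))"

definition blk :: "'a set \<Rightarrow> bool" where
  "blk V \<longleftrightarrow> conn V \<and> 2 \<le> card V \<and> (\<forall>v\<in>V. conn (V - {v}))"

text \<open>Once \<open>a\<close> is in the transversal, an arc between \<open>y\<close> and
  \<open>a\<close> uses up one unit of the weight of \<open>y\<close> in its direction, and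
  \<open>y\<close> can then be treated as if \<open>a\<close> were absent.\<close>

definition red :: "(bool \<Rightarrow> 'b \<Rightarrow> nat) \<Rightarrow> 'b \<Rightarrow> bool \<Rightarrow> 'b \<Rightarrow> nat" where
  "red f a = (\<lambda>s y. f s y - (if F s y a then 1 else 0))"

definition supp :: "(bool \<Rightarrow> 'b \<Rightarrow> nat) \<Rightarrow> 'a \<Rightarrow> 'b set" where
  "supp f v = {x \<in> X v. \<exists>s. f s x \<noteq> 0}"

lemma E_not: "E s u v \<longleftrightarrow> E (\<not> s) v u"
  using E_rev by simp

lemma F_not: "F s x y \<longleftrightarrow> F (\<not> s) y x"
  using F_rev by simp

lemma F_match': "\<lbrakk>u \<in> V0; v \<in> V0; x \<in> X u; x' \<in> X u; y \<in> X v; F s x y; F s x' y\<rbrakk> \<Longrightarrow> x = x'"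
  using F_match[of v u y x x' "\<not> s"] F_not by blast

lemma F_irrefl: "u \<in> V0 \<Longrightarrow> x \<in> X u \<Longrightarrow> y \<in> X u \<Longrightarrow> \<not> F s x y"
  using F_E E_irrefl by blast

lemma adj_sym: "adj u v \<Longrightarrow> adj v u"
  unfolding adj_def using E_not by blast

lemma adj_irrefl: "\<not> adj v v"
  unfolding adj_def using E_irrefl by blast

lemma adj_E: "E s u v \<Longrightarrow> adj u v"
  unfolding adj_def by blast

lemma finite_sub: "V \<subseteq> V0 \<Longrightarrow> finite V"
  using finite_V0 finite_subset by blast

lemma conn_cut:
  assumes "conn V" "A \<subseteq> V" "A \<noteq> {}" "A \<noteq> V"
  obtains u v where "u \<in> A" "v \<in> V" "v \<notin> A" "adj u v"
  using assms unfolding conn_def by blast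

text \<open>One of a set and its complement avoids \<open>w\<close>, and adjacency is symmetric, so
  cuts avoiding one fixed vertex suffice.\<close>

lemma conn_I:
  assumes "w \<in> V" and "\<And>A. \<lbrakk>A \<subseteq> V; A \<noteq> {}; w \<notin> A; \<forall>u\<in>A. \<forall>v\<in>V-A. \<not> adj u v\<rbrakk> \<Longrightarrow> False"
  shows "conn V"
  unfolding conn_def
proof (intro conjI allI impI)
  show "V \<noteq> {}" using assms(1) by blast
next
  fix A assume A: "A \<subseteq> V" "A \<noteq> {} \<and> A \<noteq> V"
  show "\<exists>u\<in>A. \<exists>v\<in>V - A. adj u v"
  proof (rule ccontr)
    assume neg: "\<not> ?thesis"
    show False
    proof (cases "w \<in> A")
      case True
      have "\<forall>u\<in>V - A. \<forall>v\<in>V-(V - A). \<not> adj u v"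
        using neg adj_sym by blast
      with assms(2)[of "V - A"] A True show False by blast
    next
      case False
      with assms(2)[of A] A neg show False by blast
    qed
  qed
qed

lemma conn_singleton: "conn {v}"
  unfolding conn_def by blast

lemma conn_insert:
  assumes "conn A" "u \<in> A" "adj u v"
  shows "conn (insert v A)"
proof (rule conn_I[of u])
  show "u \<in> insert v A" using assms by simp
next
  fix B assume B: "B \<subseteq> insert v A" "B \<noteq> {}" "u \<notin> B"
    "\<forall>x\<in>B. \<forall>y\<in>insert v A - B. \<not> adj x y"
  have "v \<notin> B" using B assms adj_sym by blast
  then have "B \<subseteq> A" using B by blast
  with conn_cut[OF assms(1), of B] B assms(2) show False
    by (metis DiffI insertCI)
qed

text \<open>A largest connected proper subset containing \<open>w\<close> stays connected when a
  neighbour is added, so by maximality this neighbour is all that it misses of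
  \<open>V\<close>.\<close>

lemma exists_noncut:
  assumes "conn V" "finite V" "w \<in> V" "V \<noteq> {w}"
  shows "\<exists>v\<in>V - {w}. conn (V - {v})"
proof -
  let ?P = "\<lambda>A. A \<subseteq> V \<and> A \<noteq> V \<and> w \<in> A \<and> conn A"
  have w: "?P {w}" using assms conn_singleton by blast
  have "\<exists>A. ?P A \<and> (\<forall>B. ?P B \<longrightarrow> card B \<le> card A)"
    using ex_has_greatest_nat[where P = ?P and k = "{w}" and f = card and b = "Suc (card V)"] w
      card_mono[OF assms(2)] by (simp add: less_Suc_eq_le)
  then obtain A where A: "A \<subseteq> V" "A \<noteq> V" "w \<in> A" "conn A" and mx: "\<And>B. ?P B \<Longrightarrow> card B \<le> card A"
    by (elim exE conjE) simp
  obtain u v where uv: "u \<in> A" "v \<in> V" "v \<notin> A" "adj u v"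
    using conn_cut[OF assms(1), of A] A by blast
  have "conn (insert v A)" using conn_insert A uv by blast
  moreover have "card (insert v A) > card A"
    using A uv assms(2) finite_subset by (metis card_insert_disjoint lessI)
  ultimately have "insert v A = V"
    using mx[of "insert v A"] A uv by (metis insertCI insert_subset not_le)
  then have "V - {v} = A" using uv by blast
  then show ?thesis using A uv by blast
qed

lemma dg_pos:
  assumes "V \<subseteq> V0" "u \<in> V" "E s v u"
  shows "0 < dg V s v"
proof -
  have "finite {u \<in> V. E s v u}" using assms(1) finite_sub by simp
  moreover have "u \<in> {u \<in> V. E s v u}" using assms by simp
  ultimately show ?thesis unfolding dg_def by (metis card_gt_0_iff empty_iff)
qed

lemma dg_diff:
  assumes "V \<subseteq> V0" "a \<in> V"
  shows "dg V s v = dg (V - {a}) s v + (if E s v a then 1 else 0)"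
proof -
  have fin: "finite {u \<in> V - {a}. E s v u}" using assms(1) finite_sub by simp
  have "{u \<in> V. E s v u} = (if E s v a then insert a {u \<in> V - {a}. E s v u} else {u \<in> V - {a}. E s v u})"
    using assms(2) by auto
  then show ?thesis unfolding dg_def using fin by simp
qed

lemma fd_mono: "finite T \<Longrightarrow> S \<subseteq> T \<Longrightarrow> fd s x S \<le> fd s x T"
  unfolding fd_def by (rule card_mono) auto

lemma sdeg_mono: "sdeg f T \<Longrightarrow> S \<subseteq> T \<Longrightarrow> sdeg f S"
  unfolding sdeg_def by (meson subset_trans)

lemma finite_transv: "V \<subseteq> V0 \<Longrightarrow> transv V T \<Longrightarrow> finite T"
  unfolding transv_def using finite_sub finite_X
  by (meson finite_UN_I finite_subset subsetD)

lemma transv_notin: "\<lbrakk>transv V T; V \<subseteq> V0; a \<in> V0; a \<notin> V; x \<in> T\<rbrakk> \<Longrightarrow> x \<notin> X a"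
  unfolding transv_def using X_disj by (metis UN_E subsetD)

lemma transv_insert:
  assumes "V \<subseteq> V0" "a \<in> V" "transv (V - {a}) T" "x \<in> X a"
  shows "transv V (insert x T)"
  unfolding transv_def
proof (intro conjI ballI)
  show "insert x T \<subseteq> \<Union> (X ` V)" using assms unfolding transv_def by blast
next
  fix v assume v: "v \<in> V"
  show "\<exists>y. insert x T \<inter> X v = {y}"
  proof (cases "v = a")
    case True
    have "T \<inter> X a = {}" using transv_notin[OF assms(3), of a] assms(1,2) by auto
    then show ?thesis using True assms by auto
  next
    case False
    then obtain y where "T \<inter> X v = {y}" using v assms unfolding transv_def by blast
    moreover have "x \<notin> X v" using False assms v X_disj by blast
    ultimately show ?thesis by auto
  qed
qed

text \<open>A set \<open>S\<close> other than \<open>{\<alpha>}\<close> is tested on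
  \<open>S - {\<alpha>}\<close>: putting \<open>\<alpha>\<close> back raises a degree by at most the
  unit that \<open>red\<close> has held back. The set \<open>{\<alpha>}\<close> is harmless, since
  \<open>\<alpha>\<close> has non-zero weight and no loop.\<close>

lemma col_red:
  assumes "V \<subseteq> V0" "a \<in> V" "\<alpha> \<in> supp f a" "col (V - {a}) (red f \<alpha>)"
  shows "col V f"
proof -
  obtain T where T: "transv (V - {a}) T" "sdeg (red f \<alpha>) T"
    using assms unfolding col_def by blast
  have \<alpha>: "\<alpha> \<in> X a" "\<exists>s. f s \<alpha> \<noteq> 0" using assms unfolding supp_def by auto
  have finT: "finite T" using finite_transv T assms(1) by blast
  have nT: "\<alpha> \<notin> T" using transv_notin[OF T(1), of a] assms(1,2) \<alpha> by auto
  have "sdeg f (insert \<alpha> T)"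
    unfolding sdeg_def
  proof (intro allI impI)
    fix S assume S: "S \<subseteq> insert \<alpha> T" "S \<noteq> {}"
    have finS: "finite S" using S finT finite_subset by blast
    show "\<exists>x\<in>S. \<exists>s. fd s x S < f s x"
    proof (cases "S = {\<alpha>}")
      case True
      obtain s where "f s \<alpha> \<noteq> 0" using \<alpha> by blast
      moreover have "fd s \<alpha> S = 0" unfolding fd_def True using F_irrefl \<alpha> assms by auto
      ultimately show ?thesis using True by (metis gr0I singletonI)
    next
      case False
      then have "S - {\<alpha>} \<noteq> {}" "S - {\<alpha>} \<subseteq> T" using S by auto
      then obtain x s where x: "x \<in> S - {\<alpha>}" "fd s x (S - {\<alpha>}) < red f \<alpha> s x"
        using T(2) unfolding sdeg_def by blast
      have fin': "finite {y \<in> S - {\<alpha>}. F s x y}" using finS by simp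
      have "fd s x S \<le> fd s x (S - {\<alpha>}) + (if F s x \<alpha> then 1 else 0)"
      proof (cases "F s x \<alpha>")
        case True
        have "{y \<in> S. F s x y} \<subseteq> insert \<alpha> {y \<in> S - {\<alpha>}. F s x y}" by auto
        then have "fd s x S \<le> card (insert \<alpha> {y \<in> S - {\<alpha>}. F s x y})"
          unfolding fd_def by (rule card_mono[rotated]) (use fin' in simp)
        also have "\<dots> \<le> fd s x (S - {\<alpha>}) + 1"
          unfolding fd_def using fin' by (simp add: card_insert_if)
        finally show ?thesis using True by simp
      next
        case False
        then have "{y \<in> S. F s x y} = {y \<in> S - {\<alpha>}. F s x y}" by auto
        then show ?thesis unfolding fd_def by simp
      qed
      then have "fd s x S < f s x" using x(2) unfolding red_def by (auto split: if_splits)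
      then show ?thesis using x by blast
    qed
  qed
  moreover have "transv V (insert \<alpha> T)" using transv_insert assms T \<alpha> by blast
  ultimately show ?thesis unfolding col_def by blast
qed

lemma card_matched_le:
  assumes "v \<in> V0" "a \<in> V0" "\<alpha> \<in> X a"
  shows "card {y \<in> X v. F s y \<alpha>} \<le> (if E s v a then 1 else 0)"
proof (cases "\<exists>y\<in>X v. F s y \<alpha>")
  case True
  then obtain y where y: "y \<in> X v" "F s y \<alpha>" by blast
  have "{y \<in> X v. F s y \<alpha>} = {y}" using y F_match' assms by blast
  moreover have "E s v a" using F_E y assms by blast
  ultimately show ?thesis by simp
next
  case False
  then have "{y \<in> X v. F s y \<alpha>} = {}" by blast
  then show ?thesis by (metis card.empty zero_le)
qed

text \<open>Truncated subtraction can only make the weight of \<open>X v\<close> larger than it should be.\<close>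

lemma sum_red_ge:
  assumes "v \<in> V0" "a \<in> V0" "\<alpha> \<in> X a"
  shows "sum (f s) (X v) \<le> sum (red f \<alpha> s) (X v) + card {y \<in> X v. F s y \<alpha> \<and> 0 < f s y}"
proof -
  have fin: "finite (X v)" using assms finite_X by blast
  have "sum (f s) (X v) \<le> (\<Sum>y\<in>X v. red f \<alpha> s y + (if F s y \<alpha> \<and> 0 < f s y then 1 else 0))"
    by (rule sum_mono) (auto simp: red_def)
  also have "\<dots> = sum (red f \<alpha> s) (X v) + (\<Sum>y\<in>X v. if F s y \<alpha> \<and> 0 < f s y then 1 else 0)"
    by (simp add: sum.distrib)
  also have "(\<Sum>y\<in>X v. if F s y \<alpha> \<and> 0 < f s y then 1 else 0) = card {y \<in> X v. F s y \<alpha> \<and> 0 < f s y}"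
    using fin by (simp add: sum.If_cases Int_def)
  finally show ?thesis .
qed

lemma sum_red_ge':
  assumes "v \<in> V0" "a \<in> V0" "\<alpha> \<in> X a"
  shows "sum (f s) (X v) \<le> sum (red f \<alpha> s) (X v) + (if E s v a then 1 else 0)"
proof -
  have fin: "finite (X v)" using assms finite_X by blast
  have "card {y \<in> X v. F s y \<alpha> \<and> 0 < f s y} \<le> card {y \<in> X v. F s y \<alpha>}"
    by (rule card_mono) (use fin in auto)
  then show ?thesis using sum_red_ge[OF assms, of f s] card_matched_le[OF assms, of s]
    by linarith
qed

text \<open>The matching gives \<open>\<alpha>\<close> at most one partner in \<open>X v\<close> per
  direction, and only where \<open>v\<close> has an arc to \<open>a\<close>. So whenever the weights
  lose a unit the degree drops as well, and neither feasibility nor a surplus is lost.\<close>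

lemma red_ge:
  assumes "V \<subseteq> V0" "a \<in> V" "\<alpha> \<in> X a" "v \<in> V"
  shows "dg V s v \<le> sum (f s) (X v) \<Longrightarrow> dg (V - {a}) s v \<le> sum (red f \<alpha> s) (X v)"
    and "dg V s v < sum (f s) (X v) \<Longrightarrow> dg (V - {a}) s v < sum (red f \<alpha> s) (X v)"
  using sum_red_ge'[of v a \<alpha> f s] dg_diff[of V a s v] assms subsetD[OF assms(1)]
  by (auto split: if_splits)

text \<open>Colour greedily with \<open>w\<close> last: a non-separating vertex other than
  \<open>w\<close> has a neighbour, hence by feasibility a colour of non-zero weight, and the
  surplus at \<open>w\<close> survives its deletion. At \<open>w\<close> only the direction of the
  surplus matters; \<open>split_cut\<close> relies on this, as it treats one direction at a
  time.\<close>

lemma excess_col: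
  assumes "V \<subseteq> V0" "conn V" "w \<in> V"
    and "\<And>v s. v \<in> V - {w} \<Longrightarrow> dg V s v \<le> sum (f s) (X v)"
    and "dg V s0 w < sum (f s0) (X w)"
  shows "col V f"
  using assms
proof (induction "card V" arbitrary: V f rule: less_induct)
  case less
  have finV: "finite V" using less.prems finite_sub by blast
  show ?case
  proof (cases "V = {w}")
    case True
    have "sum (f s0) (X w) \<noteq> 0" using less.prems by linarith
    then obtain x where x: "x \<in> X w" "f s0 x \<noteq> 0" by (meson sum.neutral)
    have "sdeg f {x}"
      unfolding sdeg_def
    proof (intro allI impI)
      fix S assume "S \<subseteq> {x}" "S \<noteq> {}"
      then have S: "S = {x}" by blast
      have "fd s0 x S = 0" unfolding fd_def S using F_irrefl x less.prems by auto
      then show "\<exists>x\<in>S. \<exists>s. fd s x S < f s x" using S x by (metis gr0I singletonI)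
    qed
    moreover have "transv V {x}" unfolding transv_def True using x by auto
    ultimately show ?thesis unfolding col_def by blast
  next
    case False
    obtain a where a: "a \<in> V" "a \<noteq> w" "conn (V - {a})"
      using exists_noncut[OF less.prems(2) finV less.prems(3) False] by blast
    obtain b where "b \<in> V" "adj a b"
      using conn_cut[OF less.prems(2), of "{a}"] a less.prems(3) by (metis bot_least insert_not_empty insert_subset singletonD singletonI)
    then obtain s where "E s a b" unfolding adj_def by blast
    then have "0 < dg V s a" using dg_pos[OF less.prems(1) \<open>b \<in> V\<close>] by blast
    then have "sum (f s) (X a) \<noteq> 0" using less.prems(4)[of a s] a by simp
    then obtain \<alpha> where \<alpha>: "\<alpha> \<in> X a" "f s \<alpha> \<noteq> 0" by (meson sum.neutral)
    have "col (V - {a}) (red f \<alpha>)"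
    proof (rule less.hyps)
      show "card (V - {a}) < card V" using a finV by (meson card_Diff1_less)
      show "V - {a} \<subseteq> V0" "conn (V - {a})" "w \<in> V - {a}" using a less.prems by auto
      show "dg (V - {a}) s v \<le> sum (red f \<alpha> s) (X v)" if "v \<in> V - {a} - {w}" for v s
        using red_ge(1) less.prems that a \<alpha> by simp
      show "dg (V - {a}) s0 w < sum (red f \<alpha> s0) (X w)"
        using red_ge(2) less.prems a \<alpha> by simp
    qed
    then show ?thesis using col_red[of V a \<alpha> f] less.prems a \<alpha> unfolding supp_def by blast
  qed
qed

lemma tight:
  assumes "V \<subseteq> V0" "conn V" "ucf V f" "v \<in> V"
  shows "sum (f s) (X v) = dg V s v"
proof (rule ccontr)
  assume "\<not> ?thesis"
  then have "dg V s v < sum (f s) (X v)" using assms unfolding ucf_def feas_def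
    by (meson linorder_neqE_nat not_le)
  then have "col V f" using excess_col[of V v f s] assms unfolding ucf_def feas_def by blast
  then show False using assms unfolding ucf_def by blast
qed

lemma ucf_red:
  assumes "V \<subseteq> V0" "ucf V f" "a \<in> V" "\<alpha> \<in> supp f a"
  shows "ucf (V - {a}) (red f \<alpha>)"
  using assms col_red[of V a \<alpha> f] red_ge(1)[of V a \<alpha>]
  unfolding ucf_def feas_def supp_def by auto

lemma supp_X: "x \<in> supp f v \<Longrightarrow> x \<in> X v"
  unfolding supp_def by simp

lemma supp_I: "x \<in> X v \<Longrightarrow> 0 < f s x \<Longrightarrow> x \<in> supp f v"
  unfolding supp_def by auto

lemma finite_supp: "v \<in> V0 \<Longrightarrow> finite (supp f v)"
  unfolding supp_def using finite_X by simp

text \<open>Without such a colour, the weight sum at \<open>v\<close> in direction \<open>s\<close>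
  would stay the same when \<open>a\<close> receives \<open>\<alpha>\<close>, while the degree of
  \<open>v\<close> drops by one; but \<open>tight\<close> holds before and after.\<close>

lemma arc_half:
  assumes "V \<subseteq> V0" "conn V" "ucf V f" "a \<in> V" "conn (V - {a})" "\<alpha> \<in> supp f a"
    and "v \<in> V" "E s v a"
  shows "\<exists>y\<in>X v. F s y \<alpha> \<and> 0 < f s y"
proof (rule ccontr)
  assume "\<not> ?thesis"
  then have emp: "{y \<in> X v. F s y \<alpha> \<and> 0 < f s y} = {}" by blast
  have va: "v \<noteq> a" using assms E_irrefl by blast
  have "sum (f s) (X v) = dg V s v" using tight assms by blast
  moreover have "sum (red f \<alpha> s) (X v) = dg (V - {a}) s v"
    by (rule tight) (use assms va ucf_red in auto)
  moreover have "dg V s v = dg (V - {a}) s v + 1" using dg_diff assms by simp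
  moreover have "sum (f s) (X v) \<le> sum (red f \<alpha> s) (X v)"
    using sum_red_ge[of v a \<alpha> f s] emp assms supp_X by (metis add.right_neutral card.empty subsetD)
  ultimately show False by simp
qed

text \<open>\<open>arc_half\<close> applied from either end gives partners of positive weight, hence
  injections between two finite supports in both directions. Both are therefore onto, and what is
  known of the partners holds for the entire supports.\<close>

lemma arc_full:
  assumes "V \<subseteq> V0" "conn V" "ucf V f" "u \<in> V" "conn (V - {u})" "v \<in> V" "conn (V - {v})" "E s u v"
  shows "card (supp f u) = card (supp f v)"
    and "\<And>y. y \<in> supp f u \<Longrightarrow> 0 < f s y"
    and "\<And>x. x \<in> supp f v \<Longrightarrow> 0 < f (\<not> s) x"
    and "\<And>y. y \<in> supp f u \<Longrightarrow> \<exists>x\<in>supp f v. F s y x"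
    and "\<And>x. x \<in> supp f v \<Longrightarrow> \<exists>y\<in>supp f u. F s y x"
proof -
  have uv0: "u \<in> V0" "v \<in> V0" using assms by auto
  have h1: "\<exists>y\<in>X u. F s y x \<and> 0 < f s y" if "x \<in> supp f v" for x
    using arc_half[OF assms(1-3,6,7) that assms(4,8)] .
  have h2: "\<exists>x\<in>X v. F s y x \<and> 0 < f (\<not> s) x" if "y \<in> supp f u" for y
    using arc_half[OF assms(1-3,4,5) that assms(6), of "\<not> s"] assms(8) E_not F_not by metis
  obtain g where g: "\<And>x. x \<in> supp f v \<Longrightarrow> g x \<in> X u \<and> F s (g x) x \<and> 0 < f s (g x)"
    using h1 by metis
  obtain h where h: "\<And>y. y \<in> supp f u \<Longrightarrow> h y \<in> X v \<and> F s y (h y) \<and> 0 < f (\<not> s) (h y)"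
    using h2 by metis
  have gi: "inj_on g (supp f v)"
    by (rule inj_onI) (metis g F_match uv0 supp_X)
  have hi: "inj_on h (supp f u)"
    by (rule inj_onI) (metis h F_match' uv0 supp_X)
  have gs: "g ` supp f v \<subseteq> supp f u" by (rule image_subsetI) (metis g supp_I)
  have hs: "h ` supp f u \<subseteq> supp f v" by (rule image_subsetI) (metis h supp_I)
  have le1: "card (supp f v) \<le> card (supp f u)"
    using gi gs finite_supp uv0 card_inj_on_le by blast
  have le2: "card (supp f u) \<le> card (supp f v)"
    using hi hs finite_supp uv0 card_inj_on_le by blast
  show eq: "card (supp f u) = card (supp f v)" using le1 le2 by simp
  have gimg: "g ` supp f v = supp f u"
    using card_image[OF gi] eq gs finite_supp uv0 card_subset_eq by metis
  have himg: "h ` supp f u = supp f v"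
    using card_image[OF hi] eq hs finite_supp uv0 card_subset_eq by metis
  show "0 < f s y" if "y \<in> supp f u" for y using that gimg g by (metis imageE)
  show "0 < f (\<not> s) x" if "x \<in> supp f v" for x using that himg h by (metis imageE)
  show "\<exists>x\<in>supp f v. F s y x" if "y \<in> supp f u" for y using that himg h by (metis imageI)
  show "\<exists>y\<in>supp f u. F s y x" if "x \<in> supp f v" for x using that gimg g by (metis imageI)
qed

section \<open>Splitting at a cut vertex\<close>

text \<open>
  \<open>elim f T R x\<close>: starting from \<open>T \<union> {x}\<close>, vertices of \<open>T - R\<close> can be deleted greedily until only
  \<open>R \<union> {x}\<close> remains.
\<close>

definition elim :: "(bool \<Rightarrow> 'b \<Rightarrow> nat) \<Rightarrow> 'b set \<Rightarrow> 'b set \<Rightarrow> 'b \<Rightarrow> bool" where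
  "elim f T R x \<longleftrightarrow> R \<subseteq> T \<and>
     (\<forall>S\<subseteq>T. R \<subseteq> S \<longrightarrow> S \<noteq> R \<longrightarrow> (\<exists>y\<in>S - R. \<exists>s. fd s y (insert x S) < f s y))"

text \<open>For a colour \<open>x\<close> of \<open>c\<close> this is the smallest number of
  neighbours in direction \<open>s\<close> that can be left when \<open>x\<close> has to be removed,
  over all colourings of \<open>V - {c}\<close>. The two directions are minimised separately;
  different colourings may attain the two minima.\<close>

definition part :: "(bool \<Rightarrow> 'b \<Rightarrow> nat) \<Rightarrow> 'a set \<Rightarrow> 'a \<Rightarrow> bool \<Rightarrow> 'b \<Rightarrow> nat" where
  "part f V c = (\<lambda>s x. if x \<in> X c
     then (LEAST n. \<exists>T R. transv (V - {c}) T \<and> sdeg f T \<and> elim f T R x \<and> n = fd s x R) else f s x)"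

lemma sdeg_cong: "(\<And>x s. x \<in> T \<Longrightarrow> f s x = g s x) \<Longrightarrow> sdeg f T = sdeg g T"
  unfolding sdeg_def by (intro all_cong bex_cong) (auto simp: subset_iff)

lemma part_witness:
  assumes "V \<subseteq> V0" "conn V" "c \<in> V" "x \<in> X c"
    and "\<And>v s. v \<in> V - {c} \<Longrightarrow> dg V s v \<le> sum (f s) (X v)"
  shows "\<exists>T R. transv (V - {c}) T \<and> sdeg f T \<and> elim f T R x \<and> part f V c s x = fd s x R"
proof -
  \<comment> \<open>An artificial weight of degree plus one on every colour of \<open>c\<close>
    provides the surplus for \<open>excess_col\<close>; it is forgotten when \<open>X c\<close> is
    removed from the transversal.\<close>
  let ?g = "\<lambda>s y. if y \<in> X c then Suc (dg V s c) else f s y"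
  have c0: "c \<in> V0" using assms by blast
  have "col V ?g"
  proof (rule excess_col[OF assms(1-3)])
    show "dg V s v \<le> sum (?g s) (X v)" if "v \<in> V - {c}" for v s
    proof -
      have "y \<notin> X c" if "y \<in> X v" for y
        using that \<open>v \<in> V - {c}\<close> X_disj c0 assms(1) by (metis DiffD1 DiffD2 insertI1 subsetD)
      then have "sum (?g s) (X v) = sum (f s) (X v)" by (intro sum.cong) auto
      then show ?thesis using assms(5) that by simp
    qed
    have "?g True x \<le> sum (?g True) (X c)"
      by (rule member_le_sum) (use assms(4) finite_X c0 in auto)
    then show "dg V True c < sum (?g True) (X c)" using assms(4) by simp
  qed
  then obtain T where T: "transv V T" "sdeg ?g T" unfolding col_def by blast
  define T' where "T' = T - X c"
  have tr: "transv (V - {c}) T'"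
    unfolding transv_def
  proof (intro conjI ballI)
    show "T' \<subseteq> \<Union> (X ` (V - {c}))" using T(1) unfolding transv_def T'_def by auto
    fix v assume v: "v \<in> V - {c}"
    have "X v \<inter> X c = {}" using v X_disj c0 assms(1) by (metis DiffD1 DiffD2 disjoint_iff insertI1 subsetD)
    then have "T' \<inter> X v = T \<inter> X v" unfolding T'_def by blast
    then show "\<exists>x. T' \<inter> X v = {x}" using T(1) v unfolding transv_def by simp
  qed
  have "sdeg ?g T'" using sdeg_mono[OF T(2)] unfolding T'_def by blast
  then have sd: "sdeg f T'" using sdeg_cong[of T' ?g f] unfolding T'_def by simp
  have "elim f T' T' x" unfolding elim_def by blast
  then have "\<exists>n T R. transv (V - {c}) T \<and> sdeg f T \<and> elim f T R x \<and> n = fd s x R" using tr sd by blast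
  from LeastI_ex[OF this] show ?thesis unfolding part_def using assms(4) by simp
qed

lemma part_le:
  assumes "x \<in> X c" "transv (V - {c}) T" "sdeg f T" "elim f T R x"
  shows "part f V c s x \<le> fd s x R"
  unfolding part_def using assms by (auto intro!: Least_le)

lemma fd_insert_self: "u \<in> V0 \<Longrightarrow> x \<in> X u \<Longrightarrow> fd s x (insert x R) = fd s x R"
proof -
  assume "u \<in> V0" "x \<in> X u"
  then have "{y \<in> insert x R. F s x y} = {y \<in> R. F s x y}" using F_irrefl by auto
  then show ?thesis unfolding fd_def by simp
qed

lemma transv_remove:
  assumes "V \<subseteq> V0" "transv V T" "c \<in> V" "x \<in> X c" "x \<in> T"
  shows "transv (V - {c}) (T - {x})"
  unfolding transv_def
proof (intro conjI ballI)
  obtain y where "T \<inter> X c = {y}" using assms(2,3) unfolding transv_def by blast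
  then have c: "T \<inter> X c = {x}" using assms(4,5) by auto
  show "T - {x} \<subseteq> \<Union> (X ` (V - {c}))"
  proof
    fix y assume y: "y \<in> T - {x}"
    then obtain v where "v \<in> V" "y \<in> X v" using assms(2) unfolding transv_def by blast
    moreover have "y \<notin> X c" using y c by blast
    ultimately show "y \<in> \<Union> (X ` (V - {c}))" by blast
  qed
  fix v assume v: "v \<in> V - {c}"
  have "x \<notin> X v" using v assms(1,3,4) X_disj by (metis DiffD1 DiffD2 insertI1 subsetD)
  moreover obtain y where "T \<inter> X v = {y}" using assms(2) v unfolding transv_def by blast
  ultimately show "\<exists>y. (T - {x}) \<inter> X v = {y}" by auto
qed

text \<open>In a supposed colouring with colour \<open>x\<close> at \<open>c\<close>, eliminate as
  far as possible before \<open>x\<close>, down to a smallest \<open>R\<close>. The next vertex to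
  be removed from \<open>insert x R\<close> cannot lie in \<open>R\<close> by minimality of
  \<open>R\<close>, nor be \<open>x\<close>, whose weight \<open>part\<close> is at most its number
  of neighbours in \<open>R\<close>.\<close>

lemma part_uncol:
  assumes "V \<subseteq> V0" "c \<in> V"
  shows "\<not> col V (part f V c)"
proof
  assume "col V (part f V c)"
  then obtain T' where T': "transv V T'" "sdeg (part f V c) T'" unfolding col_def by blast
  obtain x where x: "T' \<inter> X c = {x}" using T'(1) assms unfolding transv_def by blast
  have c0: "c \<in> V0" using assms by blast
  define T where "T = T' - {x}"
  have tr: "transv (V - {c}) T" unfolding T_def using transv_remove[OF assms(1) T'(1) assms(2)] x by blast
  have TX: "y \<notin> X c" if "y \<in> T" for y using transv_notin[OF tr _ c0 _ that] assms(1) by blast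
  have "sdeg (part f V c) T" using sdeg_mono[OF T'(2)] unfolding T_def by blast
  then have sd: "sdeg f T" using sdeg_cong[of T "part f V c" f] TX unfolding part_def by simp
  have finT: "finite T" using finite_transv tr assms(1) by blast
  have "elim f T T x" unfolding elim_def by blast
  from ex_has_least_nat[of "\<lambda>R. elim f T R x", OF this, of card]
  obtain R where R: "elim f T R x" and least: "\<And>R'. elim f T R' x \<Longrightarrow> card R \<le> card R'" by blast
  have RT: "R \<subseteq> T" using R unfolding elim_def by blast
  then have finR: "finite R" using finT finite_subset by blast
  have "insert x R \<subseteq> T'" using RT x unfolding T_def by blast
  with T'(2) obtain y s where y: "y \<in> insert x R" "fd s y (insert x R) < part f V c s y"
    unfolding sdeg_def by (meson insert_not_empty)
  show False
  proof (cases "y = x")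
    case True
    have "fd s x (insert x R) = fd s x R" using fd_insert_self[OF c0] x by blast
    moreover have "part f V c s x \<le> fd s x R" using part_le[OF _ tr sd R] x by blast
    ultimately show False using y True by simp
  next
    case False
    then have yR: "y \<in> R" using y by blast
    have ylt: "fd s y (insert x R) < f s y" using y(2) TX[of y] yR RT unfolding part_def by auto
    have "elim f T (R - {y}) x"
      unfolding elim_def
    proof (intro conjI allI impI)
      show "R - {y} \<subseteq> T" using RT by blast
      fix S assume S: "S \<subseteq> T" "R - {y} \<subseteq> S" "S \<noteq> R - {y}"
      show "\<exists>z\<in>S - (R - {y}). \<exists>s. fd s z (insert x S) < f s z"
      proof (cases "S = R")
        case True
        then show ?thesis using yR ylt by blast
      next
        case False
        have ins: "insert y S \<noteq> R" using S False by auto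
        have "insert y S \<subseteq> T" "R \<subseteq> insert y S" using S yR RT by auto
        then obtain z s' where z: "z \<in> insert y S - R" "fd s' z (insert x (insert y S)) < f s' z"
          using R ins unfolding elim_def by meson
        have "finite (insert x (insert y S))" using S(1) finT finite_subset by auto
        then have "fd s' z (insert x S) \<le> fd s' z (insert x (insert y S))" by (rule fd_mono) blast
        then have "fd s' z (insert x S) < f s' z" using z by simp
        moreover have "z \<in> S - (R - {y})" using z yR by blast
        ultimately show ?thesis by blast
      qed
    qed
    from least[OF this] have "card R \<le> card (R - {y})" .
    then show False using card_Diff1_less[OF finR yR] by simp
  qed
qed

lemma fd_union_le:
  assumes "finite A" "finite B"
  shows "fd s x (A \<union> B) \<le> fd s x A + fd s x B"
proof -
  have "{y \<in> A \<union> B. F s x y} = {y \<in> A. F s x y} \<union> {y \<in> B. F s x y}" by blast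
  then show ?thesis unfolding fd_def by (simp add: card_Un_le)
qed

lemma fd_outside: "(\<And>y. y \<in> B \<Longrightarrow> \<not> F s x y) \<Longrightarrow> fd s x (A \<union> B) = fd s x A"
proof -
  assume "\<And>y. y \<in> B \<Longrightarrow> \<not> F s x y"
  then have "{y \<in> A \<union> B. F s x y} = {y \<in> A. F s x y}" by blast
  then show ?thesis unfolding fd_def by simp
qed

text \<open>As \<open>S\<close> meets \<open>T\<close> outside \<open>R\<close>, elimination applied
  to \<open>(S \<inter> T) \<union> R\<close> removes a vertex outside \<open>R\<close>, which then
  lies in \<open>S\<close>. Adding \<open>R\<close> could only raise its degree, and it has no arcs
  to the rest of \<open>S\<close>.\<close>

lemma elim_glue:
  assumes "elim f T R x" "finite T" "finite S" "x \<in> S" "\<not> S \<inter> T \<subseteq> R"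
    and "\<And>y z s. y \<in> T \<Longrightarrow> z \<in> S - insert x T \<Longrightarrow> \<not> F s y z"
  shows "\<exists>y\<in>S. \<exists>s. fd s y S < f s y"
proof -
  have RT: "R \<subseteq> T" using assms(1) unfolding elim_def by blast
  let ?S = "(S \<inter> T) \<union> R"
  have "?S \<subseteq> T" "R \<subseteq> ?S" "?S \<noteq> R" using RT assms(5) by auto
  then obtain y s where y: "y \<in> ?S - R" "fd s y (insert x ?S) < f s y"
    using assms(1) unfolding elim_def by meson
  have yT: "y \<in> T" "y \<in> S" using y by auto
  have "S = insert x (S \<inter> T) \<union> (S - insert x T)" using assms(4) by blast
  then have "fd s y S = fd s y (insert x (S \<inter> T))"
    using fd_outside[of "S - insert x T" s y "insert x (S \<inter> T)"] assms(6)[OF yT(1)] by metis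
  also have "\<dots> \<le> fd s y (insert x ?S)"
    by (rule fd_mono) (use assms(2) RT finite_subset in auto)
  finally show ?thesis using y(2) yT(2) by (meson le_less_trans)
qed

lemma transv_union:
  assumes "A \<inter> B = {}" "A \<union> B \<subseteq> V0" "transv A S" "transv B T"
  shows "transv (A \<union> B) (S \<union> T)"
  unfolding transv_def
proof (intro conjI ballI)
  show "S \<union> T \<subseteq> \<Union> (X ` (A \<union> B))" using assms(3,4) unfolding transv_def by auto
  fix v assume v: "v \<in> A \<union> B"
  show "\<exists>x. (S \<union> T) \<inter> X v = {x}"
  proof (cases "v \<in> A")
    case True
    then have "T \<inter> X v = {}" using transv_notin[OF assms(4), of v] assms(1,2) by auto
    moreover obtain x where "S \<inter> X v = {x}" using True assms(3) unfolding transv_def by blast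
    ultimately have "(S \<union> T) \<inter> X v = {x}" by auto
    then show ?thesis by blast
  next
    case False
    then have "S \<inter> X v = {}" using transv_notin[OF assms(3), of v] v assms(1,2) by auto
    moreover obtain x where "T \<inter> X v = {x}" using False v assms(4) unfolding transv_def by blast
    ultimately have "(S \<union> T) \<inter> X v = {x}" by auto
    then show ?thesis by blast
  qed
qed

lemma transv_no_F:
  assumes "A \<subseteq> V0" "B \<subseteq> V0" "transv A S" "transv B T" "\<And>u v. u \<in> A \<Longrightarrow> v \<in> B \<Longrightarrow> \<not> adj u v"
    and "y \<in> S" "z \<in> T"
  shows "\<not> F s y z"
proof
  assume F: "F s y z"
  obtain u where "u \<in> A" "y \<in> X u" using assms(3,6) unfolding transv_def by blast
  moreover obtain v where "v \<in> B" "z \<in> X v" using assms(4,7) unfolding transv_def by blast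
  ultimately have "E s u v" using F_E F assms(1,2) by blast
  then show False using assms(5) adj_E \<open>u \<in> A\<close> \<open>v \<in> B\<close> by blast
qed

text \<open>
  Splitting a configuration at a cut vertex \<open>c\<close>. Relative to one side, the weights that still cannot
  be used at a colour \<open>x\<close> of \<open>c\<close> form a rectangle, whose corner is \<open>part\<close>; if the two corners
  did not add up to at least \<open>f x\<close>, colourings of the two sides could be combined.
\<close>

lemma split_cut:
  assumes V: "V \<subseteq> V0" "V = V1 \<union> V2" "V1 \<inter> V2 = {c}"
    and noadj: "\<And>u v. u \<in> V1 - {c} \<Longrightarrow> v \<in> V2 - {c} \<Longrightarrow> \<not> adj u v"
    and cn: "conn V1" "conn V2" and u: "ucf V f"
  shows "ucf V1 (part f V1 c)" and "ucf V2 (part f V2 c)"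
    and "\<And>x s. x \<in> X c \<Longrightarrow> f s x = part f V1 c s x + part f V2 c s x"
    and "\<And>x s. x \<notin> X c \<Longrightarrow> part f W c s x = f s x"
proof -
  have c: "c \<in> V1" "c \<in> V2" "c \<in> V" "c \<in> V0" using V by auto
  have V12: "V1 \<subseteq> V0" "V2 \<subseteq> V0" using V by auto
  have feas: "dg V s v \<le> sum (f s) (X v)" if "v \<in> V" for v s
    using u that unfolding ucf_def feas_def by blast
  have d1: "dg V1 s v = dg V s v" if "v \<in> V1 - {c}" for s v
    unfolding dg_def using noadj[OF that] V(2,3) adj_E by (metis (no_types, lifting) Diff_iff UnE UnI1 singletonD c(1))
  have d2: "dg V2 s v = dg V s v" if "v \<in> V2 - {c}" for s v
    unfolding dg_def using noadj[OF _ that] V(2,3) adj_E adj_sym by (metis (no_types, lifting) Diff_iff UnE UnI2 singletonD c(2))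
  have dc: "dg V s c = dg V1 s c + dg V2 s c" for s
  proof -
    have "{u \<in> V. E s c u} = {u \<in> V1. E s c u} \<union> {u \<in> V2. E s c u}" using V(2) by blast
    moreover have "{u \<in> V1. E s c u} \<inter> {u \<in> V2. E s c u} = {}"
    proof -
      have "{u \<in> V1. E s c u} \<inter> {u \<in> V2. E s c u} = {u \<in> V1 \<inter> V2. E s c u}" by blast
      then show ?thesis using E_irrefl unfolding V(3) by auto
    qed
    ultimately show ?thesis unfolding dg_def using finite_sub V12 by (simp add: card_Un_disjoint)
  qed
  have f1: "dg V1 s v \<le> sum (f s) (X v)" if "v \<in> V1 - {c}" for v s
    using d1[OF that] feas[of v s] that V(2) by auto
  have f2: "dg V2 s v \<le> sum (f s) (X v)" if "v \<in> V2 - {c}" for v s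
    using d2[OF that] feas[of v s] that V(2) by auto
  have out: "sum (part f W c s) (X v) = sum (f s) (X v)" if "v \<in> V - {c}" for v s W
  proof (rule sum.cong[OF refl])
    fix x assume "x \<in> X v"
    then have "x \<notin> X c" using that X_disj c(4) V(1) by (metis DiffD1 DiffD2 insertI1 subsetD)
    then show "part f W c s x = f s x" unfolding part_def by simp
  qed
  \<comment> \<open>A surplus at \<open>c\<close> in a single direction would already colour this
    side by \<open>excess_col\<close>, against \<open>part_uncol\<close>.\<close>
  have b1: "sum (part f V1 c s) (X c) \<le> dg V1 s c" for s
  proof (rule ccontr)
    assume "\<not> ?thesis"
    then have "col V1 (part f V1 c)"
      using excess_col[OF V12(1) cn(1) c(1), of "part f V1 c" s] f1 out V(2) by (metis DiffD1 DiffD2 DiffI UnI1 not_le)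
    then show False using part_uncol[OF V12(1) c(1)] by blast
  qed
  have b2: "sum (part f V2 c s) (X c) \<le> dg V2 s c" for s
  proof (rule ccontr)
    assume "\<not> ?thesis"
    then have "col V2 (part f V2 c)"
      using excess_col[OF V12(2) cn(2) c(2), of "part f V2 c" s] f2 out V(2) by (metis DiffD1 DiffD2 DiffI UnI2 not_le)
    then show False using part_uncol[OF V12(2) c(2)] by blast
  qed
  have ge: "f s x \<le> part f V1 c s x + part f V2 c s x" if x: "x \<in> X c" for s x
  proof (rule ccontr)
    assume neg: "\<not> ?thesis"
    obtain T1 R1 where T1: "transv (V1 - {c}) T1" "sdeg f T1" "elim f T1 R1 x" "part f V1 c s x = fd s x R1"
      using part_witness[where f = f and s = s, OF V12(1) cn(1) c(1) x f1] by blast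
    obtain T2 R2 where T2: "transv (V2 - {c}) T2" "sdeg f T2" "elim f T2 R2 x" "part f V2 c s x = fd s x R2"
      using part_witness[where f = f and s = s, OF V12(2) cn(2) c(2) x f2] by blast
    have fin: "finite T1" "finite T2"
      using finite_transv[OF _ T1(1)] finite_transv[OF _ T2(1)] V12 by auto
    have R: "R1 \<subseteq> T1" "R2 \<subseteq> T2" using T1(3) T2(3) unfolding elim_def by auto
    have n12: "\<not> F s y z" if "y \<in> T1" "z \<in> T2" for s y z
      by (rule transv_no_F[OF _ _ T1(1) T2(1) noadj that]) (use V12 in auto)
    have n21: "\<not> F s y z" if "y \<in> T2" "z \<in> T1" for s y z
      using n12[OF that(2,1)] F_not by blast
    let ?T = "insert x (T1 \<union> T2)"
    have Veq: "V - {c} = (V1 - {c}) \<union> (V2 - {c})" using V(2) by blast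
    have "transv (V - {c}) (T1 \<union> T2)"
      unfolding Veq by (rule transv_union) (use V T1 T2 in auto)
    then have tr: "transv V ?T" using transv_insert[OF V(1) c(3) _ x] by blast
    have "sdeg f ?T"
      unfolding sdeg_def
    proof (intro allI impI)
      fix S assume S: "S \<subseteq> ?T" "S \<noteq> {}"
      have finS: "finite S" using S fin finite_subset by (metis finite_UnI finite_insert)
      show "\<exists>y\<in>S. \<exists>s. fd s y S < f s y"
      proof (cases "x \<in> S")
        case False
        then have S12: "S = (S \<inter> T1) \<union> (S \<inter> T2)" "S = (S \<inter> T2) \<union> (S \<inter> T1)" using S by auto
        show ?thesis
        proof (cases "S \<inter> T1 = {}")
          case True
          then have "S \<subseteq> T2" using S12 by blast
          then show ?thesis using T2(2) S(2) unfolding sdeg_def by blast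
        next
          case False
          then obtain y s' where y: "y \<in> S \<inter> T1" "fd s' y (S \<inter> T1) < f s' y"
            using T1(2) unfolding sdeg_def by (meson inf_le2)
          have "fd s' y S = fd s' y (S \<inter> T1)"
            using fd_outside[of "S \<inter> T2" s' y "S \<inter> T1"] S12(1) n12 y(1) by (metis IntD2)
          then show ?thesis using y by (metis IntD1)
        qed
      next
        case True
        show ?thesis
        proof (cases "S \<inter> T1 \<subseteq> R1")
          case False
          show ?thesis
            by (rule elim_glue[OF T1(3) fin(1) finS True False]) (use S n12 in auto)
        next
          case S1: True
          show ?thesis
          proof (cases "S \<inter> T2 \<subseteq> R2")
            case False
            show ?thesis
              by (rule elim_glue[OF T2(3) fin(2) finS True False]) (use S n21 in auto)
          next
            case S2: True
            \<comment> \<open>With both sides eliminated down to \<open>R1\<close> and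
              \<open>R2\<close>, it is the turn of \<open>x\<close>: the corners add up to less than
              \<open>f s x\<close> by assumption.\<close>
            have "S \<subseteq> insert x (R1 \<union> R2)" using S S1 S2 by blast
            moreover have fR: "finite R1" "finite R2" using R fin finite_subset by auto
            ultimately have "fd s x S \<le> fd s x (insert x (R1 \<union> R2))" by (intro fd_mono) auto
            also have "\<dots> = fd s x (R1 \<union> R2)" using fd_insert_self[OF c(4) x] .
            also have "\<dots> \<le> fd s x R1 + fd s x R2" using fd_union_le fR by blast
            also have "\<dots> < f s x" using neg T1(4) T2(4) by simp
            finally show ?thesis using True by blast
          qed
        qed
      qed
    qed
    then have "col V f" using tr unfolding col_def by blast
    then show False using u unfolding ucf_def by blast
  qed
  \<comment> \<open>The inequalities now close up: the weight sum at \<open>c\<close> is at most the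
    sum of both parts, these are at most the two degrees, and the degrees add up to the degree of
    \<open>c\<close>, which feasibility bounds by the weight sum.\<close>
  have chain: "sum (f s) (X c) \<le> sum (part f V1 c s) (X c) + sum (part f V2 c s) (X c)" for s
    using sum_mono[of "X c" "f s" "\<lambda>x. part f V1 c s x + part f V2 c s x"] ge by (simp add: sum.distrib)
  have e1: "sum (part f V1 c s) (X c) = dg V1 s c" and e2: "sum (part f V2 c s) (X c) = dg V2 s c" for s
    using chain[of s] b1[of s] b2[of s] dc[of s] feas[OF c(3), of s] by linarith+
  show "ucf V1 (part f V1 c)"
    unfolding ucf_def feas_def
  proof (intro conjI ballI allI)
    fix v s assume v: "v \<in> V1"
    show "dg V1 s v \<le> sum (part f V1 c s) (X v)"
      using e1[of s] f1[of v s] out[of v V1 s] v V(2) by (cases "v = c") auto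
  qed (rule part_uncol[OF V12(1) c(1)])
  show "ucf V2 (part f V2 c)"
    unfolding ucf_def feas_def
  proof (intro conjI ballI allI)
    fix v s assume v: "v \<in> V2"
    show "dg V2 s v \<le> sum (part f V2 c s) (X v)"
      using e2[of s] f2[of v s] out[of v V2 s] v V(2) by (cases "v = c") auto
  qed (rule part_uncol[OF V12(2) c(2)])
  show "f s x = part f V1 c s x + part f V2 c s x" if "x \<in> X c" for s x
  proof (rule ccontr)
    assume "f s x \<noteq> part f V1 c s x + part f V2 c s x"
    then have "f s x < part f V1 c s x + part f V2 c s x" using ge[OF that, of s] by simp
    then have "sum (f s) (X c) < (\<Sum>x\<in>X c. part f V1 c s x + part f V2 c s x)"
      using ge that by (intro sum_strict_mono_ex1[OF finite_X[OF c(4)]]) auto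
    then show False using e1[of s] e2[of s] dc[of s] feas[OF c(3), of s] by (simp add: sum.distrib)
  qed
  show "part f W c s x = f s x" if "x \<notin> X c" for x s using that unfolding part_def by simp
qed

section \<open>End blocks\<close>

text \<open>\<open>C\<close> is a union of some, but not all, components of \<open>W - {c}\<close>.\<close>

definition piece :: "'a set \<Rightarrow> 'a \<Rightarrow> 'a set \<Rightarrow> bool" where
  "piece W c C \<longleftrightarrow> c \<in> W \<and> C \<subseteq> W - {c} \<and> C \<noteq> {} \<and> W - {c} - C \<noteq> {} \<and>
     (\<forall>u\<in>C. \<forall>v\<in>W - {c} - C. \<not> adj u v)"

text \<open>\<open>B\<close> is an end block of \<open>V - {a}\<close> and \<open>C\<close> consists of its vertices that do not separate \<open>V - {a}\<close>.\<close>

definition lobe :: "'a set \<Rightarrow> 'a \<Rightarrow> 'a set \<Rightarrow> 'a set \<Rightarrow> bool" where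
  "lobe V a B C \<longleftrightarrow> a \<in> V \<and> blk B \<and>
     (B = V - {a} \<and> C = V - {a} \<or> (\<exists>c. piece (V - {a}) c C \<and> B = insert c C)) \<and>
     (\<forall>u\<in>C. conn (V - {a} - {u}))"

lemma not_conn_piece:
  assumes "c \<in> W" "W - {c} \<noteq> {}" "\<not> conn (W - {c})"
  obtains C where "piece W c C"
proof -
  obtain A where "A \<subseteq> W - {c}" "A \<noteq> {}" "A \<noteq> W - {c}" "\<forall>u\<in>A. \<forall>v\<in>W - {c} - A. \<not> adj u v"
    using assms unfolding conn_def by blast
  then show thesis using that[of A] assms(1) unfolding piece_def by blast
qed

lemma piece_compl: "piece W c C \<Longrightarrow> piece W c (W - {c} - C)"
proof -
  assume p: "piece W c C"
  then have "W - {c} - (W - {c} - C) = C" unfolding piece_def by blast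
  then show ?thesis using p adj_sym unfolding piece_def by (metis Diff_subset)
qed

lemma piece_conn_insert:
  assumes "conn W" "piece W c C"
  shows "conn (insert c C)"
proof (rule conn_I[of c])
  fix A assume A: "A \<subseteq> insert c C" "A \<noteq> {}" "c \<notin> A" "\<forall>u\<in>A. \<forall>v\<in>insert c C - A. \<not> adj u v"
  have AC: "A \<subseteq> C" using A by blast
  then have "A \<subseteq> W" "A \<noteq> W" using assms(2) A(3) unfolding piece_def by auto
  then obtain u v where "u \<in> A" "v \<in> W" "v \<notin> A" "adj u v" using conn_cut[OF assms(1)] A(2) by blast
  then show False using A(4) AC assms(2) unfolding piece_def by blast
qed simp

text \<open>Take a piece with fewest vertices inside \<open>C0\<close>, leaving its separating
  vertex free. A separation caused by deleting a vertex of \<open>C\<close>, or a disconnected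
  \<open>C\<close>, would yield a smaller piece inside it.\<close>

lemma min_piece:
  assumes "conn W" "finite W" "piece W c0 C0"
  obtains c C where "piece W c C" "C \<subseteq> C0" "\<And>u. u \<in> C \<Longrightarrow> conn (W - {u})" "blk (insert c C)"
proof -
  let ?P = "\<lambda>(c, C). piece W c C \<and> C \<subseteq> C0"
  have "?P (c0, C0)" using assms by simp
  from ex_has_least_nat[of ?P, OF this, of "\<lambda>(c, C). card C"]
  obtain c C where cC: "piece W c C" "C \<subseteq> C0"
    and least: "\<And>c' C'. piece W c' C' \<Longrightarrow> C' \<subseteq> C0 \<Longrightarrow> card C \<le> card C'" by auto
  have CW: "C \<subseteq> W" "c \<in> W" "c \<notin> C" "C \<noteq> {}" using cC unfolding piece_def by auto
  have finC: "finite C" using CW assms(2) finite_subset by blast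
  have nopiece: False if "piece W c' C'" "C' \<subset> C" for c' C'
    using least[OF that(1)] that(2) cC(2) psubset_card_mono[OF finC that(2)] by auto
  have noncut: "conn (W - {u})" if u: "u \<in> C" for u
  proof (rule conn_I[of c])
    show "c \<in> W - {u}" using CW u by blast
    fix A assume A: "A \<subseteq> W - {u}" "A \<noteq> {}" "c \<notin> A" "\<forall>x\<in>A. \<forall>y\<in>W - {u} - A. \<not> adj x y"
    \<comment> \<open>The part of \<open>A\<close> outside \<open>C\<close> would have no neighbour
      in \<open>C\<close>, in particular not \<open>u\<close>, and so be closed off in all of
      \<open>W\<close>.\<close>
    have AC: "A \<subseteq> C"
    proof (rule ccontr)
      assume "\<not> A \<subseteq> C"
      then have ne: "A - C \<noteq> {}" by blast
      have sub: "A - C \<subseteq> W" "A - C \<noteq> W" using A(1) CW by auto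
      obtain x y where xy: "x \<in> A - C" "y \<in> W" "y \<notin> A - C" "adj x y"
        using conn_cut[OF assms(1) sub(1) ne sub(2)] by blast
      have "x \<in> W - {c} - C" using xy(1) A by blast
      then have "y \<notin> C" using cC(1) xy(4) adj_sym unfolding piece_def by blast
      then have "y \<notin> A" "y \<noteq> u" using xy(3) u by auto
      then show False using A(4) xy by blast
    qed
    have "piece W u A"
      unfolding piece_def
    proof (intro conjI)
      show "W - {u} - A \<noteq> {}" using CW u A by blast
    qed (use A u CW in auto)
    then show False using nopiece[of u A] AC A(1) u by blast
  qed
  have cB: "conn (insert c C)" using piece_conn_insert assms cC by blast
  have "blk (insert c C)"
    unfolding blk_def
  proof (intro conjI ballI)
    show "conn (insert c C)" by fact
    have "0 < card C" using finC CW by (simp add: card_gt_0_iff)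
    then show "2 \<le> card (insert c C)" using finC CW by simp
    fix v assume v: "v \<in> insert c C"
    show "conn (insert c C - {v})"
    proof (cases "v = c")
      case True
      have "conn C"
        unfolding conn_def
      proof (intro conjI allI impI)
        show "C \<noteq> {}" by fact
        fix A assume A: "A \<subseteq> C" "A \<noteq> {} \<and> A \<noteq> C"
        show "\<exists>u\<in>A. \<exists>v\<in>C - A. adj u v"
        proof (rule ccontr)
          assume neg: "\<not> ?thesis"
          have "piece W c A"
            unfolding piece_def
          proof (intro conjI)
            show "\<forall>u\<in>A. \<forall>v\<in>W - {c} - A. \<not> adj u v" using neg cC(1) A unfolding piece_def by blast
          qed (use A CW in auto)
          then show False using nopiece A by blast
        qed
      qed
      moreover have "insert c C - {v} = C" using True CW by blast
      ultimately show ?thesis by simp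
    next
      case False
      then have vC: "v \<in> C" using v by blast
      show ?thesis
      proof (rule conn_I[of c])
        show "c \<in> insert c C - {v}" using False by blast
        fix A assume A: "A \<subseteq> insert c C - {v}" "A \<noteq> {}" "c \<notin> A"
          "\<forall>x\<in>A. \<forall>y\<in>insert c C - {v} - A. \<not> adj x y"
        have AC: "A \<subseteq> C" using A by blast
        have sub: "A \<subseteq> W - {v}" "A \<noteq> W - {v}" using A CW vC by auto
        obtain x y where xy: "x \<in> A" "y \<in> W - {v}" "y \<notin> A" "adj x y"
          using conn_cut[OF noncut[OF vC] sub(1) A(2) sub(2)] by blast
        have "y \<in> insert c C" using xy AC cC(1) unfolding piece_def by blast
        then show False using xy A(4) by blast
      qed
    qed
  qed
  then show thesis using that cC noncut by blast
qed

lemma lobe_cases: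
  assumes "V \<subseteq> V0" "blk V" "a \<in> V" "3 \<le> card V"
  shows "lobe V a (V - {a}) (V - {a}) \<or> (\<exists>c C. piece (V - {a}) c C)"
proof (cases "blk (V - {a})")
  case True
  then show ?thesis using assms(3) unfolding lobe_def blk_def by blast
next
  case False
  have fin: "finite V" using finite_sub assms(1) by blast
  have cn: "conn (V - {a})" using assms unfolding blk_def by blast
  have c2: "2 \<le> card (V - {a})" using assms(3,4) fin by simp
  obtain c where c: "c \<in> V - {a}" "\<not> conn (V - {a} - {c})" using False cn c2 unfolding blk_def by blast
  have "V - {a} - {c} \<noteq> {}"
  proof
    assume "V - {a} - {c} = {}"
    then have "V - {a} = {c}" using c by blast
    then show False using c2 by simp
  qed
  then show ?thesis using not_conn_piece[OF c(1) _ c(2)] by metis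
qed

lemma piece_lobe:
  assumes "V \<subseteq> V0" "blk V" "a \<in> V" "piece (V - {a}) c0 C0"
  obtains c C where "piece (V - {a}) c C" "C \<subseteq> C0" "lobe V a (insert c C) C"
proof -
  have cn: "conn (V - {a})" using assms unfolding blk_def by blast
  have fin: "finite (V - {a})" using finite_sub assms(1) by blast
  obtain c C where "piece (V - {a}) c C" "C \<subseteq> C0" "\<And>u. u \<in> C \<Longrightarrow> conn (V - {a} - {u})" "blk (insert c C)"
    using min_piece[OF cn fin assms(4)] by metis
  then show thesis using that[of c C] assms(3) unfolding lobe_def by metis
qed

section \<open>Blocks whose underlying graph is complete or a cycle\<close>

definition nb :: "'a set \<Rightarrow> 'a \<Rightarrow> 'a set" where
  "nb V u = {v \<in> V. adj u v}"

lemma nb_ge2: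
  assumes "V \<subseteq> V0" "blk V" "3 \<le> card V" "u \<in> V"
  shows "2 \<le> card (nb V u)"
proof (rule ccontr)
  assume neg: "\<not> ?thesis"
  have fin: "finite V" using finite_sub assms(1) by blast
  then have finn: "finite (nb V u)" unfolding nb_def by simp
  have cu: "conn V" using assms unfolding blk_def by blast
  have "{u} \<noteq> V" using assms(3) by auto
  then obtain p where p: "p \<in> V" "adj u p" using conn_cut[OF cu, of "{u}"] assms(4) by (metis empty_not_insert empty_subsetI insert_subset singletonD)
  then have "p \<in> nb V u" unfolding nb_def by blast
  moreover from this have "card (nb V u) = 1" using neg finn card_gt_0_iff[of "nb V u"] by auto
  ultimately have nbp: "nb V u = {p}" by (auto simp: card_1_singleton_iff)
  have cp: "conn (V - {p})" using assms p unfolding blk_def by blast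
  have up: "u \<noteq> p" using p adj_irrefl by blast
  have "{u} \<noteq> V - {p}"
  proof
    assume "{u} = V - {p}"
    then have "V = {u, p}" using p by blast
    then show False using assms(3) up by simp
  qed
  then obtain q where "q \<in> V - {p}" "adj u q"
    using conn_cut[OF cp, of "{u}"] assms(4) up by (metis Diff_iff empty_not_insert empty_subsetI insert_subset singletonD)
  then show False using nbp unfolding nb_def by blast
qed

text \<open>Suppose that deleting \<open>s\<close> as well cuts off a set \<open>L\<close> from
  \<open>a\<close>. It avoids \<open>C\<close>, whose vertices are all adjacent to \<open>a\<close>.
  It must have \<open>u\<close> as a neighbour, and outside \<open>C\<close> the only possible
  neighbours of \<open>u\<close> are \<open>a\<close> and \<open>c\<close>, so \<open>L\<close>
  contains \<open>c\<close>. From \<open>c\<close> one is led to a vertex of \<open>L\<close> that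
  is adjacent to \<open>a\<close> or lies in \<open>C\<close>.\<close>

lemma lobe_piece_big_imp_blk:
  assumes V: "V \<subseteq> V0" "blk V" "a \<in> V"
    and pc: "piece (V - {a}) c C" and lb: "lobe V a (insert c C) C"
    and ad: "\<And>u. u \<in> C \<Longrightarrow> adj a u" and uw: "u \<in> C" "w \<in> C" "u \<noteq> w"
  shows "blk (V - {u})"
proof -
  have fin: "finite V" using finite_sub V by blast
  have CV: "C \<subseteq> V" "c \<in> V" "c \<noteq> a" "c \<notin> C" "a \<notin> C" using pc unfolding piece_def by auto
  define Z where "Z = V - {a} - C"
  have Yn: "Z - {c} \<noteq> {}" using pc unfolding piece_def Z_def by blast
  have nCY: "\<not> adj x y" "\<not> adj y x" if "x \<in> C" "y \<in> Z - {c}" for x y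
    using pc that adj_sym unfolding piece_def Z_def by blast+
  have cnu: "conn (V - {u})" using V uw CV unfolding blk_def by blast
  have cna: "conn (V - {a})" using V unfolding blk_def by blast
  have cnc: "conn (V - {c})" using V CV unfolding blk_def by blast
  have Zc: "c \<in> Z" unfolding Z_def using CV by blast
  have connZ: "\<exists>x\<in>A. \<exists>y\<in>Z - A. adj x y" if A: "A \<subseteq> Z" "A \<noteq> {}" "c \<notin> A" for A
  proof -
    have "A \<subseteq> V - {a}" "A \<noteq> V - {a}" using A CV unfolding Z_def by auto
    then obtain x y where xy: "x \<in> A" "y \<in> V - {a}" "y \<notin> A" "adj x y" using conn_cut[OF cna] A(2) by metis
    have "y \<notin> C" using nCY(2)[of y x] xy A by blast
    then show ?thesis using xy unfolding Z_def by blast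
  qed
  show ?thesis
    unfolding blk_def
  proof (intro conjI ballI)
    show "conn (V - {u})" by fact
    have "w \<noteq> c" "w \<noteq> a" "c \<noteq> a" using uw CV by auto
    then have "card {w, c, a} = 3" by simp
    moreover have "{w, c, a} \<subseteq> V - {u}" using uw CV V by auto
    ultimately have "3 \<le> card (V - {u})" using fin card_mono by (metis finite_Diff)
    then show "2 \<le> card (V - {u})" by simp
    fix s assume s: "s \<in> V - {u}"
    show "conn (V - {u} - {s})"
    proof (cases "s = a")
      case True
      have "V - {u} - {s} = V - {a} - {u}" using True by blast
      then show ?thesis using lb uw unfolding lobe_def by simp
    next
      case False
      show ?thesis
      proof (rule conn_I[of a])
        show "a \<in> V - {u} - {s}" using V False uw CV by blast
        fix L assume L: "L \<subseteq> V - {u} - {s}" "L \<noteq> {}" "a \<notin> L"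
          and nadj: "\<forall>x\<in>L. \<forall>y\<in>V - {u} - {s} - L. \<not> adj x y"
        have aout: "a \<in> V - {u} - {s} - L" using V False uw CV L(3) by blast
        have LC: "L \<inter> C = {}" using ad adj_sym nadj aout by blast
        have cs: "conn (V - {s})" using V s unfolding blk_def by blast
        have "L \<subseteq> V - {s}" "L \<noteq> V - {s}" using L aout by auto
        then obtain l y where ly: "l \<in> L" "y \<in> V - {s}" "y \<notin> L" "adj l y" using conn_cut[OF cs] L(2) by metis
        have "y = u" using ly nadj by blast
        then have "\<not> l \<in> Z - {c}" using nCY(2)[of u l] ly uw by blast
        then have "l = c" using ly(1) L LC unfolding Z_def by blast
        then have cL: "c \<in> L" using ly by simp
        show False
        proof (cases "s \<in> C")
          case True
          \<comment> \<open>\<open>Z\<close> holds together through \<open>c\<close>, so all of it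
            is on the side of \<open>c\<close>; yet \<open>Z - {c}\<close> must reach
            \<open>a\<close> when \<open>c\<close> is deleted.\<close>
          have ZL: "Z \<subseteq> L"
          proof (rule ccontr)
            assume "\<not> Z \<subseteq> L"
            then obtain x y where "x \<in> Z - L" "y \<in> Z - (Z - L)" "adj x y" using connZ[of "Z - L"] cL by blast
            moreover have "Z - L \<subseteq> V - {u} - {s} - L" unfolding Z_def using True uw by blast
            ultimately show False using nadj adj_sym by blast
          qed
          have sub: "Z - {c} \<subseteq> V - {c}" "Z - {c} \<noteq> V - {c}" unfolding Z_def using V CV by auto
          obtain x y where xy: "x \<in> Z - {c}" "y \<in> V - {c}" "y \<notin> Z - {c}" "adj x y"
            using conn_cut[OF cnc sub(1) Yn sub(2)] by blast
          have "y \<notin> C" using nCY(2)[of y x] xy by blast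
          then have "y = a" using xy unfolding Z_def by blast
          then show False using xy ZL nadj aout by blast
        next
          case sC: False
          have cu: "conn (V - {a} - {u})" using lb uw unfolding lobe_def by blast
          \<comment> \<open>The second inner vertex \<open>w\<close> makes \<open>C - {u}\<close>
            non-empty. Without \<open>a\<close> and \<open>u\<close> its only way out is
            \<open>c\<close>, and this puts a vertex of \<open>C\<close> into
            \<open>L\<close>.\<close>
          have sub: "C - {u} \<subseteq> V - {a} - {u}" "C - {u} \<noteq> {}" "C - {u} \<noteq> V - {a} - {u}" using CV uw by auto
          obtain x y where xy: "x \<in> C - {u}" "y \<in> V - {a} - {u}" "y \<notin> C - {u}" "adj x y"
            using conn_cut[OF cu sub] by blast
          have "y = c" using nCY(1)[of x y] xy unfolding Z_def by blast
          then have "x \<in> L" using nadj cL xy sC CV adj_sym by blast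
          then show False using LC xy by blast
        qed
      qed
    qed
  qed
qed

text \<open>
  A vertex of degree two forces both its neighbours to have degree two, so that the graph is a
  cycle. Otherwise an end block of \<open>V - {a}\<close> has at least two inner vertices, and deleting one of
  them leaves a block, so that this vertex would have to be adjacent to everything.
\<close>

lemma complete_or_cycle:
  assumes V: "V \<subseteq> V0" "blk V" "3 \<le> card V"
    and ad: "\<And>a B C u. lobe V a B C \<Longrightarrow> u \<in> C \<Longrightarrow> adj a u"
  shows "(\<forall>u\<in>V. \<forall>v\<in>V. u \<noteq> v \<longrightarrow> adj u v) \<or> (\<forall>u\<in>V. card (nb V u) = 2)"
proof (rule disjCI)
  assume "\<not> (\<forall>u\<in>V. card (nb V u) = 2)"
  then obtain w0 where w0: "w0 \<in> V" "card (nb V w0) \<noteq> 2" by blast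
  have fin: "finite V" using finite_sub V by blast
  have finn: "finite (nb V u)" for u unfolding nb_def using fin by simp
  have lobes: "(\<forall>u\<in>V-{a}. adj a u) \<or> (\<exists>c C. piece (V - {a}) c C)" if "a \<in> V" for a
    using lobe_cases[OF V(1,2) that V(3)] ad by blast
  have blkall: "adj a u" if "blk (V - {a})" "a \<in> V" "u \<in> V - {a}" for a u
  proof -
    have "lobe V a (V - {a}) (V - {a})" using that unfolding lobe_def blk_def by blast
    then show ?thesis using ad that by blast
  qed
  show "\<forall>u\<in>V. \<forall>v\<in>V. u \<noteq> v \<longrightarrow> adj u v"
  proof (rule ccontr)
    assume "\<not> ?thesis"
    then obtain a b where ab: "a \<in> V" "b \<in> V" "a \<noteq> b" "\<not> adj a b" by blast
    obtain c0 C0 where "piece (V - {a}) c0 C0" using lobes[OF ab(1)] ab by blast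
    then obtain c C where pc: "piece (V - {a}) c C" and lb: "lobe V a (insert c C) C"
      using piece_lobe[OF V(1,2) ab(1)] by metis
    have CV: "C \<subseteq> V" "c \<in> V" "c \<noteq> a" "c \<notin> C" "a \<notin> C" "C \<noteq> {}" using pc unfolding piece_def by auto
    have adC: "adj a u" if "u \<in> C" for u using ad[OF lb that] .
    obtain y where y: "y \<in> V - {a} - {c} - C" using pc unfolding piece_def by blast
    obtain u where u: "u \<in> C" using CV by blast
    have nuy: "\<not> adj u y" using pc u y unfolding piece_def by blast
    \<comment> \<open>A second inner vertex would make \<open>V - {u}\<close> a block, and then
      \<open>u\<close> would be adjacent to every vertex, including \<open>y\<close>.\<close>
    have Cu: "C = {u}"
    proof (rule ccontr)
      assume "C \<noteq> {u}"
      then obtain w where "w \<in> C" "u \<noteq> w" using u by blast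
      then have "blk (V - {u})" using lobe_piece_big_imp_blk[OF V(1,2) ab(1) pc lb adC u] by blast
      then show False using blkall[of u y] nuy y u CV by blast
    qed
    have deg2: "card (nb V v) = 2" if "nb V v \<subseteq> {p, q}" "v \<in> V" for v p q
    proof -
      have "card (nb V v) \<le> card {p, q}" by (rule card_mono) (use that in auto)
      also have "\<dots> \<le> 2" by (simp add: card_insert_if)
      finally show ?thesis using nb_ge2[OF V that(2)] by simp
    qed
    have "nb V u \<subseteq> {a, c}" unfolding nb_def using pc u Cu adj_irrefl unfolding piece_def by blast
    then have u2: "card (nb V u) = 2" using deg2 u CV by blast
    have "a \<noteq> c" "a \<noteq> u" "a \<noteq> y" "c \<noteq> u" "c \<noteq> y" "u \<noteq> y" using CV u y by auto
    then have "card {a, c, u, y} = 4" by simp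
    moreover have "{a, c, u, y} \<subseteq> V" using ab CV u y by auto
    ultimately have c4: "4 \<le> card V" using fin card_mono by metis
    \<comment> \<open>With at least four vertices, a vertex \<open>x\<close> of degree two is not
      adjacent to all others, so \<open>V - {x}\<close> has a cut vertex. The lobes on its two sides
      are disjoint and consist of neighbours of \<open>x\<close>, hence of one neighbour each; the
      lobe \<open>{p}\<close> leaves \<open>p\<close> only \<open>x\<close> and one cut vertex as
      neighbours.\<close>
    have nbr2: "card (nb V p) = 2" if x: "x \<in> V" "card (nb V x) = 2" and p: "p \<in> V" "adj x p" for x p
    proof -
      have pn: "p \<in> nb V x" using p unfolding nb_def by blast
      obtain q where q: "nb V x = {p, q}" "q \<noteq> p"
      proof -
        obtain x1 x2 where "nb V x = {x1, x2}" "x1 \<noteq> x2" using x(2) by (meson card_2_iff)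
        then show thesis using pn that[of x1] that[of x2] by auto
      qed
      have "\<exists>c C. piece (V - {x}) c C"
      proof (rule ccontr)
        assume "\<not> ?thesis"
        then have "\<forall>u\<in>V-{x}. adj x u" using lobes[OF x(1)] by metis
        then have "V - {x} \<subseteq> nb V x" unfolding nb_def by auto
        then have "card (V - {x}) \<le> 2" using x(2) finn card_mono by metis
        then show False using c4 x(1) fin by simp
      qed
      then obtain c0 K where K: "piece (V - {x}) c0 K" by blast
      obtain c1 C1 where 1: "piece (V - {x}) c1 C1" "C1 \<subseteq> K" "lobe V x (insert c1 C1) C1"
        using piece_lobe[OF V(1,2) x(1) K] by metis
      obtain c2 C2 where 2: "piece (V - {x}) c2 C2" "C2 \<subseteq> V - {x} - {c0} - K" "lobe V x (insert c2 C2) C2"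
        using piece_lobe[OF V(1,2) x(1) piece_compl[OF K]] by metis
      have sub: "C1 \<subseteq> {p, q}" "C2 \<subseteq> {p, q}"
      proof -
        have "C1 \<subseteq> nb V x" using ad[OF 1(3)] 1(1) unfolding nb_def piece_def by auto
        moreover have "C2 \<subseteq> nb V x" using ad[OF 2(3)] 2(1) unfolding nb_def piece_def by auto
        ultimately show "C1 \<subseteq> {p, q}" "C2 \<subseteq> {p, q}" using q(1) by simp_all
      qed
      have ne: "C1 \<noteq> {}" "C2 \<noteq> {}" using 1(1) 2(1) unfolding piece_def by auto
      have ne3: "C1 \<inter> C2 = {}" using 1(2) 2(2) by auto
      have "C1 = {p} \<or> C2 = {p}"
      proof (cases "p \<in> C1")
        case True
        then have "C2 = {q}" using sub(2) ne(2) ne3 by auto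
        then show ?thesis using True sub(1) ne3 by auto
      next
        case False
        then have "C1 = {q}" using sub(1) ne(1) by auto
        then show ?thesis using sub(2) ne(2) ne3 by auto
      qed
      then obtain c' where "piece (V - {x}) c' {p}" using 1 2 by blast
      then have "nb V p \<subseteq> {x, c'}" unfolding nb_def piece_def using adj_irrefl by blast
      then show ?thesis using deg2 p by blast
    qed
    let ?A = "{x \<in> V. card (nb V x) = 2}"
    have sub: "?A \<subseteq> V" "?A \<noteq> {}" "?A \<noteq> V" using w0 u2 u CV by auto
    have cV: "conn V" using V unfolding blk_def by blast
    obtain x p where "x \<in> ?A" "p \<in> V" "p \<notin> ?A" "adj x p" by (rule conn_cut[OF cV sub])
    then show False using nbr2 by blast
  qed
qed

section \<open>Blocks\<close>

lemma blk_conn: "blk V \<Longrightarrow> conn V" "blk V \<Longrightarrow> v \<in> V \<Longrightarrow> conn (V - {v})"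
  unfolding blk_def by auto

lemma blk_arc:
  assumes "V \<subseteq> V0" "blk V" "ucf V f" "u \<in> V" "v \<in> V" "E s u v"
  shows "card (supp f u) = card (supp f v)"
    and "\<And>y. y \<in> supp f u \<Longrightarrow> 0 < f s y"
    and "\<And>x. x \<in> supp f v \<Longrightarrow> 0 < f (\<not> s) x"
    and "\<And>y. y \<in> supp f u \<Longrightarrow> \<exists>x\<in>supp f v. F s y x"
    and "\<And>x. x \<in> supp f v \<Longrightarrow> \<exists>y\<in>supp f u. F s y x"
  using arc_full[OF assms(1) blk_conn(1)[OF assms(2)] assms(3,4) blk_conn(2)[OF assms(2,4)]
      assms(5) blk_conn(2)[OF assms(2,5)] assms(6)] by auto

lemma card_supp_const:
  assumes "V \<subseteq> V0" "blk V" "ucf V f" "u \<in> V" "v \<in> V"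
  shows "card (supp f u) = card (supp f v)"
proof (rule ccontr)
  assume neg: "\<not> ?thesis"
  let ?A = "{w \<in> V. card (supp f w) = card (supp f u)}"
  have "v \<notin> ?A" using neg by simp
  then have sub: "?A \<subseteq> V" "?A \<noteq> {}" "?A \<noteq> V" using assms(4,5) by blast+
  obtain x y where "x \<in> ?A" "y \<in> V" "y \<notin> ?A" "adj x y"
    by (rule conn_cut[OF blk_conn(1)[OF assms(2)] sub])
  then show False using blk_arc(1)[OF assms(1-3), of x y] unfolding adj_def by auto
qed

lemma dg_pos_arc: "0 < dg V s u \<Longrightarrow> \<exists>v\<in>V. E s u v"
  unfolding dg_def by (metis (no_types, lifting) Collect_empty_eq card.empty less_numeral_extra(3))

lemma supp_pos:
  assumes "V \<subseteq> V0" "blk V" "ucf V f" "u \<in> V" "y \<in> supp f u" "0 < dg V s u"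
  shows "0 < f s y"
  using dg_pos_arc[OF assms(6)] blk_arc(2)[OF assms(1-4)] assms(5) by blast

lemma sum_supp:
  assumes "V \<subseteq> V0" "blk V" "ucf V f" "u \<in> V"
  shows "sum (f s) (supp f u) = dg V s u"
proof -
  have "sum (f s) (supp f u) = sum (f s) (X u)"
    by (rule sum.mono_neutral_left) (use assms finite_X supp_def in auto)
  then show ?thesis using tight[OF assms(1) blk_conn(1)[OF assms(2)] assms(3,4)] by simp
qed

lemma card_supp_le_dg:
  assumes "V \<subseteq> V0" "blk V" "ucf V f" "u \<in> V" "0 < dg V s u"
  shows "card (supp f u) \<le> dg V s u"
proof -
  have "(\<Sum>x\<in>supp f u. 1) \<le> sum (f s) (supp f u)"
    by (rule sum_mono) (use supp_pos[OF assms(1-4) _ assms(5)] in force)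
  then show ?thesis using sum_supp[OF assms(1-4)] by simp
qed

lemma supp_single:
  assumes "V \<subseteq> V0" "blk V" "ucf V f" "u \<in> V" "card (supp f u) = 1" "x \<in> supp f u"
  shows "f s x = dg V s u"
proof -
  have "supp f u = {x}" using assms(5,6) by (metis card_1_singletonE singletonD)
  then show ?thesis using sum_supp[OF assms(1-4), of s] by simp
qed

lemma blk_nbr:
  assumes "blk V" "u \<in> V"
  obtains v where "v \<in> V" "adj u v"
proof -
  have "V \<noteq> {u}" using assms unfolding blk_def by auto
  then show thesis using conn_cut[OF blk_conn(1)[OF assms(1)], of "{u}"] assms(2) that
    by (metis empty_not_insert empty_subsetI insert_subset singletonD)
qed

lemma card_supp_pos:
  assumes "V \<subseteq> V0" "blk V" "ucf V f" "u \<in> V"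
  shows "0 < card (supp f u)"
proof -
  obtain v where v: "v \<in> V" "adj u v" using blk_nbr assms by blast
  then obtain s where "E s u v" unfolding adj_def by blast
  then have "0 < dg V s u" using dg_pos[OF assms(1) v(1)] by blast
  then have "supp f u \<noteq> {}" using sum_supp[OF assms, of s] by auto
  then show ?thesis using finite_supp assms by (metis card_gt_0_iff subsetD)
qed

lemma lobe_sub: "lobe V a B C \<Longrightarrow> C \<subseteq> B \<and> B \<subseteq> V - {a}"
  unfolding lobe_def piece_def by auto

text \<open>Splitting off the rest of \<open>V - {a}\<close> alters weights only at the colours of
  the cut vertex, which is not an inner vertex of the end block.\<close>

lemma lobe_ucf:
  assumes "V \<subseteq> V0" "conn (V - {a})" "lobe V a B C" "ucf (V - {a}) f"
  obtains g where "ucf B g" "\<And>u x s. u \<in> C \<Longrightarrow> x \<in> X u \<Longrightarrow> g s x = f s x"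
proof (cases "B = V - {a}")
  case True
  then show thesis using that[of f] assms by simp
next
  case False
  then obtain c where c: "piece (V - {a}) c C" "B = insert c C" using assms(3) unfolding lobe_def by blast
  define V2 where "V2 = insert c (V - {a} - {c} - C)"
  have cs: "c \<in> V - {a}" "C \<subseteq> V - {a} - {c}" "c \<in> V0" using c assms(1) unfolding piece_def by auto
  have "conn V2" unfolding V2_def using piece_conn_insert[OF assms(2) piece_compl[OF c(1)]] .
  moreover have "conn B" using piece_conn_insert[OF assms(2)] c by simp
  moreover have "V - {a} = B \<union> V2" "B \<inter> V2 = {c}" using c(2) cs unfolding V2_def by auto
  moreover have "\<not> adj u v" if "u \<in> B - {c}" "v \<in> V2 - {c}" for u v
    using that c unfolding piece_def V2_def by blast
  moreover have "V - {a} \<subseteq> V0" using assms(1) by blast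
  ultimately have "ucf B (part f B c)"
    by (intro split_cut(1)[of "V - {a}" B V2 c f] assms(4)) auto
  moreover have "\<And>x s. x \<notin> X c \<Longrightarrow> part f B c s x = f s x" unfolding part_def by simp
  moreover have "x \<notin> X c" if "u \<in> C" "x \<in> X u" for u x
  proof
    assume "x \<in> X c"
    then have "u = c" using X_disj[of u c x] that cs assms(1) by auto
    then show False using that cs by auto
  qed
  ultimately show thesis using that[of "part f B c"] by metis
qed

definition bidir :: "'a set \<Rightarrow> bool" where
  "bidir V \<longleftrightarrow> (\<forall>u\<in>V. \<forall>v\<in>V. \<forall>s. E s u v \<longrightarrow> E (\<not> s) u v)"

definition source_sink :: "'a set \<Rightarrow> bool" where
  "source_sink V \<longleftrightarrow> (\<forall>v\<in>V. \<exists>s. \<forall>u\<in>V. \<not> E s v u)"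

text \<open>What the induction over blocks with several colours of non-zero weight per vertex carries along.\<close>

definition balanced :: "'a set \<Rightarrow> (bool \<Rightarrow> 'b \<Rightarrow> nat) \<Rightarrow> bool" where
  "balanced V f \<longleftrightarrow>
     (bidir V \<and> (\<forall>v\<in>V. \<forall>x\<in>X v. f True x = f False x) \<or> source_sink V) \<and>
     (\<forall>u\<in>V. \<forall>v\<in>V. \<forall>s. E s u v \<longrightarrow>
        (\<forall>x\<in>supp f u. \<forall>y\<in>supp f v. F s x y \<longrightarrow> f s x = f (\<not> s) y))"

definition multi :: "'a set \<Rightarrow> (bool \<Rightarrow> 'b \<Rightarrow> nat) \<Rightarrow> bool" where
  "multi V f \<longleftrightarrow> (\<forall>v\<in>V. 2 \<le> card (supp f v))"

text \<open>The induction hypothesis of \<open>blk_balanced\<close> as a predicate, so that the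
  arguments using it can stand outside that induction; \<open>all_hered\<close> supplies it
  afterwards.\<close>

definition hered :: "'a set \<Rightarrow> bool" where
  "hered V \<longleftrightarrow> (\<forall>B g. B \<subset> V \<longrightarrow> blk B \<longrightarrow> ucf B g \<longrightarrow> multi B g \<longrightarrow> balanced B g)"

lemma red_le: "red f \<alpha> s x \<le> f s x"
  unfolding red_def by simp

lemma supp_red: "supp (red f \<alpha>) u \<subseteq> supp f u"
proof
  fix x assume "x \<in> supp (red f \<alpha>) u"
  then obtain s where "x \<in> X u" "0 < red f \<alpha> s x" unfolding supp_def by auto
  then show "x \<in> supp f u" using supp_I[of x u f s] red_le[of f \<alpha> s x] by simp
qed

text \<open>
  Suppose that \<open>u\<close> and \<open>b\<close> are adjacent inner vertices of an end block of \<open>V - {a}\<close>, with \<open>u\<close>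
  adjacent to \<open>a\<close> and \<open>b\<close> not. By balancedness the weights at \<open>u\<close> are determined by those at \<open>b\<close>;
  but the colour chosen for \<open>a\<close> changes the former only.
\<close>

lemma lobe_adj:
  assumes V: "V \<subseteq> V0" "blk V" "ucf V f" and mu: "multi V f"
    and he: "hered V"
    and lb: "lobe V a B C" and wC: "w \<in> C"
  shows "adj a w"
proof (rule ccontr)
  have k: "2 \<le> card (supp f v)" if "v \<in> V" for v using mu that unfolding multi_def by blast
  have IH: "balanced B g" if "B \<subset> V" "blk B" "ucf B g" "\<And>v. v \<in> B \<Longrightarrow> 2 \<le> card (supp g v)" for B g
    using he that unfolding hered_def multi_def by blast
  assume nw: "\<not> adj a w"
  have a: "a \<in> V" using lb unfolding lobe_def by blast
  have CB: "C \<subseteq> B" "B \<subseteq> V - {a}" using lobe_sub[OF lb] by auto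
  have bB: "blk B" using lb unfolding lobe_def by blast
  have BV: "B \<subset> V" "B \<subseteq> V0" using CB a V by auto
  have cn: "conn (V - {a})" using blk_conn V a by blast
  have "\<exists>u\<in>C. adj a u"
  proof (cases "C = V - {a}")
    case True
    obtain v where "v \<in> V" "adj a v" using blk_nbr V a by blast
    then show ?thesis using True adj_irrefl by blast
  next
    case False
    then obtain c where c: "piece (V - {a}) c C" using lb unfolding lobe_def by blast
    have "conn (V - {c})" using c blk_conn V unfolding piece_def by blast
    moreover have "C \<subseteq> V - {c}" "C \<noteq> {}" "C \<noteq> V - {c}" using c a unfolding piece_def by auto
    ultimately obtain x y where xy: "x \<in> C" "y \<in> V - {c}" "y \<notin> C" "adj x y" using conn_cut by metis
    then have "y = a" using c unfolding piece_def by blast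
    then show ?thesis using xy adj_sym by blast
  qed
  then obtain u0 where u0: "u0 \<in> C" "adj a u0" by blast
  have cC: "conn C"
  proof (cases "C = V - {a}")
    case False
    then obtain c where c: "piece (V - {a}) c C" "B = insert c C" using lb unfolding lobe_def by blast
    then have "B - {c} = C" unfolding piece_def by blast
    then show ?thesis using blk_conn(2)[OF bB, of c] c by simp
  qed (simp add: cn)
  let ?A = "{u \<in> C. adj a u}"
  have sub: "?A \<subseteq> C" "?A \<noteq> {}" "?A \<noteq> C" using u0 nw wC by auto
  obtain u b where ub: "u \<in> ?A" "b \<in> C" "b \<notin> ?A" "adj u b" by (rule conn_cut[OF cC sub])
  have uV: "u \<in> V" "b \<in> V" "u \<in> B" "b \<in> B" "u \<in> C" using ub CB by auto
  have u0': "u \<in> V0" "b \<in> V0" "a \<in> V0" using uV V a by auto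
  have nab: "\<not> adj a b" using ub by blast
  obtain s where "E s a u" using ub unfolding adj_def by blast
  then have s: "E (\<not> s) u a" using E_not by blast
  define t where "t = (\<not> s)"
  have t: "E t u a" using s unfolding t_def .
  obtain r where r: "E r u b" using ub unfolding adj_def by blast
  have "\<forall>\<alpha>\<in>supp f a. \<exists>g. ucf B g \<and> (\<forall>v\<in>C. \<forall>x\<in>X v. \<forall>s. g s x = red f \<alpha> s x)"
  proof
    fix \<alpha> assume "\<alpha> \<in> supp f a"
    then have "ucf (V - {a}) (red f \<alpha>)" using ucf_red V a by blast
    then show "\<exists>g. ucf B g \<and> (\<forall>v\<in>C. \<forall>x\<in>X v. \<forall>s. g s x = red f \<alpha> s x)"
      using lobe_ucf[OF V(1) cn lb] by metis
  qed
  then obtain G where G: "\<And>\<alpha>. \<alpha> \<in> supp f a \<Longrightarrow> ucf B (G \<alpha>)"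
    "\<And>\<alpha> v x s. \<alpha> \<in> supp f a \<Longrightarrow> v \<in> C \<Longrightarrow> x \<in> X v \<Longrightarrow> G \<alpha> s x = red f \<alpha> s x" by metis
  have Gb: "G \<alpha> s y = f s y" if "\<alpha> \<in> supp f a" "y \<in> X b" for \<alpha> s y
  proof -
    have "\<not> F s y \<alpha>" using F_E[of b a y \<alpha> s] that u0' supp_X nab adj_E adj_sym by blast
    then show ?thesis using G(2)[OF that(1) ub(2) that(2)] unfolding red_def by simp
  qed
  \<comment> \<open>The weights at \<open>b\<close> do not notice the colour of \<open>a\<close>, so
    \<open>b\<close> keeps all its colours; as supports in \<open>B\<close> have constant size, no
    vertex of \<open>B\<close> falls below two and the induction hypothesis applies.\<close>
  have sb: "supp (G \<alpha>) b = supp f b" if "\<alpha> \<in> supp f a" for \<alpha>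
    using Gb[OF that] unfolding supp_def by auto
  have su: "supp (G \<alpha>) u = supp f u" if "\<alpha> \<in> supp f a" for \<alpha>
  proof (rule card_subset_eq)
    show "finite (supp f u)" using finite_supp u0' by blast
    have "supp (G \<alpha>) u = supp (red f \<alpha>) u" using G(2)[OF that uV(5)] unfolding supp_def by auto
    then show "supp (G \<alpha>) u \<subseteq> supp f u" using supp_red by simp
    have "card (supp (G \<alpha>) u) = card (supp (G \<alpha>) b)"
      using card_supp_const[OF BV(2) bB G(1)[OF that] uV(3,4)] .
    then show "card (supp (G \<alpha>) u) = card (supp f u)"
      using sb[OF that] card_supp_const[OF V uV(1,2)] by simp
  qed
  have bal: "balanced B (G \<alpha>)" if "\<alpha> \<in> supp f a" for \<alpha>
  proof (rule IH[OF BV(1) bB G(1)[OF that]])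
    fix v assume "v \<in> B"
    then show "2 \<le> card (supp (G \<alpha>) v)"
      using card_supp_const[OF BV(2) bB G(1)[OF that], of v b] sb[OF that] k uV by simp
  qed
  \<comment> \<open>The partner of \<open>z\<close> at \<open>b\<close> has the same weight for
    every colour of \<open>a\<close>, and balancedness copies it to \<open>z\<close>.\<close>
  have const: "G \<alpha> q z = G \<beta> q z" if as: "E q u b" "z \<in> supp f u" "\<alpha> \<in> supp f a" "\<beta> \<in> supp f a" for q z \<alpha> \<beta>
  proof -
    obtain y where y: "y \<in> supp f b" "F q z y" using blk_arc(4)[OF V uV(1,2) as(1,2)] by blast
    have "G \<gamma> q z = f (\<not> q) y" if "\<gamma> \<in> supp f a" for \<gamma>
    proof -
      have "G \<gamma> q z = G \<gamma> (\<not> q) y"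
        using bal[OF that] uV as(1) y as(2) su[OF that] sb[OF that] unfolding balanced_def by blast
      then show ?thesis using Gb[OF that supp_X[OF y(1)]] by simp
    qed
    then show ?thesis using as by simp
  qed
  have "supp f a \<noteq> {}" using k[OF a] by auto
  then obtain \<alpha> where \<alpha>: "\<alpha> \<in> supp f a" by blast
  have "supp f a \<noteq> {\<alpha>}" using k[OF a] by auto
  then obtain \<beta> where \<beta>: "\<beta> \<in> supp f a" "\<beta> \<noteq> \<alpha>" using \<alpha> by blast
  obtain z where z: "z \<in> supp f u" "F t z \<alpha>" using blk_arc(5)[OF V uV(1) a t \<alpha>] by blast
  \<comment> \<open>Only one of the two colours of \<open>a\<close> is matched to \<open>z\<close>
    in direction \<open>t\<close>, so there the weight of \<open>z\<close> does depend on the colour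
    of \<open>a\<close>.\<close>
  have nz: "\<not> F t z \<beta>" using F_match[of u a z \<alpha> \<beta> t] u0' z \<alpha> \<beta> supp_X by blast
  have pos: "0 < f t z" using blk_arc(2)[OF V uV(1) a t z(1)] .
  have Ga: "G \<alpha> t z = f t z - 1" using G(2)[OF \<alpha> uV(5) supp_X[OF z(1)]] z(2) unfolding red_def by simp
  have Gbe: "G \<beta> t z = f t z" using G(2)[OF \<beta>(1) uV(5) supp_X[OF z(1)]] nz unfolding red_def by simp
  show False
  proof (cases "E t u b")
    case True
    then show False using const[OF True z(1) \<alpha> \<beta>(1)] Ga Gbe pos by simp
  next
    case False
    \<comment> \<open>Now \<open>u\<close> and \<open>b\<close> are joined only in the opposite
      direction, so \<open>B\<close> is not bidirected and its vertices are sources or sinks. Then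
      \<open>u\<close> has degree zero in direction \<open>t\<close> within \<open>B\<close>, and
      tightness leaves no weight there.\<close>
    then have rt: "r = (\<not> t)" using r by (cases r; cases t) auto
    have "\<not> bidir B"
    proof
      assume "bidir B"
      then have "E (\<not> r) u b" using r uV(3,4) unfolding bidir_def by blast
      then show False using False rt by simp
    qed
    then have "source_sink B" using bal[OF \<alpha>] unfolding balanced_def by blast
    then obtain q where q: "\<forall>v\<in>B. \<not> E q u v" using uV unfolding source_sink_def by blast
    then have "q \<noteq> r" using r uV by blast
    then have "q = t" using rt by (cases q; cases t) auto
    then have "{v \<in> B. E t u v} = {}" using q by blast
    then have "dg B t u = 0" unfolding dg_def by (metis card.empty)
    then have "sum (G \<beta> t) (X u) = 0" using tight[OF BV(2) blk_conn(1)[OF bB] G(1)[OF \<beta>(1)] uV(3)] by metis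
    then have "G \<beta> t z = 0" using finite_X[OF u0'(1)] supp_X[OF z(1)] by simp
    then show False using Gbe pos by simp
  qed
qed

lemma complete_conn:
  assumes "V \<noteq> {}" "\<And>u v. u \<in> V \<Longrightarrow> v \<in> V \<Longrightarrow> u \<noteq> v \<Longrightarrow> adj u v"
  shows "conn V"
  unfolding conn_def
proof (intro conjI allI impI)
  fix A assume A: "A \<subseteq> V" "A \<noteq> {} \<and> A \<noteq> V"
  then obtain u v where "u \<in> A" "v \<in> V - A" by blast
  then show "\<exists>u\<in>A. \<exists>v\<in>V - A. adj u v" using A assms(2)[of u v] by blast
qed (rule assms(1))

lemma complete_blk:
  assumes "2 \<le> card V" "\<And>u v. u \<in> V \<Longrightarrow> v \<in> V \<Longrightarrow> u \<noteq> v \<Longrightarrow> adj u v"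
  shows "blk V"
proof -
  have "V \<noteq> {}" using assms(1) by auto
  moreover have "V - {v} \<noteq> {}" for v
  proof
    assume "V - {v} = {}"
    then have "card V \<le> card {v}" by (intro card_mono) auto
    then show False using assms(1) by simp
  qed
  moreover have "conn (V - {v})" for v
    by (rule complete_conn) (use calculation(2)[of v] assms(2) in auto)
  moreover have "conn V" by (rule complete_conn) (use calculation(1) assms(2) in auto)
  ultimately show ?thesis unfolding blk_def using assms(1) by simp
qed

text \<open>Of three vertices two lack arcs in the same direction, but the arc between these two has
  that direction at one of its ends.\<close>

lemma complete_not_source_sink:
  assumes "3 \<le> card V" "\<And>u v. u \<in> V \<Longrightarrow> v \<in> V \<Longrightarrow> u \<noteq> v \<Longrightarrow> adj u v"
  shows "\<not> source_sink V"
proof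
  assume "source_sink V"
  then obtain t where t: "\<And>v u. v \<in> V \<Longrightarrow> u \<in> V \<Longrightarrow> \<not> E (t v) v u" unfolding source_sink_def by metis
  have diff: "t p \<noteq> t q" if pq: "p \<in> V" "q \<in> V" "p \<noteq> q" for p q
  proof
    assume eq: "t p = t q"
    obtain s where s: "E s p q" using assms(2)[OF pq] unfolding adj_def by blast
    then have "s = (\<not> t p)" using t[OF pq(1,2)] by (cases s; cases "t p") auto
    then have "E (t p) q p" using s E_not[of s p q] by simp
    then show False using t pq eq by simp
  qed
  obtain A where A: "A \<subseteq> V" "card A = 3" using assms(1) by (metis obtain_subset_with_card_n)
  then obtain p q r where "A = {p, q, r}" "p \<noteq> q" "q \<noteq> r" "p \<noteq> r" by (auto simp: card_3_iff)
  then show False using diff[of p q] diff[of q r] diff[of p r] A by auto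
qed

section \<open>Complete blocks\<close>

lemma bool_cases2: "P s \<Longrightarrow> P (\<not> s) \<Longrightarrow> P t"
  by (cases s; cases t) auto

lemma two_elems:
  assumes "2 \<le> card A" "x \<in> A"
  obtains y where "y \<in> A" "y \<noteq> x"
proof -
  have "\<not> A \<subseteq> {x}" using assms(1) card_mono[of "{x}" A] by auto
  then show thesis using that by blast
qed

lemma dg_complete:
  assumes "V \<subseteq> V0" "bidir V" "\<And>u v. u \<in> V \<Longrightarrow> v \<in> V \<Longrightarrow> u \<noteq> v \<Longrightarrow> adj u v" "u \<in> V"
  shows "dg V s u = card V - 1"
proof -
  have "E s u v" if "v \<in> V" "v \<noteq> u" for v
  proof -
    have "adj u v" using assms(3)[of u v] assms(4) that by blast
    then obtain t where "E t u v" unfolding adj_def by blast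
    then show ?thesis using bool_cases2[of "\<lambda>t. E t u v" t s] assms(2,4) that unfolding bidir_def by blast
  qed
  then have "{v \<in> V. E s u v} = V - {u}" using E_irrefl by auto
  then show ?thesis unfolding dg_def using assms(4) finite_sub[OF assms(1)] by simp
qed

text \<open>Two lost colours cannot both be matched to \<open>\<alpha>\<close> in one direction, so
  they use opposite ones. But then \<open>z\<close> also has positive weight in the direction of
  \<open>z'\<close>, and losing this weight would give \<open>\<alpha>\<close> a second partner
  there.\<close>

lemma removed_unique:
  assumes V: "V \<subseteq> V0" "blk V" "ucf V f" and a: "a \<in> V" "\<alpha> \<in> supp f a" and u: "u \<in> V"
    and z: "z \<in> supp f u - supp (red f \<alpha>) u" and z': "z' \<in> supp f u - supp (red f \<alpha>) u"
  shows "z = z'"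
proof (rule ccontr)
  assume ne: "z \<noteq> z'"
  have u0: "u \<in> V0" "a \<in> V0" using V a u by auto
  have X: "z \<in> X u" "z' \<in> X u" "\<alpha> \<in> X a" using z z' a supp_X by auto
  have rz: "red f \<alpha> s z = 0" "red f \<alpha> s z' = 0" for s using z z' X unfolding supp_def by auto
  obtain s where s: "0 < f s z" using z unfolding supp_def by auto
  obtain s' where s': "0 < f s' z'" using z' unfolding supp_def by auto
  have Fz: "F s z \<alpha>" using rz(1)[of s] s unfolding red_def by (auto split: if_splits)
  have Fz': "F s' z' \<alpha>" using rz(2)[of s'] s' unfolding red_def by (auto split: if_splits)
  have "s \<noteq> s'" using F_match'[OF u0 X(1,2,3), of s] Fz Fz' ne by blast
  then have "s' = (\<not> s)" by auto
  moreover have "E s' u a" using F_E[OF u0 X(2,3) Fz'] .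
  ultimately have "0 < f (\<not> s) z" using blk_arc(2)[OF V u a(1), of s' z] z by blast
  then have "F (\<not> s) z \<alpha>" using rz(1)[of "\<not> s"] unfolding red_def by (auto split: if_splits)
  then show False using F_match'[OF u0 X(1,2,3), of "\<not> s"] Fz' ne \<open>s' = (\<not> s)\<close> by blast
qed

text \<open>Two colours of \<open>a\<close> remove different colours of \<open>u\<close>, since a
  colour has at most one partner at \<open>a\<close> in each direction, and each removes only one.
  So \<open>u\<close> has just these two, and neither had more than the unit taken away.\<close>

lemma two_colours:
  assumes V: "V \<subseteq> V0" "blk V" "ucf V f" and a: "a \<in> V" "2 \<le> card (supp f a)"
    and r1: "\<And>\<alpha>. \<alpha> \<in> supp f a \<Longrightarrow> card (supp (red f \<alpha>) u) \<le> 1" and u: "u \<in> V"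
  shows "card (supp f u) = 2" and "\<And>x. x \<in> supp f u \<Longrightarrow> f s x \<le> 1"
    and "\<exists>\<alpha>\<in>supp f a. \<exists>z\<in>supp f u. \<forall>s. 0 < f s z \<longrightarrow> F s z \<alpha>"
proof -
  have u0: "u \<in> V0" "a \<in> V0" using V a u by auto
  have k: "2 \<le> card (supp f u)" using card_supp_const[OF V u a(1)] a by simp
  have fin: "finite (supp f u)" using finite_supp u0 by blast
  have rem: "\<exists>z. supp f u - supp (red f \<alpha>) u = {z}" if "\<alpha> \<in> supp f a" for \<alpha>
  proof -
    have "card (supp (red f \<alpha>) u) < card (supp f u)" using r1[OF that] k by simp
    then have "supp f u - supp (red f \<alpha>) u \<noteq> {}" using supp_red[of f \<alpha> u] by auto
    then obtain z where "z \<in> supp f u - supp (red f \<alpha>) u" by blast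
    then show ?thesis using removed_unique[OF V a(1) that u] by blast
  qed
  have remF: "F s z \<alpha> \<and> f s z = 1" if "z \<in> supp f u - supp (red f \<alpha>) u" "0 < f s z" for s z \<alpha>
  proof -
    have "red f \<alpha> s z = 0" using that unfolding supp_def by auto
    then show ?thesis using that(2) unfolding red_def by (auto split: if_splits)
  qed
  obtain \<alpha> where \<alpha>: "\<alpha> \<in> supp f a" using a(2) by (metis all_not_in_conv card.empty not_numeral_le_zero)
  obtain \<beta> where \<beta>: "\<beta> \<in> supp f a" "\<beta> \<noteq> \<alpha>" using two_elems[OF a(2) \<alpha>] .
  obtain z where z: "supp f u - supp (red f \<alpha>) u = {z}" using rem[OF \<alpha>] by blast
  obtain z2 where z2: "supp f u - supp (red f \<beta>) u = {z2}" using rem[OF \<beta>(1)] by blast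
  have zs: "z \<in> supp f u" "z2 \<in> supp f u" using z z2 by auto
  have ne: "z \<noteq> z2"
  proof
    assume "z = z2"
    obtain s where "0 < f s z" using zs unfolding supp_def by auto
    then have "F s z \<alpha>" "F s z \<beta>" using remF[of z \<alpha> s] remF[of z \<beta> s] z z2 \<open>z = z2\<close> by auto
    then show False using F_match[of u a z \<alpha> \<beta> s] u0 zs \<alpha> \<beta> supp_X by blast
  qed
  have "card (supp f u) \<le> Suc (card (supp (red f \<alpha>) u))"
  proof -
    have "supp f u = insert z (supp (red f \<alpha>) u)" using z supp_red[of f \<alpha> u] by auto
    then show ?thesis using card_insert_le_m1 fin by (metis card_insert_if finite_insert lessI less_imp_le order_refl)
  qed
  then show k2: "card (supp f u) = 2" using r1[OF \<alpha>] k by simp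
  have "{z, z2} = supp f u"
    by (rule card_subset_eq[OF fin]) (use zs ne k2 in auto)
  moreover have "f s z \<le> 1" for s using remF[of z \<alpha> s] z by (cases "0 < f s z") auto
  moreover have "f s z2 \<le> 1" for s using remF[of z2 \<beta> s] z2 by (cases "0 < f s z2") auto
  ultimately show "f s x \<le> 1" if "x \<in> supp f u" for x using that by (metis insertE singletonD)
  show "\<exists>\<alpha>\<in>supp f a. \<exists>z\<in>supp f u. \<forall>s. 0 < f s z \<longrightarrow> F s z \<alpha>"
    using \<alpha> zs remF[of z \<alpha>] z by blast
qed

text \<open>
  If \<open>V - {a}\<close> is not bidirected, then all weights there are \<open>(1, 1)\<close>, so \<open>V - {a}\<close> is a directed
  triangle joined to \<open>a\<close> by digons. Colouring a vertex \<open>u\<close> of it leaves a weight \<open>(1, 0)\<close> or \<open>(0, 1)\<close>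
  at another vertex \<open>q\<close>, contrary to the presence of a digon between \<open>q\<close> and \<open>a\<close>.
\<close>

lemma complete_bidir_minus:
  assumes V: "V \<subseteq> V0" "blk V" "ucf V f" and mu: "multi V f"
    and he: "hered V"
    and c4: "4 \<le> card V" and cpl: "\<forall>u\<in>V. \<forall>v\<in>V. u \<noteq> v \<longrightarrow> adj u v" and a: "a \<in> V"
  shows "bidir (V - {a})"
proof -
  have k: "2 \<le> card (supp f v)" if "v \<in> V" for v using mu that unfolding multi_def by blast
  have IH: "balanced B g" if "B \<subset> V" "blk B" "ucf B g" "\<And>v. v \<in> B \<Longrightarrow> 2 \<le> card (supp g v)" for B g
    using he that unfolding hered_def multi_def by blast
  have ad: "adj u v" if "u \<in> V" "v \<in> V" "u \<noteq> v" for u v using cpl that by blast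
  show ?thesis
  proof (cases "\<exists>\<alpha>\<in>supp f a. \<forall>v\<in>V-{a}. 2 \<le> card (supp (red f \<alpha>) v)")
  case True
  then obtain \<alpha> where \<alpha>: "\<alpha> \<in> supp f a" "\<And>v. v \<in> V-{a} \<Longrightarrow> 2 \<le> card (supp (red f \<alpha>) v)" by blast
  have fin: "finite V" using finite_sub V by blast
  have c3: "3 \<le> card (V - {a})" using c4 a fin by simp
  \<comment> \<open>A single colour of \<open>a\<close> that spares two colours at every other
    vertex suffices for the induction hypothesis; completeness then excludes the source-sink
    alternative.\<close>
  have "blk (V - {a})" by (rule complete_blk) (use c3 ad in auto)
  moreover have "V - {a} \<subset> V" using a by blast
  ultimately have "balanced (V - {a}) (red f \<alpha>)" using IH ucf_red[OF V(1,3) a \<alpha>(1)] \<alpha>(2) by blast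
  moreover have "\<not> source_sink (V - {a})" by (rule complete_not_source_sink) (use c3 ad in auto)
  ultimately show ?thesis unfolding balanced_def by blast
next
  case False
  have fin: "finite V" using finite_sub V by blast
  have c3: "3 \<le> card (V - {a})" using c4 a fin by simp
  have bl: "blk (V - {a})" by (rule complete_blk) (use c3 ad in auto)
  have Va: "V - {a} \<subseteq> V0" using V by blast
  have r1: "card (supp (red f \<alpha>) u) \<le> 1" if "\<alpha> \<in> supp f a" "u \<in> V - {a}" for \<alpha> u
  proof -
    from that(1) False obtain v where v: "v \<in> V - {a}" "\<not> 2 \<le> card (supp (red f \<alpha>) v)" by blast
    then show ?thesis using card_supp_const[OF Va bl ucf_red[OF V(1,3) a that(1)] that(2) v(1)] by linarith
  qed
  have sum: "card V - 1 \<le> dg V True u + dg V False u" if "u \<in> V" for u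
  proof -
    have "V - {u} \<subseteq> {v \<in> V. E True u v} \<union> {v \<in> V. E False u v}"
    proof
      fix v assume "v \<in> V - {u}"
      then have "adj u v" using ad that by blast
      then have "E True u v \<or> E False u v" unfolding adj_def by (metis (full_types))
      then show "v \<in> {v \<in> V. E True u v} \<union> {v \<in> V. E False u v}" using \<open>v \<in> V - {u}\<close> by blast
    qed
    then have "card (V - {u}) \<le> card ({v \<in> V. E True u v} \<union> {v \<in> V. E False u v})"
      using fin by (intro card_mono) auto
    also have "\<dots> \<le> dg V True u + dg V False u" unfolding dg_def by (rule card_Un_le)
    finally show ?thesis using that fin by simp
  qed
  have two: "card (supp f u) = 2" "\<And>s x. x \<in> supp f u \<Longrightarrow> f s x \<le> 1"
    "\<exists>\<alpha>\<in>supp f a. \<exists>z\<in>supp f u. \<forall>s. 0 < f s z \<longrightarrow> F s z \<alpha>" if "u \<in> V - {a}" for u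
    using two_colours[OF V a k[OF a], of u] r1 that by blast+
  \<comment> \<open>Two colours of weight at most one bound each degree by two, and a non-zero
    degree is at least two; as the two degrees add up to at least three, both are two.\<close>
  have dg2: "dg V s u = 2" if u: "u \<in> V - {a}" for s u
  proof -
    have uV: "u \<in> V" using u by blast
    have le: "dg V t u \<le> 2" for t
    proof -
      have "sum (f t) (supp f u) \<le> (\<Sum>x\<in>supp f u. 1)" by (rule sum_mono) (use two(2)[OF u] in auto)
      then show ?thesis using sum_supp[OF V uV] two(1)[OF u] by simp
    qed
    have ge: "dg V t u = 0 \<or> 2 \<le> dg V t u" for t
      using card_supp_le_dg[OF V uV, of t] two(1)[OF u] by linarith
    show ?thesis using sum[OF uV] c4 le[of True] le[of False] ge[of True] ge[of False] by (cases s) auto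
  qed
  have pos: "0 < f s x" if "u \<in> V - {a}" "x \<in> supp f u" for s u x
    using supp_pos[OF V, of u x s] dg2 that by simp
  have one: "f s x = 1" if "u \<in> V - {a}" "x \<in> supp f u" for s u x
    using pos[OF that, of s] two(2)[OF that, of s] by simp
  have digon: "E s u a" if u: "u \<in> V - {a}" for s u
  proof -
    obtain \<alpha> z where az: "\<alpha> \<in> supp f a" "z \<in> supp f u" "\<forall>s. 0 < f s z \<longrightarrow> F s z \<alpha>" using two(3)[OF u] by blast
    then have "F s z \<alpha>" using pos[OF u, of z s] by blast
    then show ?thesis using F_E[of u a z \<alpha> s] az u a V(1) supp_X by blast
  qed
  have "V - {a} \<noteq> {}" using c3 by (metis card.empty not_numeral_le_zero)
  then obtain u where u: "u \<in> V - {a}" by blast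
  have uV: "u \<in> V" using u by blast
  \<comment> \<open>Otherwise \<open>u\<close> would have degree at least three in direction
    \<open>True\<close>, counting its digon with \<open>a\<close>.\<close>
  have "\<exists>q\<in>V-{a}-{u}. \<exists>s. \<not> E s u q"
  proof (rule ccontr)
    assume "\<not> ?thesis"
    then have "V - {u} \<subseteq> {v \<in> V. E True u v}" using digon[OF u, of True] by blast
    then have "card (V - {u}) \<le> dg V True u" unfolding dg_def using fin by (intro card_mono) auto
    then show False using dg2[OF u, of True] c4 uV fin by simp
  qed
  then obtain q t where q: "q \<in> V" "q \<noteq> a" "q \<noteq> u" "\<not> E t u q" by blast
  define s where "s = (\<not> t)"
  have Euq: "E s u q"
  proof -
    obtain r where "E r u q" using ad[OF uV q(1)] q unfolding adj_def by blast
    then show ?thesis using q(4) unfolding s_def by (cases r; cases t) auto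
  qed
  have nE: "\<not> E s q u" using q(4) E_not[of s q u] unfolding s_def by simp
  have qa: "q \<in> V - {a}" using q by blast
  obtain x where x: "x \<in> supp f u" using two(1)[OF u] by (metis all_not_in_conv card.empty zero_neq_numeral)
  obtain z where z: "z \<in> supp f q" "F s x z" using blk_arc(4)[OF V uV q(1) Euq x] by blast
  \<comment> \<open>There is only one arc between \<open>u\<close> and \<open>q\<close>, so
    colouring \<open>u\<close> with \<open>x\<close> takes just one of the two units of
    \<open>z\<close>.\<close>
  have "\<not> F s z x" using F_E[of q u z x s] nE z x q uV V(1) supp_X by blast
  then have rs: "red f x s z = 1" using one[OF qa z(1), of s] unfolding red_def by simp
  have "F (\<not> s) z x" using z F_not by blast
  then have rn: "red f x (\<not> s) z = 0" using one[OF qa z(1), of "\<not> s"] unfolding red_def by simp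
  have zsupp: "z \<in> supp (red f x) q" using supp_I[of z q "red f x" s] rs supp_X[OF z(1)] by simp
  have Vu: "V - {u} \<subseteq> V0" using V by blast
  have bl': "blk (V - {u})" by (rule complete_blk) (use c4 ad fin uV in auto)
  have "q \<in> V - {u}" "a \<in> V - {u}" using q a u by auto
  then have "0 < red f x (\<not> s) z"
    using blk_arc(2)[OF Vu bl' ucf_red[OF V(1,3) uV x], of q a "\<not> s" z] digon[OF qa] zsupp by blast
  then show ?thesis using rn by simp
qed
qed

text \<open>After some \<open>a\<close> is coloured and deleted, the rest is balanced by induction
  or has one colour per vertex, whose weight is the full degree. Either way the reduced weights
  agree in both directions and along matched pairs. Two colours of \<open>a\<close> take their units
  from different places, and comparing the resulting equations excludes every deviation.\<close>

lemma complete_struct: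
  assumes V: "V \<subseteq> V0" "blk V" "ucf V f" and mu: "multi V f"
    and he: "hered V"
    and c4: "4 \<le> card V" and cpl: "\<forall>u\<in>V. \<forall>v\<in>V. u \<noteq> v \<longrightarrow> adj u v"
  shows "bidir V"
    and "\<And>u x s t. u \<in> V \<Longrightarrow> x \<in> X u \<Longrightarrow> f s x = f t x"
    and "\<And>u v x y s t. \<lbrakk>u \<in> V; v \<in> V; u \<noteq> v; x \<in> supp f u; y \<in> supp f v; F s x y\<rbrakk> \<Longrightarrow> F t x y"
    and "\<And>u v w x y z s. \<lbrakk>u \<in> V; v \<in> V; w \<in> V; u \<noteq> v; u \<noteq> w; v \<noteq> w; x \<in> supp f u; y \<in> supp f v;
      z \<in> supp f w; F s x y; F s x z\<rbrakk> \<Longrightarrow> F s y z"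
    and "\<And>u v x y s t. \<lbrakk>u \<in> V; v \<in> V; u \<noteq> v; x \<in> supp f u; y \<in> supp f v; F s x y\<rbrakk> \<Longrightarrow> f t x = f t y"
proof -
  have k: "2 \<le> card (supp f v)" if "v \<in> V" for v using mu that unfolding multi_def by blast
  have IH: "balanced B g" if "B \<subset> V" "blk B" "ucf B g" "\<And>v. v \<in> B \<Longrightarrow> 2 \<le> card (supp g v)" for B g
    using he that unfolding hered_def multi_def by blast
  have ad: "adj u v" if "u \<in> V" "v \<in> V" "u \<noteq> v" for u v using cpl that by blast
  have fin: "finite V" using finite_sub V by blast
  have bm: "bidir (V - {a})" if "a \<in> V" for a using complete_bidir_minus[OF V mu he c4 cpl that] .
  have other: "\<exists>a\<in>V. a \<noteq> u \<and> a \<noteq> v" for u v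
  proof (rule ccontr)
    assume "\<not> ?thesis"
    then have "card V \<le> card {u, v}" by (intro card_mono) auto
    then show False using c4 by (simp add: card_insert_if split: if_splits)
  qed
  show bd: "bidir V"
    unfolding bidir_def
  proof (intro ballI allI impI)
    fix u v s assume uv: "u \<in> V" "v \<in> V" "E s u v"
    obtain a where "a \<in> V" "a \<noteq> u" "a \<noteq> v" using other by blast
    then show "E (\<not> s) u v" using bm uv unfolding bidir_def by blast
  qed
  have EE: "E s u v" if "u \<in> V" "v \<in> V" "u \<noteq> v" for s u v
  proof -
    from ad[OF that] obtain t where "E t u v" unfolding adj_def by blast
    then show ?thesis using bool_cases2[of "\<lambda>t. E t u v" t s] bd that unfolding bidir_def by blast
  qed
  have c3: "3 \<le> card (V - {a})" if "a \<in> V" for a using c4 that fin by simp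
  have bl: "blk (V - {a})" if "a \<in> V" for a
    by (rule complete_blk) (use c3[OF that] ad in auto)
  have Va: "V - {a} \<subseteq> V0" for a using V by blast
  have dgc: "dg (V - {a}) s u = card V - 2" if "a \<in> V" "u \<in> V - {a}" for a s u
    using dg_complete[OF Va bm[OF that(1)] _ that(2)] ad that fin by simp
  have cases: "balanced (V - {a}) (red f \<alpha>) \<or> (\<forall>u\<in>V - {a}. \<forall>x\<in>supp (red f \<alpha>) u. \<forall>s. red f \<alpha> s x = card V - 2)"
    if a: "a \<in> V" "\<alpha> \<in> supp f a" for a \<alpha>
  proof (cases "\<forall>u\<in>V - {a}. 2 \<le> card (supp (red f \<alpha>) u)")
    case True
    then show ?thesis using IH[of "V - {a}" "red f \<alpha>"] bl[OF a(1)] ucf_red[OF V(1,3) a] a by blast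
  next
    case False
    then obtain v where v: "v \<in> V - {a}" "\<not> 2 \<le> card (supp (red f \<alpha>) v)" by blast
    note ur = ucf_red[OF V(1,3) a]
    have "red f \<alpha> s x = card V - 2" if u: "u \<in> V - {a}" "x \<in> supp (red f \<alpha>) u" for u x s
    proof -
      have "card (supp (red f \<alpha>) u) = 1"
        using card_supp_const[OF Va bl[OF a(1)] ur u(1) v(1)] v(2) card_supp_pos[OF Va bl[OF a(1)] ur u(1)] by simp
      then show ?thesis using supp_single[OF Va bl[OF a(1)] ur u(1) _ u(2)] dgc a u by simp
    qed
    then show ?thesis by blast
  qed
  have nss: "\<not> source_sink (V - {a})" if "a \<in> V" for a
    by (rule complete_not_source_sink) (use c3[OF that] ad in auto)
  have G1: "red f \<alpha> s x = red f \<alpha> t x" if a: "a \<in> V" "\<alpha> \<in> supp f a" and u: "u \<in> V - {a}" "x \<in> X u" for a \<alpha> u x s t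
  proof (cases "x \<in> supp (red f \<alpha>) u")
    case False
    then show ?thesis using u unfolding supp_def by auto
  next
    case True
    show ?thesis using cases[OF a]
    proof
      assume "balanced (V - {a}) (red f \<alpha>)"
      then have "red f \<alpha> True x = red f \<alpha> False x" using nss[OF a(1)] u unfolding balanced_def by blast
      then show ?thesis by (cases s; cases t) auto
    qed (use u True in simp)
  qed
  have G2: "red f \<alpha> t y = red f \<alpha> t z"
    if a: "a \<in> V" "\<alpha> \<in> supp f a" and uv: "u \<in> V - {a}" "v \<in> V - {a}" "u \<noteq> v"
      and yz: "y \<in> X u" "z \<in> X v" "F s y z" for a \<alpha> u v y z s t
  proof -
    note ur = ucf_red[OF V(1,3) a]
    note arc = blk_arc[OF Va bl[OF a(1)] ur uv(1,2) EE[of u v s]]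
    have uv0: "u \<in> V0" "v \<in> V0" using uv V by auto
    have uvV: "u \<in> V" "v \<in> V" using uv by auto
    \<comment> \<open>Supports come before weights: matched colours leave them together, and outside
      them both reduced weights are zero.\<close>
    have iff: "y \<in> supp (red f \<alpha>) u \<longleftrightarrow> z \<in> supp (red f \<alpha>) v"
    proof
      assume "y \<in> supp (red f \<alpha>) u"
      then obtain z' where "z' \<in> supp (red f \<alpha>) v" "F s y z'" using arc(4) uv uvV by blast
      then show "z \<in> supp (red f \<alpha>) v" using F_match[OF uv0 yz(1,2) _ yz(3)] supp_X by metis
    next
      assume "z \<in> supp (red f \<alpha>) v"
      then obtain y' where "y' \<in> supp (red f \<alpha>) u" "F s y' z" using arc(5) uv uvV by blast
      then show "y \<in> supp (red f \<alpha>) u" using F_match'[OF uv0 yz(1) _ yz(2,3)] supp_X by metis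
    qed
    show ?thesis
    proof (cases "y \<in> supp (red f \<alpha>) u")
      case False
      then show ?thesis using iff yz unfolding supp_def by auto
    next
      case True
      show ?thesis using cases[OF a]
      proof
        assume "balanced (V - {a}) (red f \<alpha>)"
        then have "red f \<alpha> s y = red f \<alpha> (\<not> s) z"
          using True iff uv yz EE[OF uvV uv(3), of s] unfolding balanced_def by blast
        then show ?thesis using G1[OF a uv(1) yz(1), of s t] G1[OF a uv(2) yz(2), of "\<not> s" t] by simp
      qed (use uv True iff in simp)
    qed
  qed
  \<comment> \<open>If \<open>z\<close> meets \<open>\<alpha>\<close> in one direction and another
    colour \<open>\<beta>\<close> in the other, the two reductions give
    \<open>f s z - 1 = f (\<not> s) z\<close> and \<open>f s z = f (\<not> s) z - 1\<close>, which
    is impossible for positive weights.\<close>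
  have C3: "F (\<not> s) z \<alpha>" if a: "a \<in> V" "\<alpha> \<in> supp f a" and u: "u \<in> V - {a}" "z \<in> supp f u" and Fs: "F s z \<alpha>" for a \<alpha> u z s
  proof (rule ccontr)
    assume n: "\<not> F (\<not> s) z \<alpha>"
    have uV: "u \<in> V" "u \<noteq> a" using u by auto
    obtain \<beta> where \<beta>: "\<beta> \<in> supp f a" "F (\<not> s) z \<beta>" using blk_arc(4)[OF V uV(1) a(1) EE[OF uV(1) a(1) uV(2)] u(2)] by blast
    have "\<beta> \<noteq> \<alpha>" using n \<beta> by blast
    then have n2: "\<not> F s z \<beta>" using F_match[of u a z \<alpha> \<beta> s] Fs uV a \<beta> u V(1) supp_X by blast
    have "f s z - 1 = f (\<not> s) z" using G1[OF a u(1) supp_X[OF u(2)], of s "\<not> s"] n Fs unfolding red_def by simp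
    moreover have "f s z = f (\<not> s) z - 1" using G1[OF a(1) \<beta>(1) u(1) supp_X[OF u(2)], of s "\<not> s"] n2 \<beta>(2) unfolding red_def by simp
    moreover have "0 < f s z" using blk_arc(2)[OF V uV(1) a(1) EE[OF uV(1) a(1) uV(2)] u(2)] by blast
    ultimately show False by simp
  qed
  show C3': "F t x y" if "u \<in> V" "v \<in> V" "u \<noteq> v" "x \<in> supp f u" "y \<in> supp f v" "F s x y" for u v x y s t
    using C3[OF that(2,5) _ that(4,6)] that bool_cases2[of "\<lambda>s. F s x y" s t] by blast
  have pos: "0 < f s x" if u: "u \<in> V" "x \<in> supp f u" for u x s
  proof -
    obtain a where a: "a \<in> V" "a \<noteq> u" using other by blast
    then show ?thesis using blk_arc(2)[OF V u(1) a(1) EE u(2)] u by blast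
  qed
  show "f s x = f t x" if u: "u \<in> V" "x \<in> X u" for u x s t
  proof (cases "x \<in> supp f u")
    case False
    then show ?thesis using u unfolding supp_def by auto
  next
    case True
    obtain a where a: "a \<in> V" "a \<noteq> u" using other by blast
    then obtain \<alpha> where \<alpha>: "\<alpha> \<in> supp f a" using k[OF a(1)] by (metis all_not_in_conv card.empty not_numeral_le_zero)
    have "red f \<alpha> s x = red f \<alpha> t x" using G1[OF a(1) \<alpha>] u a by blast
    moreover have "F s x \<alpha> \<longleftrightarrow> F t x \<alpha>" using C3'[OF u(1) a(1) _ True \<alpha>] a by blast
    ultimately show ?thesis using pos[OF u(1) True, of s] pos[OF u(1) True, of t] unfolding red_def
      by (auto split: if_splits)
  qed
  have C4: "F s z \<alpha>"
    if V3: "u \<in> V" "v \<in> V" "a \<in> V" "u \<noteq> v" "u \<noteq> a" "v \<noteq> a" and S3: "y \<in> supp f u" "z \<in> supp f v" "\<alpha> \<in> supp f a"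
      and FF: "F s y z" "F s y \<alpha>" for u v a y z \<alpha> s
  proof (rule ccontr)
    assume n: "\<not> F s z \<alpha>"
    have in0: "u \<in> V0" "v \<in> V0" "a \<in> V0" using V3 V by auto
    have XX: "y \<in> X u" "z \<in> X v" using S3 supp_X by auto
    obtain \<beta> where \<beta>: "\<beta> \<in> supp f a" "F s z \<beta>" using blk_arc(4)[OF V V3(2,3) EE[OF V3(2,3,6)] S3(2)] by blast
    have "\<beta> \<noteq> \<alpha>" using n \<beta> by blast
    then have n2: "\<not> F s y \<beta>" using F_match[OF in0(1,3) XX(1), of \<alpha> \<beta> s] FF S3 \<beta> supp_X by blast
    have "red f \<alpha> s y = red f \<alpha> s z" "red f \<beta> s y = red f \<beta> s z"
      using G2[OF V3(3) _ _ _ V3(4) XX FF(1)] S3 \<beta> V3 by auto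
    then have "f s y - 1 = f s z" "f s y = f s z - 1" using FF n n2 \<beta> unfolding red_def by auto
    then show False using pos[OF V3(1) S3(1), of s] by simp
  qed
  then show "F s y z" if "u \<in> V" "v \<in> V" "w \<in> V" "u \<noteq> v" "u \<noteq> w" "v \<noteq> w" "x \<in> supp f u" "y \<in> supp f v"
    "z \<in> supp f w" "F s x y" "F s x z" for u v w x y z s
    using that by blast
  show "f t x = f t y" if uv: "u \<in> V" "v \<in> V" "u \<noteq> v" and xy: "x \<in> supp f u" "y \<in> supp f v" "F s x y" for u v x y s t
  proof -
    obtain a where a: "a \<in> V" "a \<noteq> u" "a \<noteq> v" using other by blast
    have in0: "u \<in> V0" "v \<in> V0" "a \<in> V0" using a uv V by auto
    obtain \<beta> where \<beta>: "\<beta> \<in> supp f a" "F t x \<beta>" using blk_arc(4)[OF V uv(1) a(1) EE[of u a t] xy(1)] uv a by blast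
    \<comment> \<open>A colour of a third vertex matched to neither \<open>x\<close> nor
      \<open>y\<close>, so that the reduction leaves both weights untouched.\<close>
    obtain \<alpha> where \<alpha>: "\<alpha> \<in> supp f a" "\<alpha> \<noteq> \<beta>" using two_elems[OF k[OF a(1)] \<beta>(1)] .
    have n: "\<not> F t x \<alpha>" using F_match[OF in0(1,3), of x \<alpha> \<beta> t] \<alpha> \<beta> xy supp_X by blast
    have Fyx: "F t y x" using C3'[OF uv xy, of "\<not> t"] F_not by blast
    have n2: "\<not> F t y \<alpha>"
    proof
      assume "F t y \<alpha>"
      then have "F t x \<alpha>" using C4[OF uv(2,1) a(1) uv(3)[symmetric] _ _ xy(2,1) \<alpha>(1) Fyx] a by blast
      then show False using n by blast
    qed
    have "red f \<alpha> t x = red f \<alpha> t y"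
      using G2[OF a(1) \<alpha>(1) _ _ uv(3) supp_X[OF xy(1)] supp_X[OF xy(2)] xy(3)] uv a by blast
    then show ?thesis using n n2 unfolding red_def by simp
  qed
qed

section \<open>Cycles\<close>

lemma card2_other:
  assumes "card A = 2" "x \<in> A"
  obtains y where "A = {x, y}" "x \<noteq> y"
proof -
  obtain p q where "A = {p, q}" "p \<noteq> q" using assms(1) by (auto simp: card_2_iff)
  then show thesis using assms(2) that[of p] that[of q] by auto
qed

text \<open>Two neighbours bound each degree by two, while in a direction that occurs all of the at
  least two colours have positive weight and the weights sum to the degree. So a non-zero degree is
  two, shared by two colours of weight one.\<close>

lemma cycle_struct:
  assumes V: "V \<subseteq> V0" "blk V" "ucf V f" and mu: "multi V f"
    and nb2': "\<forall>u\<in>V. card (nb V u) = 2"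
  shows "\<And>u. u \<in> V \<Longrightarrow> card (supp f u) = 2"
    and "\<And>u x s. u \<in> V \<Longrightarrow> dg V s u = 0 \<Longrightarrow> x \<in> X u \<Longrightarrow> f s x = 0"
    and "\<And>u x s. u \<in> V \<Longrightarrow> dg V s u \<noteq> 0 \<Longrightarrow> x \<in> supp f u \<Longrightarrow> f s x = 1"
    and "\<And>u v s. u \<in> V \<Longrightarrow> dg V s u \<noteq> 0 \<Longrightarrow> v \<in> V \<Longrightarrow> adj u v \<Longrightarrow> E s u v"
    and "(\<forall>u\<in>V. \<forall>s. dg V s u \<noteq> 0) \<or> (\<forall>u\<in>V. \<exists>s. dg V s u = 0 \<and> dg V (\<not> s) u \<noteq> 0)"
proof -
  have k: "2 \<le> card (supp f v)" if "v \<in> V" for v using mu that unfolding multi_def by blast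
  have nb2: "card (nb V u) = 2" if "u \<in> V" for u using nb2' that by blast
  have fin: "finite V" using finite_sub V by blast
  have finn: "finite (nb V u)" for u unfolding nb_def using fin by simp
  have sub: "{v \<in> V. E s u v} \<subseteq> nb V u" for s u unfolding nb_def adj_def by blast
  have le2: "dg V s u \<le> 2" if "u \<in> V" for s u
    using card_mono[OF finn sub[of s u]] nb2[OF that] unfolding dg_def by simp
  have some: "\<exists>s. dg V s u \<noteq> 0" if "u \<in> V" for u
  proof -
    obtain v where v: "v \<in> V" "adj u v" by (rule blk_nbr[OF V(2) \<open>u \<in> V\<close>])
    then obtain s where "E s u v" unfolding adj_def by blast
    then show ?thesis using dg_pos[OF V(1) v(1)] by (metis less_numeral_extra(3))
  qed
  show c2: "card (supp f u) = 2" if "u \<in> V" for u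
  proof -
    from some[OF that] obtain s where "0 < dg V s u" by auto
    then show ?thesis using card_supp_le_dg[OF V that, of s] le2[OF that, of s] k[OF that] by linarith
  qed
  show f0: "f s x = 0" if "u \<in> V" "dg V s u = 0" "x \<in> X u" for u x s
  proof -
    have "sum (f s) (X u) = 0" using tight[OF V(1) blk_conn(1)[OF V(2)] V(3) that(1), of s] that by simp
    then show ?thesis using finite_X that V(1) by (metis (no_types, lifting) subsetD sum_eq_0_iff)
  qed
  have d2: "dg V s u = 2" if "u \<in> V" "dg V s u \<noteq> 0" for s u
    using card_supp_le_dg[OF V that(1), of s] le2[OF that(1), of s] c2[OF that(1)] that(2) by linarith
  show "f s x = 1" if u: "u \<in> V" "dg V s u \<noteq> 0" "x \<in> supp f u" for u x s
  proof -
    from c2[OF u(1)] u(3) obtain y where y: "supp f u = {x, y}" "x \<noteq> y" by (rule card2_other)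
    have "0 < f s x" "0 < f s y" using supp_pos[OF V u(1), of _ s] u(2) y by auto
    moreover have "f s x + f s y = 2" using sum_supp[OF V u(1), of s] d2[OF u(1,2)] y by simp
    ultimately show ?thesis by simp
  qed
  show all: "E s u v" if "u \<in> V" "dg V s u \<noteq> 0" "v \<in> V" "adj u v" for u v s
  proof -
    have "{v \<in> V. E s u v} = nb V u"
      by (rule card_subset_eq[OF finn sub]) (use nb2 d2 that dg_def in auto)
    then show ?thesis using that unfolding nb_def by blast
  qed
  show "(\<forall>u\<in>V. \<forall>s. dg V s u \<noteq> 0) \<or> (\<forall>u\<in>V. \<exists>s. dg V s u = 0 \<and> dg V (\<not> s) u \<noteq> 0)"
  proof (rule ccontr)
    assume neg: "\<not> ?thesis"
    \<comment> \<open>A vertex with arcs in both directions passes this property to its neighbours,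
      so all vertices have it or none.\<close>
    let ?A = "{u \<in> V. \<forall>s. dg V s u \<noteq> 0}"
    from neg obtain p where p: "p \<in> V" "\<not> (\<forall>s. dg V s p \<noteq> 0)" by blast
    from neg obtain q where q: "q \<in> V" "\<not> (\<exists>s. dg V s q = 0 \<and> dg V (\<not> s) q \<noteq> 0)" by blast
    have "dg V s q \<noteq> 0" for s
      using some[OF q(1)] q(2) bool_cases2[of "\<lambda>s. dg V s q = 0" s] by (metis (full_types))
    then have "q \<in> ?A" "p \<notin> ?A" using p q by auto
    then have sub: "?A \<subseteq> V" "?A \<noteq> {}" "?A \<noteq> V" using p(1) by blast+
    obtain u v where uv: "u \<in> ?A" "v \<in> V" "v \<notin> ?A" "adj u v"
      by (rule conn_cut[OF blk_conn(1)[OF V(2)] sub])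
    have "dg V s v \<noteq> 0" for s
    proof -
      have "E (\<not> s) u v" using all[of u "\<not> s" v] uv by blast
      then have "E s v u" using E_not[of s v u] by simp
      then show ?thesis using dg_pos[OF V(1), of u s v] uv by auto
    qed
    then show False using uv by blast
  qed
qed

lemma cycle_balanced:
  assumes V: "V \<subseteq> V0" "blk V" "ucf V f" and mu: "multi V f"
    and nb2': "\<forall>u\<in>V. card (nb V u) = 2"
  shows "balanced V f"
proof -
  have k: "2 \<le> card (supp f v)" if "v \<in> V" for v using mu that unfolding multi_def by blast
  have nb2: "card (nb V u) = 2" if "u \<in> V" for u using nb2' that by blast
  note cs = cycle_struct[OF V mu nb2']
  have d: "dg V s u \<noteq> 0" if "u \<in> V" "v \<in> V" "E s u v" for u v s
    using dg_pos[OF V(1) that(2,3)] by simp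
  have W2: "f s x = f (\<not> s) y" if "u \<in> V" "v \<in> V" "E s u v" "x \<in> supp f u" "y \<in> supp f v" for u v s x y
  proof -
    have "E (\<not> s) v u" using that E_not by blast
    then show ?thesis using cs(3)[of u s x] cs(3)[of v "\<not> s" y] d that by metis
  qed
  show ?thesis
  proof (cases "\<forall>u\<in>V. \<forall>s. dg V s u \<noteq> 0")
    case True
    have "bidir V" unfolding bidir_def using cs(4) True adj_E by blast
    moreover have "f True x = f False x" if "u \<in> V" "x \<in> X u" for u x
    proof (cases "x \<in> supp f u")
      case in_supp: True
      then show ?thesis using cs(3)[OF that(1) _ in_supp] True that by simp
    next
      case False
      then show ?thesis using that unfolding supp_def by auto
    qed
    ultimately show ?thesis using W2 unfolding balanced_def by blast
  next
    case False
    then have "\<forall>u\<in>V. \<exists>s. dg V s u = 0" using cs(5) by blast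
    then have "source_sink V" unfolding source_sink_def using d by blast
    then show ?thesis using W2 unfolding balanced_def by blast
  qed
qed

text \<open>A non-zero degree is at least the number of colours sharing it, so some vertex has two
  neighbours.\<close>

lemma card_ge3_of_supp:
  assumes V: "V \<subseteq> V0" "blk V" "ucf V f" and mu: "multi V f"
  shows "3 \<le> card V"
proof -
  have k: "2 \<le> card (supp f v)" if "v \<in> V" for v using mu that unfolding multi_def by blast
  have fin: "finite V" using finite_sub V by blast
  obtain u where u: "u \<in> V" using V(2) unfolding blk_def conn_def by blast
  obtain v where v: "v \<in> V" "adj u v" by (rule blk_nbr[OF V(2) u])
  then obtain s where "E s u v" unfolding adj_def by blast
  then have "0 < dg V s u" using dg_pos[OF V(1) v(1)] by blast
  then have "2 \<le> dg V s u" using card_supp_le_dg[OF V u, of s] k[OF u] by simp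
  also have "dg V s u \<le> card (V - {u})" unfolding dg_def
    by (rule card_mono) (use fin E_irrefl in auto)
  finally show ?thesis using u fin by simp
qed

lemma complete_or_cycle_IH:
  assumes V: "V \<subseteq> V0" "blk V" "ucf V f" and mu: "multi V f"
    and he: "hered V"
  shows "4 \<le> card V \<and> (\<forall>u\<in>V. \<forall>v\<in>V. u \<noteq> v \<longrightarrow> adj u v) \<or> (\<forall>u\<in>V. card (nb V u) = 2)"
proof -
  have k: "2 \<le> card (supp f v)" if "v \<in> V" for v using mu that unfolding multi_def by blast
  have IH: "balanced B g" if "B \<subset> V" "blk B" "ucf B g" "\<And>v. v \<in> B \<Longrightarrow> 2 \<le> card (supp g v)" for B g
    using he that unfolding hered_def multi_def by blast
  have c3: "3 \<le> card V" using card_ge3_of_supp[OF V mu] .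
  have fin: "finite V" using finite_sub V by blast
  have "(\<forall>u\<in>V. \<forall>v\<in>V. u \<noteq> v \<longrightarrow> adj u v) \<or> (\<forall>u\<in>V. card (nb V u) = 2)"
    by (rule complete_or_cycle[OF V(1,2) c3 lobe_adj[OF V mu he]])
  \<comment> \<open>The triangle is assigned to the cycles, so the complete case may count on a
    fourth vertex.\<close>
  moreover have "card (nb V u) = 2" if "\<forall>u\<in>V. \<forall>v\<in>V. u \<noteq> v \<longrightarrow> adj u v" "card V = 3" "u \<in> V" for u
  proof -
    have "nb V u = V - {u}"
    proof (intro equalityI subsetI)
      fix v assume "v \<in> nb V u"
      then show "v \<in> V - {u}" using adj_irrefl unfolding nb_def by auto
    next
      fix v assume "v \<in> V - {u}"
      then show "v \<in> nb V u" using that unfolding nb_def by auto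
    qed
    then show ?thesis using that fin by simp
  qed
  ultimately show ?thesis using c3 by (metis Suc_leI le_neq_implies_less numeral_3_eq_3 numeral_eq_Suc pred_numeral_simps(2) semiring_norm(26) semiring_norm(27))
qed

text \<open>Both the block and its weights vary in the induction, because end blocks come with
  reduced and split weights.\<close>

lemma blk_balanced:
  assumes "V \<subseteq> V0" "blk V" "ucf V f" "multi V f"
  shows "balanced V f"
  using assms
proof (induction "card V" arbitrary: V f rule: less_induct)
  case less
  note V = less.prems(1-3) and mu = less.prems(4)
  have he: "hered V"
    unfolding hered_def
  proof (intro allI impI)
    fix B g assume B: "B \<subset> V" "blk B" "ucf B g" "multi B g"
    have "card B < card V" using psubset_card_mono[OF finite_sub[OF V(1)] B(1)] .
    moreover have "B \<subseteq> V0" using B(1) V(1) by auto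
    ultimately show "balanced B g" using less.hyps B(2-4) by blast
  qed
  show ?case using complete_or_cycle_IH[OF V mu he]
  proof
    assume "4 \<le> card V \<and> (\<forall>u\<in>V. \<forall>v\<in>V. u \<noteq> v \<longrightarrow> adj u v)"
    then have c4: "4 \<le> card V" and cpl: "\<forall>u\<in>V. \<forall>v\<in>V. u \<noteq> v \<longrightarrow> adj u v" by auto
    note cs = complete_struct[OF V mu he c4 cpl]
    have "f s x = f (\<not> s) y" if uv: "u \<in> V" "v \<in> V" "E s u v" "x \<in> supp f u" "y \<in> supp f v" "F s x y" for u v s x y
    proof -
      have "u \<noteq> v" using uv E_irrefl by blast
      then have "f s x = f s y" using cs(5)[OF uv(1,2) _ uv(4-6)] by blast
      also have "f s y = f (\<not> s) y" using cs(2)[OF uv(2) supp_X[OF uv(5)]] .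
      finally show ?thesis .
    qed
    then show ?thesis unfolding balanced_def using cs(1,2) by blast
  next
    assume "\<forall>u\<in>V. card (nb V u) = 2"
    then show ?thesis using cycle_balanced[OF V mu] by blast
  qed
qed

lemma all_hered: "V \<subseteq> V0 \<Longrightarrow> hered V"
  unfolding hered_def using blk_balanced by (meson psubset_imp_subset subset_trans)

text \<open>If \<open>\<alpha>\<close> took only one unit of \<open>z\<close>, then \<open>z\<close>
  would keep weight in just one direction. In \<open>V - {a}\<close> the vertex \<open>u\<close> is
  a leaf attached to \<open>c\<close>, and splitting off \<open>{u, c}\<close> leaves a
  configuration in which the digon between \<open>u\<close> and \<open>c\<close> demands weight of
  \<open>z\<close> in both directions.\<close>

lemma cycle_digon:
  assumes V: "V \<subseteq> V0" "blk V" "ucf V f" and mu: "multi V f"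
    and nb2': "\<forall>u\<in>V. card (nb V u) = 2"
    and pos: "\<And>u s. u \<in> V \<Longrightarrow> dg V s u \<noteq> 0"
    and z: "u \<in> V" "z \<in> supp f u" "a \<in> V" "\<alpha> \<in> supp f a" "F s z \<alpha>"
  shows "F (\<not> s) z \<alpha>"
proof (rule ccontr)
  have k: "2 \<le> card (supp f v)" if "v \<in> V" for v using mu that unfolding multi_def by blast
  have nb2: "card (nb V u) = 2" if "u \<in> V" for u using nb2' that by blast
  assume n: "\<not> F (\<not> s) z \<alpha>"
  note cs = cycle_struct[OF V mu nb2']
  have in0: "u \<in> V0" "a \<in> V0" using z V by auto
  have ua: "adj u a" using adj_E[OF F_E[OF in0 supp_X[OF z(2)] supp_X[OF z(4)] z(5)]] .
  then have "a \<in> nb V u" using z unfolding nb_def by blast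
  with nb2[OF z(1)] obtain c where c: "nb V u = {a, c}" "a \<noteq> c" by (rule card2_other)
  have uc: "c \<in> V" "adj u c" using c(1) unfolding nb_def by auto
  have ne: "u \<noteq> c" "u \<noteq> a" using uc ua adj_irrefl by auto
  \<comment> \<open>For a triangle the second part is just \<open>{c}\<close>, which
    \<open>split_cut\<close> permits.\<close>
  let ?f = "red f \<alpha>" and ?V1 = "{u, c}" and ?V2 = "V - {a} - {u}"
  have fz: "f t z = 1" for t using cs(3)[OF z(1) pos[OF z(1)] z(2)] .
  have rs: "?f s z = 0" "?f (\<not> s) z = 1" using fz z(5) n unfolding red_def by auto
  have ur: "ucf (V - {a}) ?f" using ucf_red[OF V(1,3) z(3,4)] .
  have cn: "conn (V - {a})" using blk_conn V z by blast
  have nadj: "\<not> adj u v" if "v \<in> ?V2 - {c}" for v using that c(1) unfolding nb_def by blast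
  have c1: "conn ?V1" using conn_insert[OF conn_singleton, of u u c] uc(2) by (simp add: insert_commute)
  have c2: "conn ?V2"
  proof (rule conn_I[of c])
    show "c \<in> ?V2" using uc ne c by blast
    fix A assume A: "A \<subseteq> ?V2" "A \<noteq> {}" "c \<notin> A" "\<forall>x\<in>A. \<forall>y\<in>?V2 - A. \<not> adj x y"
    have sub: "A \<subseteq> V - {a}" "A \<noteq> V - {a}" using A z ne by auto
    obtain x y where xy: "x \<in> A" "y \<in> V - {a}" "y \<notin> A" "adj x y" by (rule conn_cut[OF cn sub(1) A(2) sub(2)])
    then have "y = u" using A by blast
    then show False using nadj[of x] xy A adj_sym by blast
  qed
  have Veq: "V - {a} = ?V1 \<union> ?V2" "?V1 \<inter> ?V2 = {c}" using z uc ne c(2) by auto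
  have na: "\<not> adj x y" if "x \<in> ?V1 - {c}" "y \<in> ?V2 - {c}" for x y using that nadj by blast
  have Va: "V - {a} \<subseteq> V0" using V by blast
  have sp1: "ucf ?V1 (part ?f ?V1 c)" by (rule split_cut(1)[OF Va Veq na c1 c2 ur])
  have zc: "z \<notin> X c" using X_disj[of u c z] in0 uc V ne supp_X[OF z(2)] by blast
  have pf: "part ?f ?V1 c t z = ?f t z" for t using zc unfolding part_def by simp
  have "part ?f ?V1 c (\<not> s) z = 1" using pf rs by simp
  then have zs: "z \<in> supp (part ?f ?V1 c) u" using supp_I[OF supp_X[OF z(2)], of "part ?f ?V1 c" "\<not> s"] by simp
  have V1: "?V1 \<subseteq> V0" using in0 uc V by blast
  have d: "?V1 - {u} = {c}" "?V1 - {c} = {u}" using ne by auto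
  have "0 < part ?f ?V1 c s z"
    by (rule arc_full(2)[OF V1 c1 sp1 _ _ _ _ cs(4)[OF z(1) pos[OF z(1)] uc] zs])
      (simp_all add: d conn_singleton)
  then show False using pf rs by simp
qed

section \<open>Enumerating the vertices of a cycle\<close>

lemma mod_pred: "(i + n - Suc 0) mod n = (if i = 0 then n - 1 else i - 1)" if "i < n" for i n :: nat
proof (cases "i = 0")
  case False
  then have "(i + n - Suc 0) mod n = (n + (i - 1)) mod n" by (simp add: add.commute)
  also have "\<dots> = i - 1" using that by simp
  finally show ?thesis using False by simp
qed (use that in simp)

text \<open>All neighbours of the ends of a longest path lie on the path, so here it closes up to a cycle.\<close>

lemma cyclic_enumeration:
  assumes "conn V" "finite V" "3 \<le> card V" and nb2: "\<forall>u\<in>V. card (nb V u) = 2"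
  obtains c where "bij_betw c {..<card V} V"
    and "\<And>i. i < card V \<Longrightarrow> nb V (c i) = {c (Suc i mod card V), c ((i + card V - 1) mod card V)}"
proof -
  let ?P = "\<lambda>p. set p \<subseteq> V \<and> distinct p \<and> p \<noteq> [] \<and> (\<forall>i. Suc i < length p \<longrightarrow> adj (p ! i) (p ! Suc i))"
  obtain v0 where v0: "v0 \<in> V" using assms(1) unfolding conn_def by blast
  then have P0: "?P [v0]" by simp
  have bound: "\<forall>p. ?P p \<longrightarrow> length p < Suc (card V)"
    using assms(2) by (metis card_mono distinct_card le_imp_less_Suc)
  obtain p where p: "set p \<subseteq> V" "distinct p" "p \<noteq> []" "\<And>i. Suc i < length p \<Longrightarrow> adj (p ! i) (p ! Suc i)"
    and longest: "\<And>q. ?P q \<Longrightarrow> length q \<le> length p"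
    using ex_has_greatest_nat[of ?P "[v0]" length "Suc (card V)"] P0 bound by auto
  define m where "m = length p"
  have m0: "0 < m" using p(3) unfolding m_def by simp
  have finn: "finite (nb V u)" for u unfolding nb_def using assms(2) by simp
  have pV: "p ! i \<in> V" if "i < m" for i using p(1) that unfolding m_def by auto
  have nbI: "v \<in> nb V u" if "v \<in> V" "adj u v" for u v using that unfolding nb_def by blast
  have end1: "nb V (p ! (m - 1)) \<subseteq> set p"
  proof
    fix y assume y: "y \<in> nb V (p ! (m - 1))"
    show "y \<in> set p"
    proof (rule ccontr)
      assume ny: "y \<notin> set p"
      have "?P (p @ [y])"
      proof (intro conjI allI impI)
        fix i assume i: "Suc i < length (p @ [y])"
        show "adj ((p @ [y]) ! i) ((p @ [y]) ! Suc i)"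
        proof (cases "Suc i < length p")
          case True
          then show ?thesis using p(4) by (simp add: nth_append)
        next
          case False
          then have "Suc i = length p" "m - 1 = i" using i unfolding m_def by simp_all
          then show ?thesis using y unfolding nb_def by (auto simp: nth_append)
        qed
      qed (use p y ny in \<open>auto simp: nb_def\<close>)
      then show False using longest[of "p @ [y]"] by simp
    qed
  qed
  have end0: "nb V (p ! 0) \<subseteq> set p"
  proof
    fix y assume y: "y \<in> nb V (p ! 0)"
    show "y \<in> set p"
    proof (rule ccontr)
      assume ny: "y \<notin> set p"
      have "?P (y # p)"
      proof (intro conjI allI impI)
        fix i assume i: "Suc i < length (y # p)"
        show "adj ((y # p) ! i) ((y # p) ! Suc i)"
        proof (cases i)
          case 0
          then show ?thesis using y adj_sym unfolding nb_def by auto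
        next
          case (Suc j)
          then show ?thesis using p(4)[of j] i by simp
        qed
      qed (use p y ny in \<open>auto simp: nb_def\<close>)
      then show False using longest[of "y # p"] by simp
    qed
  qed
  have m3: "3 \<le> m"
  proof -
    have "card (nb V (p ! 0)) \<le> card (set p - {p ! 0})"
      by (rule card_mono) (use end0 adj_irrefl in \<open>auto simp: nb_def\<close>)
    moreover have "card (set p - {p ! 0}) = m - 1"
      using p(2,3) unfolding m_def by (simp add: distinct_card)
    ultimately show ?thesis using nb2 pV[OF m0] by simp
  qed
  have inj: "i = j" if "p ! i = p ! j" "i < m" "j < m" for i j
    using that p(2) unfolding m_def by (simp add: nth_eq_iff_index_eq)
  have succ: "p ! Suc i \<in> nb V (p ! i)" if "Suc i < m" for i
    using nbI[OF pV[OF that]] p(4)[of i] that unfolding m_def by blast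
  have pred: "p ! (i - 1) \<in> nb V (p ! i)" if "0 < i" "i < m" for i
    using nbI[OF pV[of "i - 1"]] p(4)[of "i - 1"] that adj_sym unfolding m_def by simp
  have eq2: "nb V (p ! i) = {a, b}" if "i < m" "a \<in> nb V (p ! i)" "b \<in> nb V (p ! i)" "a \<noteq> b" for i a b
    by (rule sym, rule card_subset_eq[OF finn]) (use that nb2 pV in auto)
  have inner: "nb V (p ! i) = {p ! Suc i, p ! (i - 1)}" if "0 < i" "Suc i < m" for i
    using eq2[of i "p ! Suc i" "p ! (i - 1)"] succ[OF that(2)] pred[of i] that inj[of "Suc i" "i - 1"] by force
  have "p ! (m - 1) \<in> nb V (p ! 0)"
  proof -
    have "p ! (m - 2) \<in> nb V (p ! (m - 1))" using pred[of "m - 1"] m3 by (simp add: numeral_2_eq_2)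
    then obtain y where y: "nb V (p ! (m - 1)) = {p ! (m - 2), y}" "p ! (m - 2) \<noteq> y"
      using card2_other[of "nb V (p ! (m - 1))"] nb2 pV[of "m - 1"] m0 by (metis diff_less less_numeral_extra(1))
    then obtain j where j: "j < m" "y = p ! j" using end1 unfolding m_def by (metis in_set_conv_nth insert_subset)
    have adjy: "adj (p ! j) (p ! (m - 1))" using y j adj_sym unfolding nb_def by blast
    \<comment> \<open>\<open>p ! j\<close> is the second neighbour of the last vertex. An inner
      vertex of the path has both its neighbours next to it on the path, so it could only be the
      last but one, which is the first neighbour.\<close>
    have "j = 0"
    proof (rule ccontr)
      assume j0: "j \<noteq> 0"
      have "j \<noteq> m - 1" using adjy adj_irrefl by metis
      then have "Suc j < m" using j by simp
      then have "p ! (m - 1) \<in> {p ! Suc j, p ! (j - 1)}"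
        using inner[of j] j0 nbI[OF pV adjy] m0 by auto
      moreover have "j - 1 < m" "m - 1 < m" using j m0 by auto
      ultimately have "m - 1 = Suc j \<or> m - 1 = j - 1" using inj[of "m - 1" "Suc j"] inj[of "m - 1" "j - 1"] j \<open>Suc j < m\<close> m0 by auto
      then have "j = m - 2" using j j0 by auto
      then show False using y(2) j by simp
    qed
    then show ?thesis using nbI[OF pV adjy] m0 by simp
  qed
  then have close: "p ! (m - 1) \<in> nb V (p ! 0)" "p ! 0 \<in> nb V (p ! (m - 1))"
    using nbI[OF pV[OF m0]] adj_sym unfolding nb_def by auto
  have nbs: "nb V (p ! i) = {p ! (Suc i mod m), p ! ((i + m - 1) mod m)}" if i: "i < m" for i
  proof -
    consider "i = 0" | "i = m - 1" | "0 < i" "Suc i < m" using i by linarith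
    then show ?thesis
    proof cases
      case 1
      have "1 \<noteq> m - 1" "1 < m" "m - 1 < m" using m3 by auto
      then have "p ! 1 \<noteq> p ! (m - 1)" using inj by blast
      then show ?thesis using eq2[OF i, of "p ! 1" "p ! (m - 1)"] succ[of 0] close(1) m3 1 by simp
    next
      case 2
      then have "Suc i mod m = 0" "(i + m - 1) mod m = i - 1" using i m3 mod_pred[OF i] by auto
      moreover have "0 \<noteq> i - 1" "i - 1 < m" using m3 2 by auto
      then have "p ! 0 \<noteq> p ! (i - 1)" using inj m0 by blast
      ultimately show ?thesis using 2 eq2[OF i, of "p ! 0" "p ! (i - 1)"] pred[of i] close(2) m3 by simp
    next
      case 3
      then show ?thesis using inner[OF 3] mod_pred[OF i] by simp
    qed
  qed
  have "set p = V"
  proof (rule ccontr)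
    assume ne: "set p \<noteq> V"
    obtain u v where uv: "u \<in> set p" "v \<in> V" "v \<notin> set p" "adj u v"
      by (rule conn_cut[OF assms(1) p(1) _ ne]) (use p(3) in auto)
    obtain i where i: "i < m" "u = p ! i" using uv(1) unfolding m_def by (metis in_set_conv_nth)
    have "v \<in> nb V (p ! i)" using nbI[OF uv(2)] uv(4) i by blast
    then show False using nbs[OF i(1)] uv(3) m0 unfolding m_def by auto
  qed
  then have m: "m = card V" using p(2) distinct_card unfolding m_def by metis
  have "bij_betw (\<lambda>i. p ! i) {..<card V} V"
    by (rule bij_betw_nth[OF p(2)]) (use m \<open>set p = V\<close> m_def in simp_all)
  then show thesis using that[of "\<lambda>i. p ! i"] nbs m by simp
qed

section \<open>Matched colours along a cycle\<close>

definition Fadj :: "'b \<Rightarrow> 'b \<Rightarrow> bool" where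
  "Fadj x y \<longleftrightarrow> (\<exists>s. F s x y)"

lemma Fadj_sym: "Fadj x y \<Longrightarrow> Fadj y x"
  unfolding Fadj_def using F_not by blast

lemma Fadj_adj: "\<lbrakk>u \<in> V0; v \<in> V0; x \<in> X u; y \<in> X v; Fadj x y\<rbrakk> \<Longrightarrow> adj u v"
  unfolding Fadj_def adj_def using F_E by blast

text \<open>On a cycle it is enough to know which colours are joined at all: if the cycle is
  bidirected, \<open>cycle_digon\<close> supplies the opposite arc, and otherwise only one direction
  occurs at each vertex. Joined colours thus form a matching between the supports of adjacent
  vertices.\<close>

lemma cycle_Fadj:
  assumes V: "V \<subseteq> V0" "blk V" "ucf V f" and mu: "multi V f" and nb2': "\<forall>u\<in>V. card (nb V u) = 2"
  shows "\<And>u v x. \<lbrakk>u \<in> V; v \<in> V; adj u v; x \<in> supp f u\<rbrakk> \<Longrightarrow> \<exists>y\<in>supp f v. Fadj x y"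
    and "\<And>u v x y y'. \<lbrakk>u \<in> V; v \<in> V; x \<in> supp f u; y \<in> supp f v; y' \<in> supp f v; Fadj x y; Fadj x y'\<rbrakk> \<Longrightarrow> y = y'"
    and "\<And>u v x y s. \<lbrakk>u \<in> V; v \<in> V; x \<in> supp f u; y \<in> supp f v; E s u v; Fadj x y\<rbrakk> \<Longrightarrow> F s x y"
proof -
  note cs = cycle_struct[OF V mu nb2']
  have d: "dg V s u \<noteq> 0" if "u \<in> V" "v \<in> V" "E s u v" for u v s
    using dg_pos[OF V(1) that(2,3)] by simp
  show ex: "\<exists>y\<in>supp f v. Fadj x y" if "u \<in> V" "v \<in> V" "adj u v" "x \<in> supp f u" for u v x
  proof -
    from that(3) obtain s where "E s u v" unfolding adj_def by blast
    then show ?thesis using blk_arc(4)[OF V that(1,2) _ that(4)] unfolding Fadj_def by blast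
  qed
  show same: "F s x y" if uv: "u \<in> V" "v \<in> V" and xy: "x \<in> supp f u" "y \<in> supp f v" and E: "E s u v" and R: "Fadj x y" for u v x y s
  proof -
    from R obtain t where t: "F t x y" unfolding Fadj_def by blast
    show ?thesis
    proof (cases "t = s")
      case False
      then have ts: "s = (\<not> t)" by auto
      have "E t u v" using F_E[OF _ _ supp_X[OF xy(1)] supp_X[OF xy(2)] t] uv V(1) by blast
      then have "dg V t u \<noteq> 0" "dg V (\<not> t) u \<noteq> 0" using d uv E ts by auto
      then have "dg V r u \<noteq> 0" for r by (rule bool_cases2[of "\<lambda>r. dg V r u \<noteq> 0"])
      then have "\<not> (\<exists>s. dg V s u = 0 \<and> dg V (\<not> s) u \<noteq> 0)" by blast
      then have "\<forall>u\<in>V. \<forall>s. dg V s u \<noteq> 0" using cs(5) uv by blast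
      then show ?thesis using cycle_digon[OF V mu nb2' _ uv(1) xy(1) uv(2) xy(2) t] ts by blast
    qed (use t in simp)
  qed
  show "y = y'" if uv: "u \<in> V" "v \<in> V" and x: "x \<in> supp f u" and y: "y \<in> supp f v" "y' \<in> supp f v"
    and R: "Fadj x y" "Fadj x y'" for u v x y y'
  proof -
    from R(1) obtain s where s: "F s x y" unfolding Fadj_def by blast
    have in0: "u \<in> V0" "v \<in> V0" using uv V by auto
    have "E s u v" using F_E[OF in0 supp_X[OF x] supp_X[OF y(1)] s] .
    then have "F s x y'" using same[OF uv x y(2) _ R(2)] by blast
    then show ?thesis using F_match[OF in0 supp_X[OF x] supp_X[OF y(1)] supp_X[OF y(2)] s] by blast
  qed
qed

text \<open>
  Following the matchings along the cycle labels the two colours at each vertex. Choosing the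
  two labels alternately gives an independent transversal unless the labels of the first and the
  last vertex are matched in the way that depends on the parity of the length.
\<close>

lemma cycle_label:
  assumes V: "V \<subseteq> V0" "blk V" "ucf V f" and mu: "multi V f" and nb2': "\<forall>u\<in>V. card (nb V u) = 2"
    and c: "bij_betw c {..<n} V"
    and nbc: "\<And>i. i < n \<Longrightarrow> nb V (c i) = {c (Suc i mod n), c ((i + n - 1) mod n)}"
  obtains l where "\<And>i. i < n \<Longrightarrow> supp f (c i) = {l i True, l i False}"
    and "\<And>i. i < n \<Longrightarrow> l i True \<noteq> l i False"
    and "\<And>i b. Suc i < n \<Longrightarrow> Fadj (l i b) (l (Suc i) b)"
    and "\<And>b. Fadj (l (n - 1) b) (l 0 (b = odd n))"
proof -
  note cs = cycle_struct[OF V mu nb2']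
  note R = cycle_Fadj[OF V mu nb2']
  have n: "n = card V" using bij_betw_same_card[OF c] by simp
  have n2: "2 \<le> n" using V(2) n unfolding blk_def by simp
  have cV: "c i \<in> V" if "i < n" for i using c that unfolding bij_betw_def by auto
  have step: "adj (c i) (c (Suc i mod n))" if "i < n" for i
    using nbc[OF that] unfolding nb_def by blast
  from cs(1)[OF cV[of 0]] n2 obtain \<alpha> \<beta> where ab: "supp f (c 0) = {\<alpha>, \<beta>}" "\<alpha> \<noteq> \<beta>" by (auto simp: card_2_iff)
  \<comment> \<open>The labels at position \<open>0\<close> are arbitrary and are carried along by
    partners; the return from \<open>n - 1\<close> to \<open>0\<close> is still open.\<close>
  define l where "l = (\<lambda>i b. rec_nat (if b then \<alpha> else \<beta>) (\<lambda>i a. SOME y. y \<in> supp f (c (Suc i)) \<and> Fadj a y) i)"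
  have l0: "l 0 b = (if b then \<alpha> else \<beta>)" for b unfolding l_def by simp
  have lS: "l (Suc i) b = (SOME y. y \<in> supp f (c (Suc i)) \<and> Fadj (l i b) y)" for i b unfolding l_def by simp
  have nxt: "l (Suc i) b \<in> supp f (c (Suc i)) \<and> Fadj (l i b) (l (Suc i) b)"
    if "Suc i < n" "l i b \<in> supp f (c i)" for i b
  proof -
    have "\<exists>y. y \<in> supp f (c (Suc i)) \<and> Fadj (l i b) y"
      using R(1)[OF cV[of i] cV[of "Suc i"] _ that(2)] step[of i] that(1) by auto
    then show ?thesis unfolding lS by (rule someI_ex)
  qed
  have inl: "l i b \<in> supp f (c i)" if "i < n" for i b
    using that
  proof (induction i)
    case 0
    then show ?case using ab l0 by simp
  next
    case (Suc i)
    then show ?case using nxt by simp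
  qed
  have Rl: "Fadj (l i b) (l (Suc i) b)" if "Suc i < n" for i b using nxt[OF that] inl[of i b] that by simp
  have ne: "l i True \<noteq> l i False" if "i < n" for i
    using that
  proof (induction i)
    case 0
    then show ?case using ab l0 by simp
  next
    case (Suc i)
    show ?case
    proof
      assume eq: "l (Suc i) True = l (Suc i) False"
      have "l i True = l i False"
        by (rule R(2)[OF cV[of "Suc i"] cV[of i] inl[of "Suc i" True] inl[of i True] inl[of i False]])
          (use Suc.prems Fadj_sym[OF Rl[of i True]] Fadj_sym[OF Rl[of i False]] eq in auto)
      then show False using Suc by simp
    qed
  qed
  have sl: "supp f (c i) = {l i True, l i False}" if "i < n" for i
  proof (rule sym, rule card_subset_eq)
    show "finite (supp f (c i))" using finite_supp cV[OF that] V(1) by blast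
  qed (use inl[OF that] ne[OF that] cs(1)[OF cV[OF that]] in auto)
  have ne': "l i b \<noteq> l i (\<not> b)" if "i < n" for i b using ne[OF that] by (cases b) auto
  \<comment> \<open>Consecutive positions receive opposite labels, so the chosen colours are
    unmatched except perhaps at the return step.\<close>
  define t where "t = (\<lambda>i. l i (even i))"
  have close: "Fadj (t (n - 1)) (t 0)"
  proof (rule ccontr)
    assume nc: "\<not> ?thesis"
    have nstep: "\<not> Fadj (t i) (t (Suc i mod n))" if i: "i < n" for i
    proof (cases "Suc i < n")
      case True
      show ?thesis
      proof
        assume "Fadj (t i) (t (Suc i mod n))"
        then have "Fadj (l i (even i)) (l (Suc i) (\<not> even i))" using True unfolding t_def by simp
        then have "l (Suc i) (even i) = l (Suc i) (\<not> even i)"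
          using R(2)[OF cV[OF i] cV[OF True] inl[OF i] inl[OF True] inl[OF True] Rl[OF True]] by blast
        then show False using ne'[OF True] by blast
      qed
    next
      case False
      then have "Suc i = n" using i by linarith
      then have "i = n - 1" "Suc i mod n = 0" by auto
      then show ?thesis using nc by simp
    qed
    let ?T = "t ` {..<n}"
    have tin: "t i \<in> supp f (c i)" if "i < n" for i using inl[OF that] unfolding t_def by blast
    have indep: "\<not> Fadj (t i) (t j)" if ij: "i < n" "j < n" for i j
    proof
      assume F: "Fadj (t i) (t j)"
      have "adj (c i) (c j)"
        using Fadj_adj[OF _ _ supp_X[OF tin[OF ij(1)]] supp_X[OF tin[OF ij(2)]] F] cV ij V(1) by blast
      then have "c j \<in> nb V (c i)" using cV[OF ij(2)] unfolding nb_def by blast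
      then have "c j = c (Suc i mod n) \<or> c j = c ((i + n - 1) mod n)" using nbc[OF ij(1)] by blast
      then have "j = Suc i mod n \<or> j = (i + n - 1) mod n"
        using bij_betw_imp_inj_on[OF c] ij unfolding inj_on_def by auto
      then show False
      proof
        assume "j = Suc i mod n"
        then show False using nstep[OF ij(1)] F by simp
      next
        assume "j = (i + n - 1) mod n"
        then have "Suc j mod n = i" using mod_pred[OF ij(1)] ij n2 by (auto split: if_splits)
        then show False using nstep[OF ij(2)] Fadj_sym[OF F] by simp
      qed
    qed
    have "transv V ?T"
      unfolding transv_def
    proof (intro conjI ballI)
      show "?T \<subseteq> \<Union> (X ` V)" using tin cV supp_X by fastforce
      fix v assume v: "v \<in> V"
      then obtain i where i: "i < n" "v = c i" using c unfolding bij_betw_def by auto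
      have "?T \<inter> X v = {t i}"
      proof (intro equalityI subsetI)
        fix y assume "y \<in> ?T \<inter> X v"
        then obtain j where j: "j < n" "y = t j" "y \<in> X v" by auto
        then have "c j = v" using X_disj[of "c j" v y] supp_X[OF tin[OF j(1)]] cV[OF j(1)] v V(1) by blast
        then have "j = i" using i j bij_betw_imp_inj_on[OF c] unfolding inj_on_def by auto
        then show "y \<in> {t i}" using j by simp
      qed (use i supp_X[OF tin[OF i(1)]] in auto)
      then show "\<exists>x. ?T \<inter> X v = {x}" by blast
    qed
    moreover have "sdeg f ?T"
      unfolding sdeg_def
    proof (intro allI impI)
      fix S assume S: "S \<subseteq> ?T" "S \<noteq> {}"
      then obtain i where i: "i < n" "t i \<in> S" by auto
      obtain s where s: "0 < f s (t i)" using tin[OF i(1)] unfolding supp_def by auto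
      \<comment> \<open>In an independent transversal all degrees are zero, so any positive weight
        suffices.\<close>
      have "{y \<in> S. F s (t i) y} = {}" using indep[OF i(1)] S(1) unfolding Fadj_def by auto
      then have "fd s (t i) S = 0" unfolding fd_def by (metis card.empty)
      then show "\<exists>x\<in>S. \<exists>s. fd s x S < f s x" using i(2) s by metis
    qed
    ultimately show False using V(3) unfolding ucf_def col_def by blast
  qed
  \<comment> \<open>Position \<open>n - 1\<close> carries the label \<open>even (n - 1)\<close> and
    position \<open>0\<close> the label \<open>True\<close>; this is how the parity of
    \<open>n\<close> enters the closing rule.\<close>
  have ev: "even (n - 1) = odd n" using n2 by simp
  have cl1: "Fadj (l (n - 1) (odd n)) (l 0 True)" using close ev unfolding t_def by simp
  have n1: "n - 1 < n" "0 < n" "Suc (n - 1) = n" using n2 by auto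
  have cl2: "Fadj (l (n - 1) (even n)) (l 0 False)"
  proof -
    have "adj (c (n - 1)) (c 0)" using step[OF n1(1)] n1(3) by simp
    then obtain y where y: "y \<in> supp f (c 0)" "Fadj (l (n - 1) (even n)) y"
      using R(1)[OF cV[OF n1(1)] cV[OF n1(2)] _ inl[OF n1(1)]] by blast
    have "y \<noteq> l 0 True"
    proof
      assume "y = l 0 True"
      then have "l (n - 1) (odd n) = l (n - 1) (even n)"
        using R(2)[OF cV[OF n1(2)] cV[OF n1(1)] inl[OF n1(2), of True] inl[OF n1(1)] inl[OF n1(1)]
            Fadj_sym[OF cl1]] Fadj_sym[OF y(2)] by simp
      then show False using ne'[OF n1(1), of "odd n"] by simp
    qed
    then show ?thesis using y sl[OF n1(2)] by auto
  qed
  have "Fadj (l (n - 1) b) (l 0 (b = odd n))" for b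
    using cl1 cl2 by (cases "odd n"; cases b) auto
  then show thesis using that[of l] sl ne Rl by blast
qed

lemma cyclic_adj:
  assumes c: "bij_betw c {..<n} V"
    and nbc: "\<And>i. i < n \<Longrightarrow> nb V (c i) = {c (Suc i mod n), c ((i + n - 1) mod n)}"
    and n: "2 \<le> n"
  shows "cyclic_enum V adj n c"
  unfolding cyclic_enum_def
proof (intro conjI ballI c)
  fix u v assume uv: "u \<in> V" "v \<in> V"
  have step: "adj (c i) (c (Suc i mod n))" if "i < n" for i
    using nbc[OF that] unfolding nb_def by blast
  show "adj u v \<longleftrightarrow> (\<exists>i<n. {u, v} = {c i, c (Suc i mod n)})"
  proof
    assume a: "adj u v"
    obtain i where i: "i < n" "u = c i" using c uv unfolding bij_betw_def by auto
    have "v \<in> nb V (c i)" using a i uv unfolding nb_def by blast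
    then consider "v = c (Suc i mod n)" | "v = c ((i + n - 1) mod n)" using nbc[OF i(1)] by blast
    then show "\<exists>i<n. {u, v} = {c i, c (Suc i mod n)}"
    proof cases
      case 1
      then show ?thesis using i by blast
    next
      case 2
      let ?j = "(i + n - 1) mod n"
      have "?j < n" "Suc ?j mod n = i" using mod_pred[OF i(1)] i n by (auto split: if_splits)
      then have "{u, v} = {c ?j, c (Suc ?j mod n)}" using 2 i by auto
      then show ?thesis using \<open>?j < n\<close> by blast
    qed
  next
    assume "\<exists>i<n. {u, v} = {c i, c (Suc i mod n)}"
    then obtain i where i: "i < n" "{u, v} = {c i, c (Suc i mod n)}" by blast
    then have "u = c i \<and> v = c (Suc i mod n) \<or> v = c i \<and> u = c (Suc i mod n)" by (auto simp: doubleton_eq_iff)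
    then show "adj u v" using step[OF i(1)] adj_sym by blast
  qed
qed

lemma cyclic_enum_cases:
  assumes "cyclic_enum S A n c" "i < n" "j < n" "A (c i) (c j)"
  shows "j = Suc i mod n \<or> i = Suc j mod n"
proof -
  have inS: "c i \<in> S" "c j \<in> S" and inj: "inj_on c {..<n}"
    using assms unfolding cyclic_enum_def bij_betw_def by auto
  obtain k where k: "k < n" "{c i, c j} = {c k, c (Suc k mod n)}"
    using assms(1,4) inS unfolding cyclic_enum_def by blast
  then have "c i = c k \<and> c j = c (Suc k mod n) \<or> c j = c k \<and> c i = c (Suc k mod n)"
    by (auto simp: doubleton_eq_iff)
  moreover have "Suc k mod n < n" using k(1) by simp
  ultimately show ?thesis using inj k(1) assms(2,3) by (metis inj_onD lessThan_iff)
qed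

lemma cyclic_step:
  assumes "cyclic_enum S A n c" "i < n"
  shows "A (c i) (c (Suc i mod n))" "A (c (Suc i mod n)) (c i)"
proof -
  have "c i \<in> S" "c (Suc i mod n) \<in> S" using assms unfolding cyclic_enum_def bij_betw_def by auto
  then show "A (c i) (c (Suc i mod n))" "A (c (Suc i mod n)) (c i)"
    using assms unfolding cyclic_enum_def by (blast, metis insert_commute)
qed

text \<open>For even \<open>n\<close> the return step exchanges the labels, so the two strands join
  into one cycle: once around along label \<open>True\<close>, then along label
  \<open>False\<close>. Hence \<open>k mod n\<close> is the position and \<open>k < n\<close> the
  label.\<close>

lemma cyclic_double:
  assumes V: "V \<subseteq> V0" "blk V" "ucf V f" and mu: "multi V f" and nb2': "\<forall>u\<in>V. card (nb V u) = 2"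
    and c: "cyclic_enum V adj n c" and ev: "even n" and n2: "2 \<le> n"
    and sl: "\<And>i. i < n \<Longrightarrow> supp f (c i) = {l i True, l i False}"
    and ne: "\<And>i. i < n \<Longrightarrow> l i True \<noteq> l i False"
    and Rl: "\<And>i b. Suc i < n \<Longrightarrow> Fadj (l i b) (l (Suc i) b)"
    and cl: "\<And>b. Fadj (l (n - 1) b) (l 0 (b = odd n))"
  shows "cyclic_enum (\<Union>v\<in>V. supp f v) Fadj (2 * n) (\<lambda>k. l (k mod n) (k < n))"
proof -
  define z where "z = (\<lambda>k. l (k mod n) (k < n))"
  have cb: "bij_betw c {..<n} V" using c unfolding cyclic_enum_def by blast
  have cV: "c i \<in> V" if "i < n" for i using cb that unfolding bij_betw_def by auto
  have lin: "l i b \<in> supp f (c i)" if "i < n" for i b using sl[OF that] by (cases b) auto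
  have n0: "0 < n" using n2 by simp
  have modn: "k mod n < n" for k using n0 by simp
  have zin: "z k \<in> supp f (c (k mod n))" for k unfolding z_def using lin[OF modn] by blast
  have idx: "i = j" if "x \<in> supp f (c i)" "x \<in> supp f (c j)" "i < n" "j < n" for x i j
  proof -
    have "c i = c j" using X_disj[of "c i" "c j" x] supp_X that cV V(1) by blast
    then show ?thesis using cb that unfolding bij_betw_def inj_on_def by auto
  qed
  have zstep: "Fadj (z k) (z (Suc k mod (2 * n)))" if k: "k < 2 * n" for k
  proof -
    consider "Suc k < n" | "Suc k = n" | "n \<le> k" "Suc k < 2 * n" | "Suc k = 2 * n" using k by linarith
    then show ?thesis
    proof cases
      case 1
      then show ?thesis using Rl[of k True] unfolding z_def by simp
    next
      case 2
      then have "k = n - 1" by simp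
      then show ?thesis using cl[of True] 2 ev n0 unfolding z_def by auto
    next
      case 3
      then have "k mod n = k - n" "Suc k mod n = Suc (k - n)"
        by (simp_all add: le_mod_geq Suc_diff_le)
      then show ?thesis using Rl[of "k - n" False] 3 unfolding z_def by simp
    next
      case 4
      then have "k mod n = n - 1" using n0 by (simp add: le_mod_geq)
      then show ?thesis using cl[of False] 4 ev n0 unfolding z_def by simp
    qed
  qed
  have bij: "bij_betw z {..<2 * n} (\<Union>v\<in>V. supp f v)"
    unfolding bij_betw_def
  proof (intro conjI inj_onI equalityI subsetI)
    fix k m assume km: "k \<in> {..<2 * n}" "m \<in> {..<2 * n}" "z k = z m"
    have eq: "k mod n = m mod n" using idx[of "z k" "k mod n" "m mod n"] zin[of k] zin[of m] km(3) modn by simp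
    have "(k < n) = (m < n)"
      using km(3) ne[OF modn, of m] unfolding z_def eq by (cases "k < n"; cases "m < n") auto
    then show "k = m" using eq km(1,2) by (cases "k < n") (auto simp: le_mod_geq not_less)
  next
    fix y assume "y \<in> z ` {..<2 * n}"
    then show "y \<in> (\<Union>v\<in>V. supp f v)" using zin cV[OF modn] by blast
  next
    fix y assume "y \<in> (\<Union>v\<in>V. supp f v)"
    then obtain i where i: "i < n" "y \<in> supp f (c i)" using cb unfolding bij_betw_def by auto
    then consider "y = z i" | "y = z (i + n)" using sl[OF i(1)] unfolding z_def by auto
    then show "y \<in> z ` {..<2 * n}" using i by cases auto
  qed
  \<comment> \<open>A colour has a single partner at the next position, so only its successor in the
    enumeration qualifies.\<close>
  have key: "z m = z (Suc k mod (2 * n))" if "k < 2 * n" "Fadj (z k) (z m)" "m mod n = Suc (k mod n) mod n" for k m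
  proof -
    have "Suc k mod (2 * n) mod n = m mod n" using that(3) by (simp add: mod_mod_cancel mod_Suc_eq)
    then have "z (Suc k mod (2 * n)) \<in> supp f (c (m mod n))" using zin[of "Suc k mod (2 * n)"] by simp
    then show ?thesis
      using cycle_Fadj(2)[OF V mu nb2' cV[OF modn] cV[OF modn] zin[of k] zin[of m] _ that(2) zstep[OF that(1)]] by simp
  qed
  have "Fadj x y \<longleftrightarrow> (\<exists>k<2 * n. {x, y} = {z k, z (Suc k mod (2 * n))})"
    if xy: "x \<in> (\<Union>v\<in>V. supp f v)" "y \<in> (\<Union>v\<in>V. supp f v)" for x y
  proof
    assume F: "Fadj x y"
    obtain k where k: "k < 2 * n" "x = z k" using bij xy(1) unfolding bij_betw_def by auto
    obtain m where m: "m < 2 * n" "y = z m" using bij xy(2) unfolding bij_betw_def by auto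
    have "adj (c (k mod n)) (c (m mod n))"
      using Fadj_adj[OF _ _ supp_X[OF zin[of k]] supp_X[OF zin[of m]]] F k m cV[OF modn] V(1) by blast
    then have "m mod n = Suc (k mod n) mod n \<or> k mod n = Suc (m mod n) mod n"
      using cyclic_enum_cases[OF c modn modn] by blast
    then show "\<exists>k<2 * n. {x, y} = {z k, z (Suc k mod (2 * n))}"
    proof
      assume "m mod n = Suc (k mod n) mod n"
      then have "z m = z (Suc k mod (2 * n))" using key[OF k(1), of m] F k m by simp
      then show ?thesis using k m by (intro exI[of _ k]) simp
    next
      assume "k mod n = Suc (m mod n) mod n"
      then have "z k = z (Suc m mod (2 * n))" using key[OF m(1), of k] Fadj_sym[OF F] k m by simp
      then show ?thesis using k m by (intro exI[of _ m]) (simp add: insert_commute)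
    qed
  next
    assume "\<exists>k<2 * n. {x, y} = {z k, z (Suc k mod (2 * n))}"
    then obtain k where k: "k < 2 * n" "{x, y} = {z k, z (Suc k mod (2 * n))}" by blast
    then have "x = z k \<and> y = z (Suc k mod (2 * n)) \<or> y = z k \<and> x = z (Suc k mod (2 * n))"
      by (auto simp: doubleton_eq_iff)
    then show "Fadj x y" using zstep[OF k(1)] Fadj_sym[OF zstep[OF k(1)]] by metis
  qed
  then show ?thesis unfolding cyclic_enum_def using bij unfolding z_def by blast
qed

text \<open>Sources and sinks alternate along the cycle and have to fit together on return.\<close>

lemma source_sink_cycle_even:
  assumes V: "V \<subseteq> V0" and c: "cyclic_enum V adj n c" and n: "2 \<le> n"
    and ss: "\<forall>u\<in>V. \<exists>s. dg V s u = 0 \<and> dg V (\<not> s) u \<noteq> 0"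
  shows "even n"
proof -
  have cV: "c i \<in> V" if "i < n" for i using c that unfolding cyclic_enum_def bij_betw_def by auto
  define \<sigma> where "\<sigma> = (\<lambda>i. dg V True (c i) \<noteq> 0)"
  have ss': "(dg V True u = 0) = (dg V False u \<noteq> 0)" if "u \<in> V" for u
    using bspec[OF ss that] by (metis (full_types))
  have d: "dg V s u \<noteq> 0" if "u \<in> V" "v \<in> V" "E s u v" for u v s
    using dg_pos[OF V that(2,3)] by simp
  have flip: "\<sigma> (Suc i mod n) = (\<not> \<sigma> i)" if i: "i < n" for i
  proof -
    have j: "Suc i mod n < n" using n by simp
    obtain s where s: "E s (c i) (c (Suc i mod n))" using cyclic_step(1)[OF c i] unfolding adj_def by blast
    then have "E (\<not> s) (c (Suc i mod n)) (c i)" using E_not by blast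
    then have "dg V s (c i) \<noteq> 0" "dg V (\<not> s) (c (Suc i mod n)) \<noteq> 0" using d cV i j s by blast+
    then show ?thesis using ss'[OF cV[OF i]] ss'[OF cV[OF j]] unfolding \<sigma>_def by (cases s) auto
  qed
  have "\<sigma> i = (\<sigma> 0 = even i)" if "i < n" for i
    using that
  proof (induction i)
    case (Suc i)
    then show ?case using flip[of i] by auto
  qed simp
  moreover have "\<sigma> 0 = (\<not> \<sigma> (n - 1))" using flip[of "n - 1"] n by simp
  moreover have "n - 1 < n" using n by simp
  ultimately have "\<not> even (n - 1)" by metis
  then show ?thesis using n by simp
qed

end

section \<open>Constructible configurations\<close>

definition dir :: "'c pair_pre_digraph \<Rightarrow> bool \<Rightarrow> 'c \<Rightarrow> 'c \<Rightarrow> bool" where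
  "dir G s u v \<longleftrightarrow> (if s then (u, v) else (v, u)) \<in> parcs G"

definition weight :: "('b \<Rightarrow> nat \<times> nat) \<Rightarrow> bool \<Rightarrow> 'b \<Rightarrow> nat" where
  "weight f s x = (if s then fst (f x) else snd (f x))"

definition unweight :: "(bool \<Rightarrow> 'b \<Rightarrow> nat) \<Rightarrow> 'b \<Rightarrow> nat \<times> nat" where
  "unweight g x = (g True x, g False x)"

lemma unweight_weight: "unweight (weight f) = f"
  unfolding unweight_def weight_def by auto

lemma sum_pair: "(\<Sum>x\<in>A. f x) = (\<Sum>x\<in>A. fst (f x), \<Sum>x\<in>A. snd (f x))"
  for f :: "'b \<Rightarrow> nat \<times> nat"
  by (induction A rule: infinite_finite_induct) (auto simp: zero_prod_def plus_prod_def)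

lemma dir_simps: "dir G True u v \<longleftrightarrow> (u, v) \<in> parcs G" "dir G False u v \<longleftrightarrow> (v, u) \<in> parcs G"
  unfolding dir_def by auto

lemma pair_digraph_facts:
  assumes "pair_digraph G"
  shows "finite (pverts G)" "finite (parcs G)" "(u, v) \<in> parcs G \<Longrightarrow> u \<in> pverts G"
    "(u, v) \<in> parcs G \<Longrightarrow> v \<in> pverts G" "(u, u) \<notin> parcs G"
proof -
  interpret pair_digraph G by fact
  show "finite (pverts G)" "finite (parcs G)" by (fact pair_finite_verts, fact pair_finite_arcs)
  show "(u, v) \<in> parcs G \<Longrightarrow> u \<in> pverts G" "(u, v) \<in> parcs G \<Longrightarrow> v \<in> pverts G"
    using in_arcsD1 in_arcsD2 by blast+
  show "(u, u) \<notin> parcs G" using pair_no_loops by force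
qed

lemma pair_digraph_induce:
  assumes "pair_digraph G"
  shows "pair_digraph (induce G U)"
proof
  interpret pair_digraph G by fact
  show "finite (pverts (induce G U))" "finite (parcs (induce G U))"
    using pair_finite_verts pair_finite_arcs unfolding induce_def by auto
  fix e assume e: "e \<in> parcs (induce G U)"
  then show "fst e \<in> pverts (induce G U)" "snd e \<in> pverts (induce G U)" "fst e \<noteq> snd e"
    using arc_fst_in_verts arc_snd_in_verts pair_no_loops unfolding induce_def by auto
qed

lemma induce_pverts_self: "pair_digraph G \<Longrightarrow> induce G (pverts G) = G"
  using pair_digraph_facts(3,4)[of G] unfolding induce_def by (cases G) auto

lemma induce_induce: "U \<subseteq> V \<Longrightarrow> induce (induce G V) U = induce G U"
  unfolding induce_def by auto

lemma out_degree_card: "out_degree (with_proj G) v = card {y. (v, y) \<in> parcs G}"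
proof -
  have "out_arcs (with_proj G) v = (\<lambda>y. (v, y)) ` {y. (v, y) \<in> parcs G}"
    unfolding out_arcs_def by (auto simp: image_iff)
  then show ?thesis unfolding out_degree_def by (simp add: card_image inj_on_def)
qed

lemma in_degree_card: "in_degree (with_proj G) v = card {y. (y, v) \<in> parcs G}"
proof -
  have "in_arcs (with_proj G) v = (\<lambda>y. (y, v)) ` {y. (y, v) \<in> parcs G}"
    unfolding in_arcs_def by (auto simp: image_iff)
  then show ?thesis unfolding in_degree_def by (simp add: card_image inj_on_def)
qed

lemma cycle_ugraph_underlying:
  assumes "3 \<le> n" "cyclic_enum (pverts G) A n c"
    and "\<And>u v. (u, v) \<in> parcs G \<Longrightarrow> u \<in> pverts G \<and> v \<in> pverts G"
    and "\<And>u v. u \<in> pverts G \<Longrightarrow> v \<in> pverts G \<Longrightarrow> A u v \<longleftrightarrow> (u, v) \<in> parcs G \<or> (v, u) \<in> parcs G"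
  shows "cycle_ugraph n (underlying G)"
proof -
  have cin: "c i \<in> pverts G" if "i < n" for i using assms(2) that unfolding cyclic_enum_def bij_betw_def by auto
  have "{{u, v} |u v. (u, v) \<in> parcs G} = {{c i, c (Suc i mod n)} |i. i < n}" (is "?L = ?R")
  proof (intro equalityI subsetI)
    fix e assume "e \<in> ?L"
    then obtain u v where e: "e = {u, v}" "(u, v) \<in> parcs G" by blast
    then have uv: "u \<in> pverts G" "v \<in> pverts G" "A u v" using assms(3,4) by blast+
    then obtain i where "i < n" "{u, v} = {c i, c (Suc i mod n)}" using assms(2) unfolding cyclic_enum_def by blast
    then show "e \<in> ?R" using e by blast
  next
    fix e assume "e \<in> ?R"
    then obtain i where i: "i < n" "e = {c i, c (Suc i mod n)}" by blast
    let ?u = "c i" and ?v = "c (Suc i mod n)"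
    have uv: "?u \<in> pverts G" "?v \<in> pverts G" using cin i(1) by auto
    have "A ?u ?v" using assms(2) i(1) uv unfolding cyclic_enum_def by blast
    then have "(?u, ?v) \<in> parcs G \<or> (?v, ?u) \<in> parcs G" using assms(4) uv by blast
    then show "e \<in> ?L" using i(2) by (auto simp: insert_commute)
  qed
  then show ?thesis using assms(1,2) unfolding cycle_ugraph_def underlying_def cyclic_enum_def by auto
qed

lemma bidirected_cycleI:
  assumes "3 \<le> n" "cyclic_enum (pverts G) A n c"
    and "\<And>u v. (u, v) \<in> parcs G \<Longrightarrow> u \<in> pverts G \<and> v \<in> pverts G"
    and "\<And>u v. u \<in> pverts G \<Longrightarrow> v \<in> pverts G \<Longrightarrow> (u, v) \<in> parcs G \<longleftrightarrow> A u v"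
    and "\<And>u v. u \<in> pverts G \<Longrightarrow> v \<in> pverts G \<Longrightarrow> A u v \<longleftrightarrow> A v u" and "\<And>u. u \<in> pverts G \<Longrightarrow> \<not> A u u"
  shows "bidirected_cycle n G"
proof -
  have cyc: "cycle_ugraph n (underlying G)"
  proof (rule cycle_ugraph_underlying[OF assms(1-3)])
    fix u v assume uv: "u \<in> pverts G" "v \<in> pverts G"
    show "A u v \<longleftrightarrow> (u, v) \<in> parcs G \<or> (v, u) \<in> parcs G"
      using assms(4)[OF uv] assms(4)[OF uv(2,1)] assms(5)[OF uv] by blast
  qed
  have "parcs G = {(u, v). u \<noteq> v \<and> {u, v} \<in> snd (underlying G)}"
  proof -
    have sym: "(v, u) \<in> parcs G" if "(u, v) \<in> parcs G" for u v
      using that assms(3)[OF that] assms(4)[of u v] assms(4)[of v u] assms(5)[of u v] by blast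
    have "u \<noteq> v" if "(u, v) \<in> parcs G" for u v
      using that assms(3)[OF that] assms(4)[of u v] assms(6)[of u] by blast
    then show ?thesis using sym unfolding underlying_def by (auto simp: doubleton_eq_iff)
  qed
  then have "G = bidirect (underlying G)" unfolding bidirect_def by (simp add: underlying_def)
  then show ?thesis using cyc unfolding bidirected_cycle_def by blast
qed

lemma case_sum_image: "case_sum id id ` (A <+> B) = A \<union> B"
  unfolding Plus_def by (simp add: image_Un image_image)

lemma case_sum_map:
  "map_prod (case_sum id id) (case_sum id id) ` (map_prod Inl Inl ` A \<union> map_prod Inr Inr ` B) = A \<union> B"
  unfolding image_Un image_comp map_prod_compose[symmetric] case_sum_o_inj map_prod.id by simp

text \<open>All subconfigurations of the final induction are cut out of one configuration by vertex
  sets, so a single instance of \<open>digraph_cover\<close> serves throughout.\<close>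

locale dicover =
  fixes D :: "'a pair_pre_digraph" and X :: "'a \<Rightarrow> 'b set" and H :: "'b pair_pre_digraph"
  assumes conf: "configuration D X H"
begin

lemma pdD: "pair_digraph D" and pdH: "pair_digraph H" and cov: "cover D X H"
  using conf unfolding configuration_def cover_def by auto

lemma X_pverts: "v \<in> pverts D \<Longrightarrow> X v \<subseteq> pverts H"
  using cov unfolding cover_def by blast

lemma cover_match:
  assumes "u \<in> pverts D" "v \<in> pverts D" "x \<in> X u" "y \<in> X v" "(x, y) \<in> parcs H"
  shows "(u, v) \<in> parcs D" "matching (arcs_between H (X u) (X v))"
proof -
  have xy: "(x, y) \<in> arcs_between H (X u) (X v)" using assms unfolding arcs_between_def by blast
  then have "u \<noteq> v" using cov assms unfolding cover_def by blast
  then have "if (u, v) \<in> parcs D then matching (arcs_between H (X u) (X v))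
         else arcs_between H (X u) (X v) = {}" using cov assms unfolding cover_def by blast
  then show "(u, v) \<in> parcs D" "matching (arcs_between H (X u) (X v))" using xy by (auto split: if_splits)
qed

lemma cover_match_eq:
  assumes "u \<in> pverts D" "v \<in> pverts D" "x \<in> X u" "y \<in> X v" "x' \<in> X u" "y' \<in> X v"
    and "(x, y) \<in> parcs H" "(x', y') \<in> parcs H" "x = x' \<or> y = y'"
  shows "x = x' \<and> y = y'"
proof (rule ccontr)
  assume ne: "\<not> ?thesis"
  have "(x, y) \<in> arcs_between H (X u) (X v)" "(x', y') \<in> arcs_between H (X u) (X v)"
    using assms unfolding arcs_between_def by auto
  moreover have "(x, y) \<noteq> (x', y')" using ne by simp
  ultimately have "{x, y} \<inter> {x', y'} = {}"
    using cover_match(2)[OF assms(1-4,7)] unfolding matching_def by fastforce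
  then show False using assms(9) by auto
qed

sublocale digraph_cover "pverts D" "dir D" X "dir H"
proof
  show "finite (pverts D)" using pair_digraph_facts(1)[OF pdD] .
  show "\<not> dir D s v v" for s v using pair_digraph_facts(5)[OF pdD] unfolding dir_def by auto
  show "dir D (\<not> s) v u = dir D s u v" for s u v unfolding dir_def by auto
  show "finite (X v)" if "v \<in> pverts D" for v
    using X_pverts[OF that] pair_digraph_facts(1)[OF pdH] finite_subset by blast
  show "u = v" if "u \<in> pverts D" "v \<in> pverts D" "x \<in> X u" "x \<in> X v" for u v x
    using cov that unfolding cover_def by blast
  show "dir H (\<not> s) y x = dir H s x y" for s x y unfolding dir_def by auto
  show "dir D s u v" if "u \<in> pverts D" "v \<in> pverts D" "x \<in> X u" "y \<in> X v" "dir H s x y" for s u v x y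
    using cover_match(1) that unfolding dir_def by (cases s) auto
  show "y = y'" if "u \<in> pverts D" "v \<in> pverts D" "x \<in> X u" "y \<in> X v" "y' \<in> X v" "dir H s x y" "dir H s x y'"
    for s u v x y y'
    using cover_match_eq[OF that(1,2,3,4,3,5)] cover_match_eq[OF that(2,1,4,3,5,3)] that(6,7)
    unfolding dir_def by (cases s) auto
qed

section \<open>Subconfigurations on a set of vertices\<close>

definition subD :: "'a set \<Rightarrow> 'a pair_pre_digraph" where
  "subD V = induce D V"

definition subH :: "'a set \<Rightarrow> 'b pair_pre_digraph" where
  "subH V = induce H (\<Union>(X ` V))"

lemma subD_simps:
  assumes "V \<subseteq> pverts D"
  shows "pverts (subD V) = V" "(u, v) \<in> parcs (subD V) \<longleftrightarrow> u \<in> V \<and> v \<in> V \<and> (u, v) \<in> parcs D"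
  using assms unfolding subD_def induce_def by auto

lemma subH_simps:
  assumes "V \<subseteq> pverts D"
  shows "pverts (subH V) = \<Union>(X ` V)"
    "(x, y) \<in> parcs (subH V) \<longleftrightarrow> x \<in> \<Union>(X ` V) \<and> y \<in> \<Union>(X ` V) \<and> (x, y) \<in> parcs H"
  using assms X_pverts unfolding subH_def induce_def by auto

lemma subD_all: "subD (pverts D) = D"
  unfolding subD_def using induce_pverts_self[OF pdD] .

lemma subH_all: "subH (pverts D) = H"
proof -
  have "\<Union>(X ` pverts D) = pverts H" using cov unfolding cover_def by blast
  then show ?thesis unfolding subH_def using induce_pverts_self[OF pdH] by simp
qed

lemma configuration_sub:
  assumes V: "V \<subseteq> pverts D"
  shows "configuration (subD V) X (subH V)"
  unfolding configuration_def cover_def subD_simps(1)[OF V] subH_simps(1)[OF V]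
proof (intro conjI ballI impI)
  show "pair_digraph (subD V)" unfolding subD_def using pair_digraph_induce[OF pdD] .
  show "pair_digraph (subH V)" unfolding subH_def using pair_digraph_induce[OF pdH] .
  show "\<Union> (X ` V) = \<Union> (X ` V)" ..
  have ab: "arcs_between (subH V) (X u) (X v) = arcs_between H (X u) (X v)" if "u \<in> V" "v \<in> V" for u v
    using that subH_simps(2)[OF V] unfolding arcs_between_def by auto
  fix v assume v: "v \<in> V"
  then show "arcs_between (subH V) (X v) (X v) = {}" using ab[OF v v] cov V unfolding cover_def by auto
  fix u assume u: "u \<in> V"
  assume uv: "v \<noteq> u"
  show "X v \<inter> X u = {}" using u v uv X_disj V by blast
  have "if (v, u) \<in> parcs D then matching (arcs_between H (X v) (X u)) else arcs_between H (X v) (X u) = {}"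
    using cov u v uv V unfolding cover_def by blast
  then show "if (v, u) \<in> parcs (subD V) then matching (arcs_between (subH V) (X v) (X u))
         else arcs_between (subH V) (X v) (X u) = {}"
    using ab[OF v u] subD_simps(2)[OF V] u v by simp
qed

lemma deg_subD:
  assumes "V \<subseteq> pverts D" "v \<in> V"
  shows "deg (subD V) v = (dg V True v, dg V False v)"
proof -
  have "{y. (v, y) \<in> parcs (subD V)} = {u \<in> V. dir D True v u}" "{y. (y, v) \<in> parcs (subD V)} = {u \<in> V. dir D False v u}"
    using assms(2) by (auto simp: dir_simps subD_simps(2)[OF assms(1)])
  then show ?thesis unfolding deg_def out_degree_card in_degree_card dg_def by simp
qed

lemma feas_weight: "degree_feasible D X f \<Longrightarrow> feas (pverts D) (weight f)"
proof -
  assume df: "degree_feasible D X f"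
  show ?thesis
    unfolding feas_def
  proof (intro ballI allI)
    fix v s assume v: "v \<in> pverts D"
    have "deg D v \<le> (\<Sum>x\<in>X v. f x)" using df v unfolding degree_feasible_def by blast
    moreover have "deg D v = (dg (pverts D) True v, dg (pverts D) False v)"
      using deg_subD[OF subset_refl v] unfolding subD_all .
    moreover have "(\<Sum>x\<in>X v. f x) = (sum (weight f True) (X v), sum (weight f False) (X v))"
      unfolding weight_def by (simp add: sum_pair)
    ultimately show "dg (pverts D) s v \<le> sum (weight f s) (X v)" by (cases s) (simp_all add: less_eq_prod_def)
  qed
qed

lemma col_colorable:
  assumes "col (pverts D) (weight f)"
  shows "colorable D X H f"
proof -
  obtain T where T: "transv (pverts D) T" "sdeg (weight f) T" using assms unfolding col_def by blast
  have "transversal D X H T"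
    unfolding transversal_def
  proof (intro conjI ballI)
    show "T \<subseteq> pverts H" using T(1) X_pverts unfolding transv_def by blast
    fix v assume "v \<in> pverts D"
    then obtain x where "T \<inter> X v = {x}" using T(1) unfolding transv_def by blast
    then show "card (T \<inter> X v) = 1" by simp
  qed
  moreover have "strictly_degenerate (induce H T) f"
    unfolding strictly_degenerate_def
  proof (intro allI impI)
    fix H' assume H': "subgraph (with_proj H') (with_proj (induce H T)) \<and> pverts H' \<noteq> {}"
    then have sub: "pverts H' \<subseteq> T" "parcs H' \<subseteq> parcs H" and wf: "wf_digraph (with_proj H')"
      unfolding subgraph_def induce_def by auto
    have finT: "finite T" using finite_transv[OF subset_refl T(1)] .
    obtain x s where x: "x \<in> pverts H'" "fd s x (pverts H') < weight f s x"
      using T(2) sub(1) H' unfolding sdeg_def by blast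
    have ends: "a \<in> pverts H' \<and> b \<in> pverts H'" if "(a, b) \<in> parcs H'" for a b
      using wf that unfolding wf_digraph_wp_iff pair_wf_digraph_def by fastforce
    have fin: "finite {y \<in> pverts H'. dir H s x y}" for s
      by (rule finite_subset[OF _ finT]) (use sub(1) in auto)
    \<comment> \<open>\<open>H'\<close> need not be induced, but its degrees are at most those
      counted by \<open>fd\<close>.\<close>
    have "out_degree H' x \<le> fd True x (pverts H')" if "s = True"
      unfolding out_degree_card fd_def
      by (rule card_mono) (use fin[of True, unfolded dir_simps] ends sub(2) in \<open>auto simp: dir_simps\<close>)
    moreover have "in_degree H' x \<le> fd False x (pverts H')" if "s = False"
      unfolding in_degree_card fd_def
      by (rule card_mono) (use fin[of False, unfolded dir_simps] ends sub(2) in \<open>auto simp: dir_simps\<close>)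
    ultimately have "out_degree H' x < fst (f x) \<or> in_degree H' x < snd (f x)"
      using x(2) unfolding weight_def by (cases s) auto
    then show "\<exists>x\<in>pverts H'. out_degree H' x < fst (f x) \<or> in_degree H' x < snd (f x)" using x(1) by blast
  qed
  ultimately show ?thesis unfolding colorable_def by blast
qed

text \<open>A set without leaving edges contains whatever is reachable from it; conversely, the set
  reachable from \<open>u\<close> has no leaving edge.\<close>

lemma connected_subD:
  assumes V: "V \<subseteq> pverts D"
  shows "Digraph_Component.connected (with_proj (subD V)) \<longleftrightarrow> conn V"
proof -
  let ?R = "parcs (mk_symmetric (with_proj (subD V)))"
  have R: "(u, v) \<in> ?R \<longleftrightarrow> u \<in> V \<and> v \<in> V \<and> adj u v" for u v
  proof -
    have "(u, v) \<in> ?R \<longleftrightarrow> (u, v) \<in> parcs (subD V) \<or> (v, u) \<in> parcs (subD V)"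
      unfolding parcs_mk_symmetric by (auto intro: rev_bexI)
    then show ?thesis using subD_simps(2)[OF V] unfolding adj_def dir_def by (auto split: if_splits)
  qed
  have eq: "Digraph_Component.connected (with_proj (subD V)) \<longleftrightarrow>
      V \<noteq> {} \<and> (\<forall>u\<in>V. \<forall>v\<in>V. (u, v) \<in> rtrancl_on V ?R)"
    unfolding Digraph_Component.connected_def strongly_connected_def reachable_def
    by (simp add: subD_simps(1)[OF V])
  show ?thesis
  proof
    assume "Digraph_Component.connected (with_proj (subD V))"
    then have ne: "V \<noteq> {}" and re: "\<And>u v. u \<in> V \<Longrightarrow> v \<in> V \<Longrightarrow> (u, v) \<in> rtrancl_on V ?R" unfolding eq by auto
    show "conn V"
      unfolding conn_def
    proof (intro conjI allI impI ne)
      fix A assume A: "A \<subseteq> V" "A \<noteq> {} \<and> A \<noteq> V"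
      show "\<exists>u\<in>A. \<exists>v\<in>V - A. adj u v"
      proof (rule ccontr)
        assume neg: "\<not> ?thesis"
        obtain a b where ab: "a \<in> A" "b \<in> V - A" using A by blast
        have "(a, b) \<in> rtrancl_on V ?R" using re ab A by blast
        then have "b \<in> A"
        proof (induction rule: rtrancl_on_induct)
          case (step y z)
          then show ?case using neg R by blast
        qed (rule ab(1))
        then show False using ab by blast
      qed
    qed
  next
    assume cn: "conn V"
    have "(u, v) \<in> rtrancl_on V ?R" if "u \<in> V" "v \<in> V" for u v
    proof (rule ccontr)
      assume n: "(u, v) \<notin> rtrancl_on V ?R"
      let ?A = "{w \<in> V. (u, w) \<in> rtrancl_on V ?R}"
      have "u \<in> ?A" "v \<notin> ?A" using that n by auto
      then have sub: "?A \<subseteq> V" "?A \<noteq> {}" "?A \<noteq> V" using that by blast+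
      obtain x y where xy: "x \<in> ?A" "y \<in> V" "y \<notin> ?A" "adj x y" by (rule conn_cut[OF cn sub])
      then have "(u, y) \<in> rtrancl_on V ?R" using R rtrancl_on_into_rtrancl_on by (metis (no_types, lifting) mem_Collect_eq)
      then show False using xy by blast
    qed
    then show "Digraph_Component.connected (with_proj (subD V))" unfolding eq using cn unfolding conn_def by blast
  qed
qed

text \<open>The guard \<open>V - {v} \<noteq> {}\<close> lets a single vertex count as a block.
  Maximality is immediate, since only subdigraphs of the digraph itself compete.\<close>

lemma is_block_subD:
  assumes V: "V \<subseteq> pverts D" and "conn V" and nc: "\<And>v. v \<in> V \<Longrightarrow> V - {v} \<noteq> {} \<Longrightarrow> conn (V - {v})"
  shows "is_block (subD V)"
proof -
  have nosep: "\<not> separating_vertex (with_proj (subD V)) v" for v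
  proof
    assume sep: "separating_vertex (with_proj (subD V)) v"
    then have v: "v \<in> V" "V - {v} \<noteq> {}" and
      n: "\<not> Digraph_Component.connected (with_proj (subD V) \<restriction> (V - {v}))"
      unfolding separating_vertex_def by (auto simp: subD_simps(1)[OF V])
    have "with_proj (subD V) \<restriction> (V - {v}) = with_proj (induce (subD V) (V - {v}))"
      by (rule with_proj_induce[symmetric]) (auto simp: subD_simps(1)[OF V])
    also have "induce (subD V) (V - {v}) = subD (V - {v})"
      unfolding subD_def by (rule induce_induce) blast
    finally have "Digraph_Component.connected (with_proj (subD V) \<restriction> (V - {v}))"
      using connected_subD[of "V - {v}"] nc[OF v] V by auto
    then show False using n by blast
  qed
  have pd: "pair_digraph (subD V)" unfolding subD_def using pair_digraph_induce[OF pdD] .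
  interpret S: pair_digraph "subD V" by fact
  have "subgraph (with_proj (subD V)) (with_proj (subD V))"
    unfolding subgraph_def using S.wf_digraph by (auto simp: compatible_def)
  moreover have "H' = with_proj (subD V)"
    if "subgraph (with_proj (subD V)) H'" "subgraph H' (with_proj (subD V))" for H'
    using that unfolding subgraph_def compatible_def with_proj_def by (cases H') auto
  moreover have "Digraph_Component.connected (with_proj (subD V))" using connected_subD[OF V] assms(2) by blast
  ultimately show ?thesis unfolding block_of_def pre_digraph.max_subgraph_def using nosep by blast
qed

section \<open>Recognising the types of constructible configurations\<close>

lemma saturated_sub:
  assumes V: "V \<subseteq> pverts D" and T: "T \<subseteq> \<Union>(X ` V)" "\<And>v. v \<in> V \<Longrightarrow> T \<inter> X v = {t v}"
    and arcs: "\<And>u v. u \<in> V \<Longrightarrow> v \<in> V \<Longrightarrow> (u, v) \<in> parcs D \<Longrightarrow> (t u, t v) \<in> parcs H"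
  shows "transversal (subD V) X (subH V) T" "saturated_restr (subD V) X (subH V) T"
proof -
  show "transversal (subD V) X (subH V) T"
    unfolding transversal_def subD_simps(1)[OF V] subH_simps(1)[OF V] using T by simp
  have all: "{v \<in> V. X v \<inter> T \<noteq> {}} = V" using T(2) by blast
  have Dall: "induce (subD V) V = subD V" unfolding subD_def by (rule induce_induce) simp
  show "saturated_restr (subD V) X (subH V) T"
    unfolding saturated_restr_def saturated_def subD_simps(1)[OF V] all Dall
  proof (intro ballI, clarify)
    fix u v assume "(u, v) \<in> parcs (subD V)"
    then have uv: "u \<in> V" "v \<in> V" "(u, v) \<in> parcs D" using subD_simps(2)[OF V] by auto
    have Xt: "X u \<inter> T = {t u}" "X v \<inter> T = {t v}" using T(2) uv by blast+
    have tin: "t u \<in> T" "t v \<in> T" "t u \<in> \<Union>(X ` V)" "t v \<in> \<Union>(X ` V)" using Xt uv by blast+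
    have arc: "(t u, t v) \<in> parcs (induce (subH V) T)"
      using arcs[OF uv] tin subH_simps(2)[OF V] unfolding induce_def by simp
    \<comment> \<open>With one colour per vertex the matching between two classes is a single arc,
      which is perfect once it is present.\<close>
    have between: "arcs_between (induce (subH V) T) (X u \<inter> T) (X v \<inter> T) = {(t u, t v)}"
      unfolding arcs_between_def Xt using arc by blast
    have pv: "pverts (induce (induce (subH V) T) (X u \<inter> T \<union> X v \<inter> T)) = {t u, t v}"
      using tin subH_simps(1)[OF V] unfolding induce_def Xt by auto
    have pa: "(t u, t v) \<in> parcs (induce (induce (subH V) T) (X u \<inter> T \<union> X v \<inter> T))"
      using arc unfolding Xt induce_def[of "induce (subH V) T"] by simp
    show "perfect_matching (induce (induce (subH V) T) (X u \<inter> T \<union> X v \<inter> T))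
        (arcs_between (induce (subH V) T) (X u \<inter> T) (X v \<inter> T))"
      unfolding perfect_matching_def between pv matching_def using pa by auto
  qed
qed

lemma image_transversal:
  assumes "V \<subseteq> pverts D" "\<And>v. v \<in> V \<Longrightarrow> t v \<in> X v"
  shows "t ` V \<subseteq> \<Union>(X ` V)" "v \<in> V \<Longrightarrow> t ` V \<inter> X v = {t v}"
proof -
  show "t ` V \<subseteq> \<Union>(X ` V)" using assms(2) by blast
  assume v: "v \<in> V"
  show "t ` V \<inter> X v = {t v}"
  proof (intro equalityI subsetI)
    fix x assume "x \<in> t ` V \<inter> X v"
    then obtain u where u: "u \<in> V" "x = t u" "x \<in> X v" by blast
    then have "u = v" using X_disj[of u v x] assms v by blast
    then show "x \<in> {t v}" using u by simp
  qed (use assms(2) v in auto)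
qed

lemma saturated_image:
  assumes "V \<subseteq> pverts D" "\<And>v. v \<in> V \<Longrightarrow> t v \<in> X v"
    and "\<And>u v. u \<in> V \<Longrightarrow> v \<in> V \<Longrightarrow> (u, v) \<in> parcs D \<Longrightarrow> (t u, t v) \<in> parcs H"
  shows "transversal (subD V) X (subH V) (t ` V)" "saturated_restr (subD V) X (subH V) (t ` V)"
  using saturated_sub[OF assms(1) image_transversal[OF assms(1,2)] assms(3)] by auto

text \<open>All other weights at \<open>v\<close> being zero, tightness makes the weight of
  \<open>t v\<close> the degree of \<open>v\<close>.\<close>

lemma constructible_block:
  assumes V: "V \<subseteq> pverts D" and cn: "conn V" "\<And>v. v \<in> V \<Longrightarrow> V - {v} \<noteq> {} \<Longrightarrow> conn (V - {v})"
    and u: "ucf V g" and t: "\<And>v. v \<in> V \<Longrightarrow> t v \<in> X v"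
    and z: "\<And>v x s. v \<in> V \<Longrightarrow> x \<in> X v \<Longrightarrow> x \<noteq> t v \<Longrightarrow> g s x = 0"
    and arcs: "\<And>u v. u \<in> V \<Longrightarrow> v \<in> V \<Longrightarrow> (u, v) \<in> parcs D \<Longrightarrow> (t u, t v) \<in> parcs H"
  shows "constructible (subD V) X (subH V) (unweight g)"
proof (rule constructible.block)
  show "configuration (subD V) X (subH V)" using configuration_sub[OF V] .
  show "is_block (subD V)" using is_block_subD[OF V cn] .
  show "transversal (subD V) X (subH V) (t ` V)" "saturated_restr (subD V) X (subH V) (t ` V)"
    using saturated_image[OF V t arcs] by auto
  have val: "g s (t v) = dg V s v" if v: "v \<in> V" for s v
  proof -
    have "finite (X v)" using finite_X v V by blast
    then have "sum (g s) (X v) = g s (t v)"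
      using t[OF v] z[OF v] by (subst sum.remove[of _ "t v"]) auto
    then show ?thesis using tight[OF V cn(1) u v] by simp
  qed
  show "\<forall>v\<in>pverts (subD V). \<forall>x\<in>t ` V \<inter> X v. unweight g x = deg (subD V) v"
    unfolding subD_simps(1)[OF V]
    using image_transversal(2)[OF V t] val deg_subD[OF V] unfolding unweight_def by simp
  show "\<forall>x\<in>pverts (subH V) - t ` V. unweight g x = (0, 0)"
    unfolding subH_simps(1)[OF V] unweight_def using z by auto
qed

text \<open>Serves the complete blocks and, with \<open>p = 2\<close> and both
  \<open>k i = 1\<close>, also the triangle, which the odd cycles leave out.\<close>

lemma constructible_complete:
  assumes V: "V \<subseteq> pverts D" "V \<noteq> {}" and p: "1 \<le> (p::nat)"
    and t: "\<And>i v. i \<in> {1..p} \<Longrightarrow> v \<in> V \<Longrightarrow> t i v \<in> X v"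
    and arcs: "\<And>i u v. i \<in> {1..p} \<Longrightarrow> u \<in> V \<Longrightarrow> v \<in> V \<Longrightarrow> (u, v) \<in> parcs D \<Longrightarrow> (t i u, t i v) \<in> parcs H"
    and ne: "\<And>i j v. i \<in> {1..p} \<Longrightarrow> j \<in> {1..p} \<Longrightarrow> i \<noteq> j \<Longrightarrow> v \<in> V \<Longrightarrow> t i v \<noteq> t j v"
    and val: "\<And>i v s. i \<in> {1..p} \<Longrightarrow> v \<in> V \<Longrightarrow> g s (t i v) = k i"
    and k: "\<And>i. i \<in> {1..p} \<Longrightarrow> 1 \<le> k i" "(\<Sum>i = 1..p. k i) = card V - 1"
    and z: "\<And>v x s. v \<in> V \<Longrightarrow> x \<in> X v \<Longrightarrow> (\<And>i. i \<in> {1..p} \<Longrightarrow> x \<noteq> t i v) \<Longrightarrow> g s x = 0"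
    and cpl: "\<And>u v. u \<in> V \<Longrightarrow> v \<in> V \<Longrightarrow> u \<noteq> v \<Longrightarrow> (u, v) \<in> parcs D"
  shows "constructible (subD V) X (subH V) (unweight g)"
proof (rule constructible.complete[where n = "card V" and p = p and k = k and T = "\<lambda>i. t i ` V"])
  have fin: "finite V" using finite_sub V by blast
  show "configuration (subD V) X (subH V)" using configuration_sub[OF V(1)] .
  show "1 \<le> card V" using fin V(2) by (simp add: Suc_leI card_gt_0_iff)
  have "subD V = bidirect (V, {{u, v} |u v. u \<in> V \<and> v \<in> V \<and> u \<noteq> v})"
  proof -
    have "{a, b} \<in> {{u, v} |u v. u \<in> V \<and> v \<in> V \<and> u \<noteq> v} \<longleftrightarrow> a \<in> V \<and> b \<in> V \<and> a \<noteq> b" for a b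
      by (auto simp: doubleton_eq_iff)
    moreover have "(a, b) \<in> parcs (subD V) \<longleftrightarrow> a \<in> V \<and> b \<in> V \<and> a \<noteq> b" for a b
      using cpl subD_simps(2)[OF V(1)] pair_digraph_facts(5)[OF pdD] by blast
    ultimately have "parcs (subD V) = {(u, v). u \<noteq> v \<and> {u, v} \<in> {{u, v} |u v. u \<in> V \<and> v \<in> V \<and> u \<noteq> v}}"
      by auto
    then show ?thesis unfolding bidirect_def using subD_simps(1)[OF V(1)] by simp
  qed
  moreover have "complete_ugraph (card V) (V, {{u, v} |u v. u \<in> V \<and> v \<in> V \<and> u \<noteq> v})"
    unfolding complete_ugraph_def using fin by simp
  ultimately show "bidirected_complete (card V) (subD V)" unfolding bidirected_complete_def by blast
  show "\<forall>i\<in>{1..p}. transversal (subD V) X (subH V) (t i ` V) \<and> saturated_restr (subD V) X (subH V) (t i ` V)"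
    using saturated_image[OF V(1) t arcs] by blast
  show "\<forall>i\<in>{1..p}. \<forall>j\<in>{1..p}. i \<noteq> j \<longrightarrow> t i ` V \<inter> t j ` V = {}"
  proof (intro ballI impI)
    fix i j assume ij: "i \<in> {1..p}" "j \<in> {1..p}" "i \<noteq> j"
    have False if "x \<in> t i ` V" "x \<in> t j ` V" for x
    proof -
      from that obtain u v where uv: "u \<in> V" "x = t i u" "v \<in> V" "x = t j v" by blast
      have "x \<in> X u" "x \<in> X v" using t[OF ij(1) uv(1)] t[OF ij(2) uv(3)] uv by simp_all
      then have "u = v" using X_disj[of u v x] V(1) uv by blast
      then show False using ne[OF ij uv(1)] uv by simp
    qed
    then show "t i ` V \<inter> t j ` V = {}" by blast
  qed
  show "\<forall>i\<in>{1..p}. \<forall>x\<in>t i ` V. unweight g x = (k i, k i)" using val unfolding unweight_def by auto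
  show "\<forall>x\<in>pverts (subH V) - (\<Union>i\<in>{1..p}. t i ` V). unweight g x = (0, 0)"
    unfolding subH_simps(1)[OF V(1)]
  proof
    fix x assume x: "x \<in> \<Union>(X ` V) - (\<Union>i\<in>{1..p}. t i ` V)"
    then obtain v where v: "v \<in> V" "x \<in> X v" by blast
    then have "x \<noteq> t i v" if "i \<in> {1..p}" for i using x that by blast
    then show "unweight g x = (0, 0)" unfolding unweight_def using z[OF v] by blast
  qed
qed (use p k in auto)

text \<open>A single vertex has degree zero, so by tightness all its weights vanish and any colour
  forms the required transversal; one colour has to exist.\<close>

lemma constructible_single:
  assumes V: "v \<in> pverts D" and u: "ucf {v} g" and x: "x \<in> X v"
  shows "constructible (subD {v}) X (subH {v}) (unweight g)"
proof (rule constructible_block[where t = "\<lambda>_. x"])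
  show "{v} \<subseteq> pverts D" using V by simp
  show "conn {v}" by (rule conn_singleton)
  show "g s y = 0" if "w \<in> {v}" "y \<in> X w" for w y s
  proof -
    have "dg {v} s v = 0" unfolding dg_def using E_irrefl by auto
    then have "sum (g s) (X v) = 0" using tight[of "{v}" g v s] V u conn_singleton by simp
    then show ?thesis using finite_X[OF V] that by simp
  qed
  show "(x, x) \<in> parcs H" if "a \<in> {v}" "b \<in> {v}" "(a, b) \<in> parcs D" for a b
    using that pair_digraph_facts(5)[OF pdD] by auto
qed (use u x in auto)

lemma constructible_blk1:
  assumes V: "V \<subseteq> pverts D" "blk V" "ucf V g" and k: "\<And>v. v \<in> V \<Longrightarrow> card (supp g v) = 1"
  shows "constructible (subD V) X (subH V) (unweight g)"
proof -
  from k have "\<forall>v\<in>V. \<exists>x. supp g v = {x}" by (meson card_1_singletonE)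
  then obtain t where t: "\<And>v. v \<in> V \<Longrightarrow> supp g v = {t v}" by metis
  show ?thesis
  proof (rule constructible_block[where t = t])
    show "t v \<in> X v" if "v \<in> V" for v using t[OF that] supp_X by blast
    show "g s x = 0" if "v \<in> V" "x \<in> X v" "x \<noteq> t v" for v x s
      using t[OF that(1)] that supp_I[of x v g s] by blast
    show "(t u, t v) \<in> parcs H" if uv: "u \<in> V" "v \<in> V" "(u, v) \<in> parcs D" for u v
    proof -
      have "dir D True u v" using uv by (simp add: dir_simps)
      then have "dir H True (t u) (t v)" using blk_arc(4)[OF V uv(1,2), of True "t u"] t uv by auto
      then show ?thesis by (simp add: dir_simps)
    qed
  qed (use V blk_conn in auto)
qed

text \<open>Both parts live in the types of the whole, so the quotient map merely forgets the tag,
  as \<open>case_sum id id\<close>, and the bijection between the two copies of \<open>X c\<close>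
  is the identity.\<close>

lemma constructible_merge:
  assumes V: "V \<subseteq> pverts D" "V = V1 \<union> V2" "V1 \<inter> V2 = {c}"
    and noadj: "\<And>u v. u \<in> V1 - {c} \<Longrightarrow> v \<in> V2 - {c} \<Longrightarrow> \<not> adj u v"
    and card: "card V1 < card V" "card V2 < card V"
    and C: "constructible (subD V1) X (subH V1) (unweight g1)" "constructible (subD V2) X (subH V2) (unweight g2)"
    and g: "\<And>x s. x \<in> X c \<Longrightarrow> g s x = g1 s x + g2 s x"
      "\<And>x s. x \<notin> X c \<Longrightarrow> g1 s x = g s x" "\<And>x s. x \<notin> X c \<Longrightarrow> g2 s x = g s x"
  shows "constructible (subD V) X (subH V) (unweight g)"
proof (rule constructible.merge[OF configuration_sub[OF V(1)] C])
  have V12: "V1 \<subseteq> V" "V2 \<subseteq> V" using V(2) by auto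
  have V1: "V1 \<subseteq> pverts D" and V2: "V2 \<subseteq> pverts D" and c: "c \<in> V1" "c \<in> V2" using V by auto
  show "card (pverts (subD V1)) < card (pverts (subD V))" "card (pverts (subD V2)) < card (pverts (subD V))"
    using card subD_simps(1) V V1 V2 by auto
  have arcD: "u \<in> V1 \<and> v \<in> V1 \<or> u \<in> V2 \<and> v \<in> V2" if "u \<in> V" "v \<in> V" "(u, v) \<in> parcs D" for u v
  proof -
    have "adj u v" using that(3) unfolding adj_def by (metis dir_simps(1))
    then show ?thesis using noadj[of u v] noadj[of v u] adj_sym that V(2) c by blast
  qed
  define q where "q = (case_sum id id :: 'a + 'a \<Rightarrow> 'a)"
  define r where "r = (case_sum id id :: 'b + 'b \<Rightarrow> 'b)"
  \<comment> \<open>The classes are disjoint and the parts meet only in \<open>c\<close>, so nothing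
    but the colours of \<open>c\<close> gets identified.\<close>
  have shared: "x \<in> X c" if "x \<in> \<Union>(X ` V1)" "x \<in> \<Union>(X ` V2)" for x
  proof -
    from that obtain u v where uv: "u \<in> V1" "x \<in> X u" "v \<in> V2" "x \<in> X v" by blast
    then have "u = v" using X_disj[of u v x] V1 V2 by blast
    then have "u = c" using V(3) uv by blast
    then show ?thesis using uv by simp
  qed
  have "identifies q (pverts (disjoint_union (subD V1) (subD V2))) {(Inl c, Inr c)}"
    unfolding identifies_def disjoint_union_def q_def
    using V(3) subD_simps(1)[OF V1] subD_simps(1)[OF V2] by auto
  moreover have "identifies r (pverts (disjoint_union (subH V1) (subH V2))) {(Inl x, Inr (id x)) |x. x \<in> X c}"
    unfolding identifies_def
  proof (intro ballI)
    fix a b assume ab: "a \<in> pverts (disjoint_union (subH V1) (subH V2))" "b \<in> pverts (disjoint_union (subH V1) (subH V2))"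
    have pv: "pverts (disjoint_union (subH V1) (subH V2)) = \<Union>(X ` V1) <+> \<Union>(X ` V2)"
      unfolding disjoint_union_def subH_simps(1)[OF V1] subH_simps(1)[OF V2] by simp
    have sh: "x \<in> X c" if "Inl x \<in> \<Union>(X ` V1) <+> \<Union>(X ` V2)" "Inr x \<in> \<Union>(X ` V1) <+> \<Union>(X ` V2)" for x
      by (rule shared) (use that in auto)
    show "(r a = r b) = (a = b \<or> (a, b) \<in> {(Inl x, Inr (id x)) |x. x \<in> X c} \<or>
        (b, a) \<in> {(Inl x, Inr (id x)) |x. x \<in> X c})"
      using ab sh unfolding pv r_def by (cases a; cases b) (simp_all, blast+)
  qed
  moreover have "subD V = image_digraph q (disjoint_union (subD V1) (subD V2))"
  proof -
    have "pverts (subD V) = q ` (pverts (subD V1) <+> pverts (subD V2))"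
      unfolding q_def case_sum_image subD_simps(1)[OF V(1)] subD_simps(1)[OF V1] subD_simps(1)[OF V2]
      using V(2) by blast
    moreover have "parcs (subD V) = map_prod q q ` (map_prod Inl Inl ` parcs (subD V1) \<union> map_prod Inr Inr ` parcs (subD V2))"
    proof -
      have "map_prod q q ` (map_prod Inl Inl ` parcs (subD V1) \<union> map_prod Inr Inr ` parcs (subD V2)) = parcs (subD V1) \<union> parcs (subD V2)"
        unfolding q_def by (rule case_sum_map)
      also have "\<dots> = parcs (subD V)"
      proof (intro equalityI subrelI)
        fix u v assume "(u, v) \<in> parcs (subD V1) \<union> parcs (subD V2)"
        then show "(u, v) \<in> parcs (subD V)"
          using V12 by (auto simp: subD_simps(2)[OF V(1)] subD_simps(2)[OF V1] subD_simps(2)[OF V2])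
      next
        fix u v assume "(u, v) \<in> parcs (subD V)"
        then show "(u, v) \<in> parcs (subD V1) \<union> parcs (subD V2)"
          using arcD[of u v] by (auto simp: subD_simps(2)[OF V(1)] subD_simps(2)[OF V1] subD_simps(2)[OF V2])
      qed
      finally show ?thesis by simp
    qed
    ultimately show ?thesis unfolding image_digraph_def disjoint_union_def by simp
  qed
  moreover have "subH V = image_digraph r (disjoint_union (subH V1) (subH V2))"
  proof -
    have "pverts (subH V) = r ` (pverts (subH V1) <+> pverts (subH V2))"
      unfolding r_def case_sum_image subH_simps(1)[OF V(1)] subH_simps(1)[OF V1] subH_simps(1)[OF V2]
      using V(2) by blast
    moreover have "parcs (subH V) = map_prod r r ` (map_prod Inl Inl ` parcs (subH V1) \<union> map_prod Inr Inr ` parcs (subH V2))"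
    proof -
      have "map_prod r r ` (map_prod Inl Inl ` parcs (subH V1) \<union> map_prod Inr Inr ` parcs (subH V2)) = parcs (subH V1) \<union> parcs (subH V2)"
        unfolding r_def by (rule case_sum_map)
      also have "\<dots> = parcs (subH V)"
      proof (intro equalityI subrelI)
        fix x y assume "(x, y) \<in> parcs (subH V1) \<union> parcs (subH V2)"
        then show "(x, y) \<in> parcs (subH V)"
          using V12 by (auto simp: subH_simps(2)[OF V(1)] subH_simps(2)[OF V1] subH_simps(2)[OF V2])
      next
        fix x y assume "(x, y) \<in> parcs (subH V)"
        then obtain u v where uv: "u \<in> V" "v \<in> V" "x \<in> X u" "y \<in> X v" and a: "(x, y) \<in> parcs H"
          unfolding subH_simps(2)[OF V(1)] by blast
        have "(u, v) \<in> parcs D" using cover_match(1)[OF _ _ uv(3,4) a] uv V(1) by blast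
        then show "(x, y) \<in> parcs (subH V1) \<union> parcs (subH V2)"
          using arcD[OF uv(1,2)] uv a by (auto simp: subH_simps(2)[OF V1] subH_simps(2)[OF V2])
      qed
      finally show ?thesis by simp
    qed
    ultimately show ?thesis unfolding image_digraph_def disjoint_union_def by simp
  qed
  moreover have "\<forall>v\<in>pverts (subD V1). X (q (Inl v)) = r ` Inl ` X v" "\<forall>v\<in>pverts (subD V2). X (q (Inr v)) = r ` Inr ` X v"
    unfolding q_def r_def by (simp_all add: image_image)
  moreover have "\<forall>x\<in>pverts (subH V1) - X c. unweight g (r (Inl x)) = unweight g1 x"
    "\<forall>x\<in>pverts (subH V2) - X c. unweight g (r (Inr x)) = unweight g2 x"
    "\<forall>x\<in>X c. unweight g (r (Inl x)) = unweight g1 x + unweight g2 (id x)"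
    unfolding r_def unweight_def using g by (auto simp: plus_prod_def)
  moreover have "bij_betw id (X c) (X c)" by simp
  moreover have "c \<in> pverts (subD V1)" "c \<in> pverts (subD V2)"
    using c subD_simps(1)[OF V1] subD_simps(1)[OF V2] by auto
  ultimately show "merged (subD V1) X (subH V1) (unweight g1) (subD V2) X (subH V2) (unweight g2)
      (subD V) X (subH V) (unweight g)"
    unfolding merged_def by (intro bexI[of _ c] exI[of _ id] exI[of _ q] exI[of _ r]) blast+
qed

text \<open>Each colour of a fixed vertex \<open>v0\<close>, together with its partners at all other
  vertices, forms one transversal. Transitivity of the matching makes it saturated, and weights are
  constant on it. The numbers are the weights at \<open>v0\<close>, which sum to the degree
  \<open>card V - 1\<close>.\<close>

lemma constructible_blk_complete:
  assumes V: "V \<subseteq> pverts D" "blk V" "ucf V g" and mu: "multi V g"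
    and c4: "4 \<le> card V" and cpl: "\<forall>u\<in>V. \<forall>v\<in>V. u \<noteq> v \<longrightarrow> adj u v"
  shows "constructible (subD V) X (subH V) (unweight g)"
proof -
  note cs = complete_struct[OF V mu all_hered[OF V(1)] c4 cpl]
  have EE: "dir D s u v" if uv: "u \<in> V" "v \<in> V" "u \<noteq> v" for s u v
  proof -
    from cpl uv obtain t where "dir D t u v" unfolding adj_def by blast
    then show ?thesis using bool_cases2[of "\<lambda>t. dir D t u v" t s] cs(1) uv unfolding bidir_def by blast
  qed
  obtain v0 where v0: "v0 \<in> V" using V(2) unfolding blk_def conn_def by blast
  define p where "p = card (supp g v0)"
  have p: "2 \<le> p" using mu v0 unfolding p_def multi_def by blast
  have fs: "finite (supp g v0)" using finite_supp v0 V(1) by blast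
  obtain e where e: "bij_betw e {1..p} (supp g v0)"
    using fs unfolding p_def by (metis ex_bij_betw_nat_finite_1)
  have ein: "e i \<in> supp g v0" if "i \<in> {1..p}" for i using e that unfolding bij_betw_def by blast
  define cl where "cl = (\<lambda>a v. SOME y. y \<in> supp g v \<and> (v = v0 \<longrightarrow> y = a) \<and> (v \<noteq> v0 \<longrightarrow> dir H True a y))"
  have cl: "cl a v \<in> supp g v \<and> (v = v0 \<longrightarrow> cl a v = a) \<and> (v \<noteq> v0 \<longrightarrow> dir H True a (cl a v))"
    if "v \<in> V" "a \<in> supp g v0" for v a
  proof -
    have "\<exists>y. y \<in> supp g v \<and> (v = v0 \<longrightarrow> y = a) \<and> (v \<noteq> v0 \<longrightarrow> dir H True a y)"
      using blk_arc(4)[OF V v0 that(1) EE[OF v0 that(1), of True] that(2)] that(2) by (cases "v = v0") auto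
    then show ?thesis unfolding cl_def by (rule someI_ex)
  qed
  have clF: "dir H True (cl a u) (cl a v)" if a: "a \<in> supp g v0" and uv: "u \<in> V" "v \<in> V" "u \<noteq> v" for a u v
  proof -
    consider "u = v0" | "v = v0" | "u \<noteq> v0" "v \<noteq> v0" by blast
    then show ?thesis
    proof cases
      case 1
      then show ?thesis using cl[OF uv(1) a] cl[OF uv(2) a] uv by simp
    next
      case 2
      then have "dir H True a (cl a u)" "cl a v = a" using cl[OF uv(1) a] cl[OF uv(2) a] uv by auto
      moreover have "dir H False a (cl a u)"
        using cs(3)[OF v0 uv(1) _ a _ calculation(1), of False] 2 uv cl[OF uv(1) a] by blast
      ultimately show ?thesis by (simp add: dir_simps)
    next
      case 3
      then show ?thesis
        using cs(4)[OF v0 uv(1,2) _ _ uv(3) a, of "cl a u" "cl a v" True] cl[OF uv(1) a] cl[OF uv(2) a] by blast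
    qed
  qed
  have clval: "g s (cl a v) = g True a" if a: "a \<in> supp g v0" and v: "v \<in> V" for a v s
  proof (cases "v = v0")
    case True
    then show ?thesis using cl[OF v a] cs(2)[OF v0 supp_X[OF a], of s True] by simp
  next
    case False
    have c: "cl a v \<in> supp g v" "dir H True a (cl a v)" using cl[OF v a] False by auto
    have "g True a = g True (cl a v)" using cs(5)[OF v0 v _ a c] False by blast
    then show ?thesis using cs(2)[OF v supp_X[OF c(1)], of s True] by simp
  qed
  have clinj: "a = b" if ab: "a \<in> supp g v0" "b \<in> supp g v0" and v: "v \<in> V" and eq: "cl a v = cl b v" for a b v
  proof (cases "v = v0")
    case True
    then show ?thesis using cl[OF v ab(1)] cl[OF v ab(2)] eq by simp
  next
    case False
    then have "dir H True a (cl a v)" "dir H True b (cl a v)" using cl[OF v ab(1)] cl[OF v ab(2)] eq by auto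
    then show ?thesis using F_match'[of v0 v a b "cl a v" True] v0 v V(1) supp_X ab cl[OF v ab(1)] by blast
  qed
  have clsurj: "\<exists>a\<in>supp g v0. x = cl a v" if v: "v \<in> V" and x: "x \<in> supp g v" for v x
  proof (cases "v = v0")
    case True
    then show ?thesis using cl[OF v, of x] x by metis
  next
    case False
    obtain a where a: "a \<in> supp g v0" "dir H True a x"
      using blk_arc(5)[OF V v0 v EE[OF v0 v False[symmetric], of True] x] by blast
    have "dir H True a (cl a v)" using cl[OF v a(1)] False by blast
    then have "x = cl a v" using F_match[of v0 v a x "cl a v" True] a v0 v V(1) supp_X x cl[OF v a(1)] by blast
    then show ?thesis using a by blast
  qed
  show ?thesis
  proof (rule constructible_complete[where p = p and t = "\<lambda>i. cl (e i)" and k = "\<lambda>i. g True (e i)"])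
    show "V \<subseteq> pverts D" "V \<noteq> {}" "1 \<le> p" using V v0 p by auto
    show "cl (e i) v \<in> X v" if "i \<in> {1..p}" "v \<in> V" for i v using cl[OF that(2) ein[OF that(1)]] supp_X by blast
    show "(cl (e i) u, cl (e i) v) \<in> parcs H" if "i \<in> {1..p}" "u \<in> V" "v \<in> V" "(u, v) \<in> parcs D" for i u v
      using clF[OF ein[OF that(1)] that(2,3)] that(4) pair_digraph_facts(5)[OF pdD] by (auto simp: dir_simps)
    show "cl (e i) v \<noteq> cl (e j) v" if "i \<in> {1..p}" "j \<in> {1..p}" "i \<noteq> j" "v \<in> V" for i j v
      using clinj[OF ein[OF that(1)] ein[OF that(2)] that(4)] that e unfolding bij_betw_def inj_on_def by blast
    show "g s (cl (e i) v) = g True (e i)" if "i \<in> {1..p}" "v \<in> V" for i v s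
      using clval[OF ein[OF that(1)] that(2)] .
    have dgv: "dg V s v0 = card V - 1" for s
      using dg_complete[OF V(1) cs(1) _ v0] cpl by blast
    show "1 \<le> g True (e i)" if "i \<in> {1..p}" for i
      using supp_pos[OF V v0 ein[OF that], of True] dgv c4 by simp
    have "(\<Sum>i = 1..p. g True (e i)) = sum (g True) (supp g v0)"
      using sum.reindex_bij_betw[OF e] by blast
    then show "(\<Sum>i = 1..p. g True (e i)) = card V - 1" using sum_supp[OF V v0] dgv by simp
    show "g s x = 0" if v: "v \<in> V" "x \<in> X v" and n: "\<And>i. i \<in> {1..p} \<Longrightarrow> x \<noteq> cl (e i) v" for v x s
    proof (rule ccontr)
      assume "g s x \<noteq> 0"
      then obtain a where "a \<in> supp g v0" "x = cl a v" using clsurj[OF v(1)] supp_I[OF v(2), of g s] by auto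
      then show False using n e unfolding bij_betw_def by (metis imageE)
    qed
    show "(u, v) \<in> parcs D" if "u \<in> V" "v \<in> V" "u \<noteq> v" for u v using EE[OF that, of True] by (simp add: dir_simps)
  qed
qed

lemma subH_union:
  assumes V: "V \<subseteq> pverts D" and T: "T \<subseteq> \<Union>(X ` V)"
  shows "pverts (induce (subH V) T) = T" "(x, y) \<in> parcs (induce (subH V) T) \<longleftrightarrow> x \<in> T \<and> y \<in> T \<and> (x, y) \<in> parcs H"
  using T subH_simps[OF V] unfolding induce_def by auto

text \<open>For odd length the labels of \<open>cycle_label\<close> return to themselves and give
  two saturated transversals; for even length they form the double cycle of
  \<open>cyclic_double\<close>. Independently of this, the cycle is bidirected or consists of
  sources and sinks, and the latter forces even length.\<close>

lemma constructible_blk_cycle: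
  assumes V: "V \<subseteq> pverts D" "blk V" "ucf V g" and mu: "multi V g" and nb2': "\<forall>u\<in>V. card (nb V u) = 2"
  shows "constructible (subD V) X (subH V) (unweight g)"
proof -
  note cs = cycle_struct[OF V mu nb2']
  note R = cycle_Fadj[OF V mu nb2']
  have fin: "finite V" using finite_sub V by blast
  have k: "2 \<le> card (supp g v)" if "v \<in> V" for v using mu that unfolding multi_def by blast
  have n3: "3 \<le> card V" using card_ge3_of_supp[OF V mu] .
  define n where "n = card V"
  have n3: "3 \<le> n" "2 \<le> n" using n3 unfolding n_def by auto
  obtain c where c: "bij_betw c {..<n} V"
    and nbc: "\<And>i. i < n \<Longrightarrow> nb V (c i) = {c (Suc i mod n), c ((i + n - 1) mod n)}"
    unfolding n_def using cyclic_enumeration[OF blk_conn(1)[OF V(2)] fin n3(1)[unfolded n_def] nb2'] by metis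
  have cyc: "cyclic_enum V adj n c" using cyclic_adj[OF c nbc n3(2)] .
  obtain l where sl: "\<And>i. i < n \<Longrightarrow> supp g (c i) = {l i True, l i False}"
    and ne: "\<And>i. i < n \<Longrightarrow> l i True \<noteq> l i False"
    and Rl: "\<And>i b. Suc i < n \<Longrightarrow> Fadj (l i b) (l (Suc i) b)"
    and cl: "\<And>b. Fadj (l (n - 1) b) (l 0 (b = odd n))"
    using cycle_label[OF V mu nb2' c nbc] by metis
  define t where "t = (\<lambda>b v. l (inv_into {..<n} c v) b)"
  have tc: "t b (c i) = l i b" if "i < n" for b i
    using that c unfolding t_def bij_betw_def by (simp add: inv_into_f_f)
  have Vc: "\<exists>i<n. v = c i" if "v \<in> V" for v using c that unfolding bij_betw_def by auto
  have st: "supp g v = {t True v, t False v}" "t True v \<noteq> t False v" if "v \<in> V" for v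
    using Vc[OF that] sl ne tc by auto
  have tin: "t b v \<in> supp g v" if "v \<in> V" for b v using st[OF that] by (cases b) auto
  have tX: "t b v \<in> X v" if "v \<in> V" for b v using supp_X[OF tin[OF that]] .
  let ?T = "\<lambda>b. t b ` V"
  let ?U = "?T True \<union> ?T False"
  let ?HT = "induce (subH V) ?U"
  have Tu: "?U = (\<Union>v\<in>V. supp g v)" using st(1) by auto
  have TX: "?U \<subseteq> \<Union>(X ` V)" using tX by blast
  have disj: "?T True \<inter> ?T False = {}"
  proof -
    have False if "u \<in> V" "v \<in> V" "t True u = t False v" for u v
    proof -
      have "u = v" using X_disj[of u v "t True u"] tX[OF that(1), of True] tX[OF that(2), of False] that V(1) by auto
      then show False using that st by auto
    qed
    then show ?thesis by auto
  qed
  have TrS: "transversal (subD V) X (subH V) (?T b)" for b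
    unfolding transversal_def subD_simps(1)[OF V(1)] subH_simps(1)[OF V(1)]
    using image_transversal[OF V(1) tX] by simp
  have inT: "x \<in> supp g v" if "v \<in> V" "x \<in> X v" "x \<in> ?U" for x v
  proof -
    from that(3) obtain u where u: "u \<in> V" "x \<in> supp g u" unfolding Tu by blast
    then have "u = v" using X_disj[of u v x] supp_X that V(1) by blast
    then show ?thesis using u by simp
  qed
  have outT: "g s x = 0" if "x \<in> \<Union>(X ` V) - ?U" for x s
    using that supp_I[of x _ g s] unfolding Tu by blast
  have out: "\<forall>x\<in>pverts (subH V) - ?U. unweight g x = (0, 0)"
    unfolding subH_simps(1)[OF V(1)] unweight_def using outT by blast
  note cfg = configuration_sub[OF V(1)]
  have HT: "pverts ?HT = ?U"
    "(x, y) \<in> parcs ?HT \<longleftrightarrow>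
      x \<in> ?U \<and> y \<in> ?U \<and> (x, y) \<in> parcs H" for x y
    using subH_union[OF V(1) TX] by auto
  have dbl: "cyclic_enum (pverts ?HT) Fadj (2 * n) (\<lambda>k. l (k mod n) (k < n))"
    if "even n"
    by (subst HT(1), subst Tu, rule cyclic_double[OF V mu nb2' cyc that n3(2) sl ne Rl cl])
  have FT: "\<exists>u v. u \<in> V \<and> v \<in> V \<and> x \<in> supp g u \<and> y \<in> supp g v"
    if "x \<in> ?U" "y \<in> ?U" for x y using that unfolding Tu by blast
  have Firr: "\<not> Fadj x x" if "x \<in> ?U" for x
    using that F_irrefl supp_X V(1) unfolding Tu Fadj_def by blast
  show ?thesis using cs(5)
  proof
    assume all: "\<forall>u\<in>V. \<forall>s. dg V s u \<noteq> 0"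
    have EE: "dir D s u v" if "u \<in> V" "v \<in> V" "adj u v" for s u v using cs(4) all that by blast
    have FF: "dir H s x y" if "u \<in> V" "v \<in> V" "x \<in> supp g u" "y \<in> supp g v" "Fadj x y" for s u v x y
    proof -
      have "adj u v" using Fadj_adj[of u v x y] that supp_X V(1) by blast
      then show ?thesis using R(3)[OF that(1-4) EE that(5)] that by blast
    qed
    have one: "g s x = 1" if "u \<in> V" "x \<in> supp g u" for s u x using cs(3) all that by blast
    have val: "\<forall>x\<in>?U. unweight g x = (1, 1)"
      unfolding Tu unweight_def using one by blast
    have cycD: "bidirected_cycle n (subD V)"
    proof (rule bidirected_cycleI[OF n3(1), where A = adj and c = c], unfold subD_simps[OF V(1)])
      fix u v
      show "cyclic_enum V adj n c" by (rule cyc)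
      show "u \<in> V \<and> v \<in> V" if "u \<in> V \<and> v \<in> V \<and> (u, v) \<in> parcs D" using that by blast
      show "(u \<in> V \<and> v \<in> V \<and> (u, v) \<in> parcs D) = adj u v" if "u \<in> V" "v \<in> V"
        using that EE[OF that, of True] unfolding adj_def by (metis dir_simps(1))
      show "adj u v = adj v u" using adj_sym by blast
      show "\<not> adj u u" by (rule adj_irrefl)
    qed
    show ?thesis
    proof (cases "odd n")
      case True
      have cl': "Fadj (l (n - 1) b) (l 0 b)" for b using cl[of b] True by simp
      have step: "Fadj (l i b) (l (Suc i mod n) b)" if "i < n" for i b
      proof (cases "Suc i < n")
        case False
        then have "Suc i = n" using that by simp
        then show ?thesis using cl'[of b] by auto
      qed (use Rl in auto)
      have sat: "(t b u, t b v) \<in> parcs H" if uv: "u \<in> V" "v \<in> V" "(u, v) \<in> parcs D" for b u v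
      proof -
        have a: "adj u v" using uv(3) unfolding adj_def by (metis dir_simps(1))
        obtain i j where ij: "i < n" "u = c i" "j < n" "v = c j" using Vc uv by blast
        have "j = Suc i mod n \<or> i = Suc j mod n" using cyclic_enum_cases[OF cyc ij(1,3)] a ij by blast
        then have "Fadj (t b u) (t b v)"
          using step[OF ij(1), of b] Fadj_sym[OF step[OF ij(3), of b]] tc ij by auto
        then show ?thesis using FF[OF uv(1,2) tin[OF uv(1)] tin[OF uv(2)], of b b True] by (simp add: dir_simps)
      qed
      show ?thesis
      proof (cases "n = 3")
        case False
        then have n5: "5 \<le> n" using True n3(1) by presburger
        show ?thesis
          by (rule constructible.odd_cycle[OF cfg n5 True cycD TrS TrS disj _ _ val out])
            (use saturated_image[OF V(1) tX sat] in auto)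
      next
        case n3: True
        \<comment> \<open>A triangle is complete, with the two labels as transversals and weights
          \<open>1 + 1 = 3 - 1\<close>.\<close>
        have cpl: "adj u v" if "u \<in> V" "v \<in> V" "u \<noteq> v" for u v
        proof -
          have "nb V u \<subseteq> V - {u}" using adj_irrefl unfolding nb_def by auto
          moreover have "card (V - {u}) = 2" using n3 that fin unfolding n_def by simp
          ultimately have "nb V u = V - {u}" using nb2' that fin by (intro card_subset_eq) auto
          then show ?thesis using that unfolding nb_def by blast
        qed
        show ?thesis
        proof (rule constructible_complete[where p = 2 and t = "\<lambda>i. t (i = 1)" and k = "\<lambda>i. 1"])
          show "V \<subseteq> pverts D" "V \<noteq> {}" using V n3 unfolding n_def by auto
          show "t (i = 1) v \<noteq> t (j = 1) v" if "i \<in> {1..2}" "j \<in> {1..2}" "i \<noteq> j" "v \<in> V" for i j :: nat and v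
          proof -
            have "(i = 1) \<noteq> (j = 1)" using that by auto
            then show ?thesis using st(2)[OF that(4)] by (cases "i = 1"; cases "j = 1") auto
          qed
          show "(\<Sum>i = 1..2::nat. 1) = card V - 1" using n3 unfolding n_def by simp
          show "g s x = 0" if v: "v \<in> V" "x \<in> X v" and n: "\<And>i. i \<in> {1..2::nat} \<Longrightarrow> x \<noteq> t (i = 1) v" for v x s
          proof (rule ccontr)
            assume "g s x \<noteq> 0"
            then have "x \<in> supp g v" using supp_I[OF v(2), of g s] by simp
            then show False using st(1)[OF v(1)] n[of 1] n[of 2] by auto
          qed
          show "(u, v) \<in> parcs D" if "u \<in> V" "v \<in> V" "u \<noteq> v" for u v
            using EE[OF that(1,2) cpl[OF that], of True] by (simp add: dir_simps)
        qed (use tX sat one tin in auto)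
      qed
    next
      case False
      then have ev: "even n" by simp
      then have n4: "4 \<le> n" using n3(1) by presburger
      have "bidirected_cycle (2 * n) ?HT"
      proof (rule bidirected_cycleI[OF _ dbl[OF ev]], unfold HT)
        show "3 \<le> 2 * n" using n3 by simp
        fix x y
        show "x \<in> ?U \<and> y \<in> ?U"
          if "x \<in> ?U \<and> y \<in> ?U \<and> (x, y) \<in> parcs H" using that by blast
        show "\<not> Fadj x x" if "x \<in> ?U" using Firr[OF that] .
        show "Fadj x y \<longleftrightarrow> Fadj y x" using Fadj_sym by blast
        assume xy: "x \<in> ?U" "y \<in> ?U"
        obtain u v where uv: "u \<in> V" "v \<in> V" "x \<in> supp g u" "y \<in> supp g v" using FT[OF xy] by blast
        show "(x \<in> ?U \<and> y \<in> ?U \<and> (x, y) \<in> parcs H) = Fadj x y"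
          using xy FF[OF uv, of True] unfolding Fadj_def by (metis dir_simps(1))
      qed
      then show ?thesis
        by (rule constructible.even_cycle[OF cfg n4 ev cycD TrS TrS disj _ val out])
    qed
  next
    assume ss: "\<forall>u\<in>V. \<exists>s. dg V s u = 0 \<and> dg V (\<not> s) u \<noteq> 0"
    have ev: "even n" using source_sink_cycle_even[OF V(1) cyc n3(2) ss] .
    then have n4: "4 \<le> n" using n3(1) by presburger
    have no: "\<not> dir D s u v" if "u \<in> V" "v \<in> V" "dg V s u = 0" for s u v
      using dg_pos[OF V(1) that(2), of s u] that(3) by auto
    \<comment> \<open>A colour has no arcs in a direction that its vertex lacks, so sources and
      sinks of \<open>D\<close> are inherited by the double cycle in \<open>H\<close>.\<close>
    have noF: "\<not> dir H s x y" if "u \<in> V" "x \<in> X u" "dg V s u = 0" "y \<in> \<Union>(X ` V)" for s u x y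
    proof
      assume F: "dir H s x y"
      from that(4) obtain v where "v \<in> V" "y \<in> X v" by blast
      then have "dir D s u v" using F_E[of u v x y s] F that V(1) by blast
      then show False using no[OF that(1) \<open>v \<in> V\<close> that(3)] by blast
    qed
    have src: "source (subD V) v \<longleftrightarrow> dg V False v = 0" if "v \<in> V" for v
    proof
      assume "source (subD V) v"
      then have "\<not> dir D False v u" if "u \<in> V" for u
        using that \<open>v \<in> V\<close> unfolding source_def in_arcs_def by (auto simp: subD_simps[OF V(1)] dir_simps)
      then show "dg V False v = 0" unfolding dg_def by (metis (no_types, lifting) Collect_empty_eq card.empty)
    next
      assume "dg V False v = 0"
      then have "(u, v) \<notin> parcs D" if "u \<in> V" for u using no[OF \<open>v \<in> V\<close> that] by (metis dir_simps(2))
      then show "source (subD V) v" unfolding source_def in_arcs_def by (auto simp: subD_simps[OF V(1)])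
    qed
    have snk: "sink (subD V) v \<longleftrightarrow> dg V True v = 0" if "v \<in> V" for v
    proof
      assume "sink (subD V) v"
      then have "\<not> dir D True v u" if "u \<in> V" for u
        using that \<open>v \<in> V\<close> unfolding sink_def out_arcs_def by (auto simp: subD_simps[OF V(1)] dir_simps)
      then show "dg V True v = 0" unfolding dg_def by (metis (no_types, lifting) Collect_empty_eq card.empty)
    next
      assume "dg V True v = 0"
      then have "(v, u) \<notin> parcs D" if "u \<in> V" for u using no[OF \<open>v \<in> V\<close> that] by (metis dir_simps(1))
      then show "sink (subD V) v" unfolding sink_def out_arcs_def by (auto simp: subD_simps[OF V(1)])
    qed
    have one0: "dg V False u = 0 \<and> dg V True u \<noteq> 0 \<or> dg V True u = 0 \<and> dg V False u \<noteq> 0" if "u \<in> V" for u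
      using bspec[OF ss that] by (metis (full_types))
    have antiD: "antidirected_cycle n (subD V)"
      unfolding antidirected_cycle_def
    proof
      show "cycle_ugraph n (underlying (subD V))"
        by (rule cycle_ugraph_underlying[OF n3(1), where A = adj and c = c])
          (use cyc in \<open>auto simp: subD_simps[OF V(1)] adj_def dir_def split: if_splits\<close>)
      show "\<forall>v\<in>pverts (subD V). source (subD V) v \<or> sink (subD V) v"
        unfolding subD_simps(1)[OF V(1)] using src snk one0 by blast
    qed
    have antiH: "antidirected_cycle (2 * n) ?HT"
      unfolding antidirected_cycle_def
    proof
      show "cycle_ugraph (2 * n) (underlying ?HT)"
      proof (rule cycle_ugraph_underlying[OF _ dbl[OF ev]], unfold HT)
        show "3 \<le> 2 * n" using n3 by simp
        fix x y
        show "x \<in> ?U \<and> y \<in> ?U"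
          if "x \<in> ?U \<and> y \<in> ?U \<and> (x, y) \<in> parcs H" using that by blast
        assume xy: "x \<in> ?U" "y \<in> ?U"
        have "Fadj x y \<longleftrightarrow> (x, y) \<in> parcs H \<or> (y, x) \<in> parcs H"
          unfolding Fadj_def dir_def by (auto split: if_splits)
        then show "Fadj x y \<longleftrightarrow> (x \<in> ?U \<and> y \<in> ?U \<and> (x, y) \<in> parcs H) \<or>
            (y \<in> ?U \<and> x \<in> ?U \<and> (y, x) \<in> parcs H)"
          using xy by blast
      qed
      show "\<forall>x\<in>pverts ?HT.
          source ?HT x \<or> sink ?HT x"
        unfolding HT(1)
      proof
        fix x assume "x \<in> ?U"
        then obtain u where u: "u \<in> V" "x \<in> X u" using tX by blast
        have arcT: "y \<in> \<Union>(X ` V) \<and> z \<in> \<Union>(X ` V) \<and> (y, z) \<in> parcs H"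
          if "(y, z) \<in> parcs ?HT" for y z
          using subsetD[OF TX, of y] subsetD[OF TX, of z] that HT(2)[of y z] by metis
        from one0[OF u(1)] show "source ?HT x \<or>
            sink ?HT x"
        proof (elim disjE conjE)
          assume d: "dg V False u = 0"
          have "(y, x) \<notin> parcs ?HT" for y
            using arcT noF[OF u d, of y] by (metis dir_simps(2))
          then have "source ?HT x" unfolding source_def in_arcs_def by auto
          then show ?thesis ..
        next
          assume d: "dg V True u = 0"
          have "(x, y) \<notin> parcs ?HT" for y
            using arcT noF[OF u d, of y] by (metis dir_simps(1))
          then have "sink ?HT x" unfolding sink_def out_arcs_def by auto
          then show ?thesis ..
        qed
      qed
    qed
    have val: "\<forall>v\<in>pverts (subD V). \<forall>x\<in>X v \<inter> ?U.
        (source (subD V) v \<longrightarrow> unweight g x = (1, 0)) \<and> (sink (subD V) v \<longrightarrow> unweight g x = (0, 1))"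
      unfolding subD_simps(1)[OF V(1)]
    proof (intro ballI)
      fix v x assume v: "v \<in> V" and x: "x \<in> X v \<inter> ?U"
      have xv: "x \<in> X v" using x by (rule IntD1)
      have xs: "x \<in> supp g v" by (rule inT[OF v xv]) (use x in \<open>rule IntD2\<close>)
      have "g s x = 1" if "dg V s v \<noteq> 0" for s using cs(3)[OF v that xs] .
      moreover have "g s x = 0" if "dg V s v = 0" for s using cs(2)[OF v that xv] .
      ultimately show "(source (subD V) v \<longrightarrow> unweight g x = (1, 0)) \<and> (sink (subD V) v \<longrightarrow> unweight g x = (0, 1))"
        unfolding src[OF v] snk[OF v] unweight_def using one0[OF v] by auto
    qed
    show ?thesis
      by (rule constructible.antidirected[OF cfg n4 ev antiD TrS TrS disj antiH val out])
  qed
qed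

text \<open>Feasibility provides colours when there are at least two vertices; for a single vertex,
  of degree zero, their existence has to be asked for separately.\<close>

lemma constructible_connected:
  assumes "V \<subseteq> pverts D" "conn V" "ucf V g" "2 \<le> card V \<or> (\<forall>v\<in>V. X v \<noteq> {})"
  shows "constructible (subD V) X (subH V) (unweight g)"
  using assms
proof (induction "card V" arbitrary: V g rule: less_induct)
  case less
  note V = less.prems(1-3)
  have fin: "finite V" using finite_sub V by blast
  show ?case
  proof (cases "2 \<le> card V")
    case False
    have "0 < card V" using V(2) fin unfolding conn_def by (simp add: card_gt_0_iff)
    then have "card V = 1" using False by simp
    then obtain v where v: "V = {v}" by (rule card_1_singletonE)
    then obtain x where "x \<in> X v" using less.prems(4) False by blast
    then show ?thesis using constructible_single[of v g x] V unfolding v by simp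
  next
    case c2: True
    show ?thesis
    proof (cases "blk V")
      case True
      note VB = V(1) True V(3)
      show ?thesis
      proof (cases "multi V g")
        case mu: True
        show ?thesis using complete_or_cycle_IH[OF VB mu all_hered[OF V(1)]]
          constructible_blk_complete[OF VB mu] constructible_blk_cycle[OF VB mu] by blast
      next
        case False
        then obtain w where w: "w \<in> V" "\<not> 2 \<le> card (supp g w)" unfolding multi_def by blast
        have "card (supp g v) = 1" if "v \<in> V" for v
          using card_supp_const[OF VB that w(1)] card_supp_pos[OF VB that] w(2) by simp
        then show ?thesis using constructible_blk1[OF VB] by blast
      qed
    next
      case False
      then obtain c where c: "c \<in> V" "\<not> conn (V - {c})" using V(2) c2 unfolding blk_def by blast
      have "V - {c} \<noteq> {}"
      proof
        assume "V - {c} = {}"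
        then have "card V \<le> card {c}" by (intro card_mono) auto
        then show False using c2 by simp
      qed
      then obtain C where C: "piece V c C" using not_conn_piece[OF c(1) _ c(2)] by blast
      let ?V1 = "insert c C" and ?V2 = "insert c (V - {c} - C)"
      have CC: "C \<subseteq> V - {c}" "C \<noteq> {}" "V - {c} - C \<noteq> {}" "\<And>u v. u \<in> C \<Longrightarrow> v \<in> V - {c} - C \<Longrightarrow> \<not> adj u v"
        using C unfolding piece_def by blast+
      have cn: "conn ?V1" "conn ?V2"
        using piece_conn_insert[OF V(2) C] piece_conn_insert[OF V(2) piece_compl[OF C]] by auto
      have Veq: "V = ?V1 \<union> ?V2" "?V1 \<inter> ?V2 = {c}" using CC(1) c(1) by auto
      have na: "\<not> adj u v" if "u \<in> ?V1 - {c}" "v \<in> ?V2 - {c}" for u v using CC(4) that by blast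
      note s1 = split_cut(1)[OF V(1) Veq na cn V(3)]
      note s2 = split_cut(2)[OF V(1) Veq na cn V(3)]
      have s3: "g s x = part g ?V1 c s x + part g ?V2 c s x" if "x \<in> X c" for s x
        by (rule split_cut(3)[OF V(1) Veq na cn V(3) that])
      have sub: "?V1 \<subset> V" "?V2 \<subset> V" using CC c(1) by auto
      have lt: "card ?V1 < card V" "card ?V2 < card V" using psubset_card_mono[OF fin] sub by auto
      \<comment> \<open>Each part contains \<open>c\<close> and a further vertex, so it never
        shrinks to a single vertex and the last premise is inherited.\<close>
      have two: "2 \<le> card (insert c B)" if "B \<noteq> {}" "B \<subseteq> V - {c}" for B
      proof -
        have "finite B" "c \<notin> B" using that fin finite_subset by auto
        then show ?thesis using that(1) by (simp add: Suc_leI card_gt_0_iff)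
      qed
      have c1: "constructible (subD ?V1) X (subH ?V1) (unweight (part g ?V1 c))"
        by (rule less.hyps[OF lt(1) _ cn(1)]) (use sub V(1) s1 two CC in auto)
      have c2: "constructible (subD ?V2) X (subH ?V2) (unweight (part g ?V2 c))"
        by (rule less.hyps[OF lt(2) _ cn(2)]) (use sub V(1) s2 two CC in auto)
      show ?thesis
      proof (rule constructible_merge[OF V(1) Veq _ lt c1 c2])
        show "\<not> adj u v" if "u \<in> ?V1 - {c}" "v \<in> ?V2 - {c}" for u v using na[OF that] .
        show "g s x = part g ?V1 c s x + part g ?V2 c s x" if "x \<in> X c" for s x using s3[OF that] .
      qed (simp_all add: part_def)
    qed
  qed
qed

end

theorem theorem22:
  fixes D :: "'a pair_pre_digraph" and X :: "'a \<Rightarrow> 'b set"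
    and H :: "'b pair_pre_digraph" and f :: "'b \<Rightarrow> nat \<times> nat"
  assumes "configuration D X H"
    and "pverts H \<noteq> {}"
    and "degree_feasible D X f"
    and "uncolorable D X H f"
    and "Digraph_Component.connected D"
  shows "constructible D X H f"
proof -
  interpret dicover D X H by unfold_locales (rule assms(1))
  have "conn (pverts D)" using connected_subD[OF subset_refl] assms(5) subD_all by simp
  moreover have "ucf (pverts D) (weight f)"
    unfolding ucf_def using feas_weight[OF assms(3)] col_colorable assms(4) by blast
  moreover have "2 \<le> card (pverts D) \<or> (\<forall>v\<in>pverts D. X v \<noteq> {})"
  proof (rule disjCI)
    assume "\<not> (\<forall>v\<in>pverts D. X v \<noteq> {})"
    then obtain v where v: "v \<in> pverts D" "X v = {}" by blast
    \<comment> \<open>A vertex without colours cannot be the only vertex, because \<open>H\<close>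
      is not empty.\<close>
    have "(\<Union>v\<in>pverts D. X v) \<noteq> {}" using assms(2) cov unfolding cover_def by blast
    then obtain u where "u \<in> pverts D" "X u \<noteq> {}" by blast
    then have "u \<noteq> v" "{u, v} \<subseteq> pverts D" using v by auto
    moreover from this have "card {u, v} = 2" by simp
    ultimately show "2 \<le> card (pverts D)" using finite_V0 card_mono by metis
  qed
  ultimately have "constructible (subD (pverts D)) X (subH (pverts D)) (unweight (weight f))"
    using constructible_connected by blast
  then show ?thesis unfolding subD_all subH_all unweight_weight .
qed

end
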